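(* There holds the following sharp bound: $$|\mathcal{E}_4(f_1,f_2,f_3,f_4)|\le\frac{1}{\sqrt{2\pi}}\prod_{k=1}^4\|f_k\|_{L^2},$$ with equality if and only if the functions $f_k$ are the same Gaussian $f_k(x)=e^{-\frac12x^2+\beta x}$ for some $\beta\in\mathbb{C}$. In particular, with $\mathcal{H}_4(f)=\mathcal{E}_4(f,f,f,f)$, there holds $\mathcal{H}_4(f)\le\frac{1}{\sqrt{2\pi}}\|f\|_{L^2}^4$, with equality if and only if $f(x)=e^{-\frac12x^2+\beta x}$ for some $\beta\in\mathbb{C}$.
   Context: The functions $f,f_1,\dots,f_4$ are in $L^2(\mathbb{R}\to\mathbb{C})$. $H=-\Delta+x^2$ on $L^2(\mathbb{R})$, and $e^{itH}$ is the unitary propagator of $iu_t+Hu=0$ (so $e^{itH}\phi_n=e^{it(2n+1)}\phi_n$ for the Hermite functions $\phi_n$, $H\phi_n=(2n+1)\phi_n$). The functional is $$\mathcal{E}_4(f_1,f_2,f_3,f_4)=\frac{2}{\pi}\int_0^{\pi/2}\int_{\mathbb{R}}(e^{itH}f_1)(e^{itH}f_2)\overline{(e^{itH}f_3)(e^{itH}f_4)}\,dx\,dt.$$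
   Formalization: Equality is characterized up to scalars: f_k = c_k e^{-x²/2+βx} a.e. with common β and arbitrary complex c_k, or some f_k = 0 a.e. (for H_4: f = c e^{-x²/2+βx}), since the printed iff fails for scalar multiples and zero functions. *)

theory Defs
  imports "HOL-Analysis.Analysis"
begin

text \<open>Elements of \<open>L\<^sup>2(\<real> \<rightarrow> \<complex>)\<close> are represented by Borel functions; identities between
  them are stated almost everywhere.\<close>

definition L2 :: "(real \<Rightarrow> complex) \<Rightarrow> bool" where
  "L2 f \<longleftrightarrow> f \<in> borel_measurable lborel \<and> integrable lborel (\<lambda>x. (cmod (f x))\<^sup>2)"

definition L2_norm :: "(real \<Rightarrow> complex) \<Rightarrow> real" where
  "L2_norm f = sqrt (LINT x|lborel. (cmod (f x))\<^sup>2)"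

definition deriv1 :: "(real \<Rightarrow> complex) \<Rightarrow> real \<Rightarrow> complex" where
  "deriv1 f x = vector_derivative f (at x)"

definition osc :: "(real \<Rightarrow> complex) \<Rightarrow> real \<Rightarrow> complex" where
  "osc f x = - deriv1 (deriv1 f) x + (of_real x)\<^sup>2 * f x"

text \<open>Functions on which \<open>H = - \<Delta> + x\<^sup>2\<close> acts by classical differentiation. They contain
  the Schwartz functions, in particular the Hermite functions, and \<open>H\<close> is essentially
  self-adjoint on them, so they determine \<open>H\<close> as a self-adjoint operator.\<close>

definition osc_core :: "(real \<Rightarrow> complex) set" where
  "osc_core = {f. (\<forall>x. f differentiable at x) \<and> (\<forall>x. deriv1 f differentiable at x) \<and>
                continuous_on UNIV (deriv1 (deriv1 f)) \<and> L2 f \<and> L2 (osc f)}"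

text \<open>\<open>U t\<close> is \<open>e\<^bsup>itH\<^esup>\<close>: a strongly continuous one-parameter group of unitary operators on
  \<open>L\<^sup>2\<close> (surjectivity of \<open>U t\<close> comes from the group law) for which \<open>u(t) = U t f\<close> solves
  \<open>i u\<^sub>t + H u = 0\<close>. By the group law the equation is only needed at \<open>t = 0\<close>, where the
  time derivative is the limit in \<open>L\<^sup>2\<close> of difference quotients. By Stone's theorem there is
  exactly one such \<open>U\<close>, up to equality almost everywhere of \<open>U t f\<close> for each \<open>t\<close> and \<open>f\<close>.\<close>

definition is_propagator :: "(real \<Rightarrow> (real \<Rightarrow> complex) \<Rightarrow> real \<Rightarrow> complex) \<Rightarrow> bool" where
  "is_propagator U \<longleftrightarrow>
     (\<forall>t f. L2 f \<longrightarrow> L2 (U t f) \<and> L2_norm (U t f) = L2_norm f) \<and>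
     (\<forall>t f g a b. L2 f \<longrightarrow> L2 g \<longrightarrow>
        (AE x in lborel. U t (\<lambda>y. a * f y + b * g y) x = a * U t f x + b * U t g x)) \<and>
     (\<forall>f. L2 f \<longrightarrow> (AE x in lborel. U 0 f x = f x)) \<and>
     (\<forall>s t f. L2 f \<longrightarrow> (AE x in lborel. U (s + t) f x = U s (U t f) x)) \<and>
     (\<forall>f. L2 f \<longrightarrow> ((\<lambda>h. L2_norm (\<lambda>x. U h f x - f x)) \<longlongrightarrow> 0) (at 0)) \<and>
     (\<forall>f\<in>osc_core.
        ((\<lambda>h. L2_norm (\<lambda>x. \<i> * ((U h f x - f x) / of_real h) + osc f x)) \<longlongrightarrow> 0) (at 0))"

definition E4 :: "(real \<Rightarrow> (real \<Rightarrow> complex) \<Rightarrow> real \<Rightarrow> complex) \<Rightarrow> (real \<Rightarrow> complex) \<Rightarrow>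
    (real \<Rightarrow> complex) \<Rightarrow> (real \<Rightarrow> complex) \<Rightarrow> (real \<Rightarrow> complex) \<Rightarrow> complex" where
  "E4 U f1 f2 f3 f4 = of_real (2 / pi) *
     (LINT t:{0..pi/2}|lborel. LINT x|lborel. U t f1 x * U t f2 x * cnj (U t f3 x * U t f4 x))"

definition H4 :: "(real \<Rightarrow> (real \<Rightarrow> complex) \<Rightarrow> real \<Rightarrow> complex) \<Rightarrow> (real \<Rightarrow> complex) \<Rightarrow> complex" where
  "H4 U f = E4 U f f f f"

definition gaussian :: "complex \<Rightarrow> real \<Rightarrow> complex" where
  "gaussian \<beta> x = exp (- (of_real x)\<^sup>2 / 2 + \<beta> * of_real x)"

text \<open>The sides of the inequality are homogeneous in each function, so an extremiser is only
  determined up to scalar factors, and both sides vanish as soon as one of the functions does.\<close>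

definition gaussian_multiple :: "complex \<Rightarrow> (real \<Rightarrow> complex) \<Rightarrow> bool" where
  "gaussian_multiple \<beta> f \<longleftrightarrow> (\<exists>c. AE x in lborel. f x = c * gaussian \<beta> x)"

end

theory Submission
  imports Defs "HOL-Probability.Probability"
begin

text \<open>In the Hermite basis the propagator multiplies the \<open>n\<close>-th coefficient by \<open>e\<^bsup>i(2n+1)t\<^esup>\<close>, so in a
  product \<open>(U t f)(U t g)\<close> only the energy level \<open>N\<close> formed by the pairs \<open>i + j = N\<close> carries a
  common phase, and integrating \<open>\<bar>(U t f)(U t g)\<bar>\<^sup>2\<close> over \<open>[0, \<pi>/2]\<close> decouples the levels
  (levels of different parity decouple by reflection in \<open>x\<close>). On one level, the tensor
  \<open>\<Sum> A\<^sub>i h\<^sub>i(x) h\<^bsub>N-i\<^esub>(y)\<close> is an orthogonal combination \<open>\<Sum> a\<^sub>m h\<^sub>m(u) h\<^bsub>N-m\<^esub>(v)\<close> in the rotated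
  coordinates \<open>u, v = (x \<plusminus> y) / \<surd>2\<close>, and its restriction to the diagonal \<open>v = 0\<close> has squared norm
  \<open>\<Sum> \<bar>a\<^sub>m\<bar>\<^sup>2 h\<^bsub>N-m\<^esub>(0)\<^sup>2 / \<surd>2\<close>. As \<open>h\<^sub>n(0)\<^sup>2\<close> is strictly largest at \<open>n = 0\<close>, this gives the sharp constant
  together with a defect controlling all \<open>a\<^sub>m\<close>, \<open>m < N\<close>.

  The quadrilinear bound follows by Cauchy--Schwarz for any splitting of the four functions into
  two pairs. In the case of equality the defect of each pair vanishes on every level, so
  \<open>\<surd>(i!) f\<^sub>i \<surd>(j!) g\<^sub>j\<close> depends only on \<open>i + j\<close>. Hence both coefficient sequences are
  \<open>c z\<^sup>n / \<surd>(n!)\<close> with a common \<open>z\<close>, which are the coefficients of Gaussians. Conversely the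
  propagator maps Gaussians to multiples of Gaussians, for which the integrals are explicit.\<close>

subsection \<open>Square integrable functions\<close>

text \<open>\<open>is_propagator\<close> pins \<open>U\<close> down only through its derivative at
  time 0 on \<open>osc_core\<close>, and only up to null sets that may depend on t. Hence the action
  on Hermite coefficients has to be derived, which requires the completeness of the Hermite
  functions; this comes from the uniqueness of Fourier transforms.

  The constant 1 / sqrt (2 pi) is the square of \<open>hermite 0 0\<close>, namely 1 / sqrt pi,
  times the factor 1 / sqrt 2 from dx = du / sqrt 2 on the diagonal. The next largest value at 0 is
  attained at n = 2 and is half as large, so at least half of the defect of every level is lost in
  the bound. The defect of one fixed level M involves finitely many coefficients only, which is why
  it survives the limit; letting M vary afterwards yields all levels.\<close>

lemma L2_measurable [measurable_dest]: "L2 f \<Longrightarrow> f \<in> borel_measurable borel"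
  by (simp add: L2_def)

lemma L2_square_integrable: "L2 f \<Longrightarrow> integrable lborel (\<lambda>x. (cmod (f x))\<^sup>2)"
  by (simp add: L2_def)

lemma L2_norm_nonneg [simp]: "0 \<le> L2_norm f"
  by (simp add: L2_norm_def)

lemma L2_norm_power2: "(L2_norm f)\<^sup>2 = (LINT x|lborel. (cmod (f x))\<^sup>2)"
  by (simp add: L2_norm_def)

lemma nn_integral_L2: "L2 f \<Longrightarrow> (\<integral>\<^sup>+x. ennreal ((cmod (f x))\<^sup>2) \<partial>lborel) = ennreal ((L2_norm f)\<^sup>2)"
  by (simp add: L2_norm_power2 nn_integral_eq_integral L2_square_integrable)

lemma L2_I_nn_integral:
  assumes "f \<in> borel_measurable lborel" "(\<integral>\<^sup>+x. ennreal ((cmod (f x))\<^sup>2) \<partial>lborel) < \<infinity>"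
  shows "L2 f"
  using assms unfolding L2_def by (auto intro!: integrableI_nonneg)

lemma L2_norm_cong_AE:
  assumes "f \<in> borel_measurable lborel" "g \<in> borel_measurable lborel" "AE x in lborel. f x = g x"
  shows "L2_norm f = L2_norm g"
proof -
  have "(LINT x|lborel. (cmod (f x))\<^sup>2) = (LINT x|lborel. (cmod (g x))\<^sup>2)"
    using assms by (intro integral_cong_AE) auto
  then show ?thesis by (simp add: L2_norm_def)
qed

lemma cmod_add_square_le: "(cmod (a + b))\<^sup>2 \<le> 2 * (cmod a)\<^sup>2 + 2 * (cmod b)\<^sup>2"
proof -
  have "(cmod (a + b))\<^sup>2 \<le> (cmod a + cmod b)\<^sup>2"
    by (intro power_mono norm_triangle_ineq) auto
  also have "\<dots> \<le> 2 * (cmod a)\<^sup>2 + 2 * (cmod b)\<^sup>2"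
    using sum_squares_bound[of "cmod a" "cmod b"] by (simp add: power2_sum)
  finally show ?thesis .
qed

lemma L2_add: assumes "L2 f" "L2 g" shows "L2 (\<lambda>x. f x + g x)"
  unfolding L2_def
proof
  show "(\<lambda>x. f x + g x) \<in> borel_measurable lborel"
    using assms[THEN L2_measurable] by auto
  have "integrable lborel (\<lambda>x. 2 * (cmod (f x))\<^sup>2 + 2 * (cmod (g x))\<^sup>2)"
    using assms[THEN L2_square_integrable] by auto
  then show "integrable lborel (\<lambda>x. (cmod (f x + g x))\<^sup>2)"
    using assms[THEN L2_measurable] cmod_add_square_le
    by (elim Bochner_Integration.integrable_bound) auto
qed

lemma L2_cmult: "L2 f \<Longrightarrow> L2 (\<lambda>x. c * f x)"
  by (auto simp: L2_def norm_mult power_mult_distrib)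

lemma L2_diff: "L2 f \<Longrightarrow> L2 g \<Longrightarrow> L2 (\<lambda>x. f x - g x)"
  using L2_add[of f "\<lambda>x. (-1) * g x"] L2_cmult[of g "-1"] by simp

lemma L2_zero: "L2 (\<lambda>x. 0)"
  by (simp add: L2_def)

lemma L2_sum: "(\<And>i. i \<in> I \<Longrightarrow> L2 (f i)) \<Longrightarrow> L2 (\<lambda>x. \<Sum>i\<in>I. f i x)"
  by (induction I rule: infinite_finite_induct) (auto intro: L2_add L2_zero)

lemma L2_norm_cmult: "L2_norm (\<lambda>x. c * f x) = cmod c * L2_norm f"
  by (simp add: L2_norm_def norm_mult power_mult_distrib real_sqrt_mult)

lemma L2_norm_uminus: "L2_norm (\<lambda>x. - f x) = L2_norm f"
  by (simp add: L2_norm_def)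

lemma L2_mult_integrable:
  assumes "L2 f" "L2 g" shows "integrable lborel (\<lambda>x. f x * g x)"
proof (rule Bochner_Integration.integrable_bound)
  show "integrable lborel (\<lambda>x. (cmod (f x))\<^sup>2 + (cmod (g x))\<^sup>2)"
    using assms by (auto dest: L2_square_integrable)
  have "cmod a * cmod b \<le> (cmod a)\<^sup>2 + (cmod b)\<^sup>2" for a b :: complex
    using sum_squares_bound[of "cmod a" "cmod b"] mult_nonneg_nonneg[of "cmod a" "cmod b", OF norm_ge_zero norm_ge_zero]
    by (simp only: mult.assoc)
  then show "AE x in lborel. norm (f x * g x) \<le> norm ((cmod (f x))\<^sup>2 + (cmod (g x))\<^sup>2)"
    by (simp add: norm_mult)
qed (use assms[THEN L2_measurable] in auto)

lemma L2_cnj: "L2 f \<Longrightarrow> L2 (\<lambda>x. cnj (f x))"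
  unfolding L2_def
  by (auto intro: borel_measurable_continuous_on[of cnj] continuous_intros)

lemma L2_norm_power2_add:
  assumes "L2 f" "L2 g"
  shows "(L2_norm (\<lambda>x. f x + g x))\<^sup>2
    = (L2_norm f)\<^sup>2 + (L2_norm g)\<^sup>2 + 2 * Re (LINT x|lborel. cnj (g x) * f x)"
proof -
  have i: "integrable lborel (\<lambda>x. cnj (g x) * f x)"
    using L2_mult_integrable[OF L2_cnj[OF assms(2)] assms(1)] .
  have e: "(cmod (a + b))\<^sup>2 = (cmod a)\<^sup>2 + (cmod b)\<^sup>2 + 2 * Re (cnj b * a)" for a b
    by (simp add: cmod_power2 power2_sum algebra_simps)
  have "integrable lborel (\<lambda>x. Re (cnj (g x) * f x))" using integrable_Re[OF i] .
  then show ?thesis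
    unfolding L2_norm_power2 e integral_Re[OF i, symmetric]
    using assms[THEN L2_square_integrable] \<open>integrable lborel (\<lambda>x. Re (cnj (g x) * f x))\<close> by (simp del: times_complex.simps)
qed

section \<open>Cauchy-Schwarz and the triangle inequality\<close>

text \<open>The infimum of the right-hand sides over s is a b, reached at s = b / a when both are
  positive. Keeping s free replaces square roots of integrals with values in [0, infinity] by a
  linear inequality, which can be integrated in x and then in t before s is optimised.\<close>

lemma ennreal_le_mult_by_weights:
  fixes a b :: real
  assumes w: "\<And>s. s > 0 \<Longrightarrow> I \<le> ennreal ((s * a\<^sup>2 + b\<^sup>2 / s) / 2)" and "0 \<le> a" "0 \<le> b"
  shows "I \<le> ennreal (a * b)"
proof -
  have "I < top"
    using w[of 1] by (auto simp: top_unique less_top[symmetric])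
  then obtain r where r: "I = ennreal r" "r \<ge> 0" by (cases I) auto
  have wr: "r \<le> (s * a\<^sup>2 + b\<^sup>2 / s) / 2" if "s > 0" for s
    using w[OF that] r that by (subst (asm) r) (auto simp: ennreal_le_iff)
  have "r \<le> a * b"
  proof (rule field_le_epsilon)
    fix e :: real assume e: "e > 0"
    show "r \<le> a * b + e"
    proof (cases "a = 0")
      case True
      \<comment> \<open>For a = 0 the infimum is approached only as s grows. This s brings b^2 / s
        below e, and the summand 1 keeps it positive when b = 0.\<close>
      have "r \<le> (b\<^sup>2 / ((b\<^sup>2 + 1) / e)) / 2"
        using wr[of "(b\<^sup>2 + 1) / e"] zero_le_power2[of b] True e by (simp add: add_nonneg_pos del: zero_le_power2)
      also have "\<dots> \<le> e"
      proof -
        have "b\<^sup>2 * e \<le> (b\<^sup>2 + 1) * e" "(b\<^sup>2 + 1) > 0"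
          using e by (auto intro!: mult_right_mono add_nonneg_pos)
        then have "b\<^sup>2 * e / (b\<^sup>2 + 1) \<le> e" by (simp add: field_simps)
        moreover have "0 \<le> b\<^sup>2 * e / (b\<^sup>2 + 1)" using e by simp
        moreover have "b\<^sup>2 / ((b\<^sup>2 + 1) / e) = b\<^sup>2 * e / (b\<^sup>2 + 1)" by simp
        moreover have "y / 2 \<le> e" if "0 \<le> y" "y \<le> e" for y :: real using that by simp
        ultimately show ?thesis by metis
      qed
      finally show ?thesis using True by simp
    next
      case False
      \<comment> \<open>The minimiser b / a is not positive when b = 0; replacing b by b + d costs
        exactly a d = e.\<close>
      define d where "d = e / a"
      have a: "a > 0" and d: "d > 0" using False assms(2) e by (auto simp: d_def)
      have "b + d > 0" using assms(3) d by simp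
      have "r \<le> ((b + d) / a * a\<^sup>2 + b\<^sup>2 / ((b + d) / a)) / 2"
        using a \<open>b + d > 0\<close> by (intro wr) auto
      also have "(b + d) / a * a\<^sup>2 = a * (b + d)" using a by (simp add: power2_eq_square)
      also have "b\<^sup>2 / ((b + d) / a) \<le> a * (b + d)"
      proof -
        have "b * b \<le> (b + d) * (b + d)" using assms(3) d by (intro mult_mono) auto
        then have "b\<^sup>2 / (b + d) \<le> b + d"
          using \<open>b + d > 0\<close> by (simp add: divide_le_eq power2_eq_square)
        then have "a * (b\<^sup>2 / (b + d)) \<le> a * (b + d)"
          using a by (intro mult_left_mono) auto
        then show ?thesis by (simp add: mult.commute)
      qed
      finally show ?thesis using a by (simp add: d_def algebra_simps)
    qed
  qed
  then show ?thesis using r by (simp add: ennreal_leI)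
qed

lemma nn_integral_Cauchy_Schwarz_sqrt:
  fixes a b :: real
  assumes [measurable]: "u \<in> borel_measurable M" "v \<in> borel_measurable M"
    and "\<And>x. 0 \<le> u x" "\<And>x. 0 \<le> v x" "0 \<le> a" "0 \<le> b"
    and A: "(\<integral>\<^sup>+x. ennreal ((u x)\<^sup>2) \<partial>M) \<le> ennreal (a\<^sup>2)"
    and B: "(\<integral>\<^sup>+x. ennreal ((v x)\<^sup>2) \<partial>M) \<le> ennreal (b\<^sup>2)"
  shows "(\<integral>\<^sup>+x. ennreal (u x * v x) \<partial>M) \<le> ennreal (a * b)"
proof -
  have weighted: "(\<integral>\<^sup>+x. ennreal (u x * v x) \<partial>M) \<le> ennreal ((s * a\<^sup>2 + b\<^sup>2 / s) / 2)" if s: "s > 0" for s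
  proof -
    have p: "u x * v x \<le> s/2 * (u x)\<^sup>2 + (v x)\<^sup>2 / (2 * s)" for x
    proof -
      have "0 \<le> (s * u x - v x)\<^sup>2 / (2 * s)" using s by simp
      also have "\<dots> = s/2 * (u x)\<^sup>2 + (v x)\<^sup>2 / (2 * s) - u x * v x"
        using s by (simp add: field_simps power2_eq_square)
      finally show ?thesis by simp
    qed
    have "(\<integral>\<^sup>+x. ennreal (u x * v x) \<partial>M)
        \<le> (\<integral>\<^sup>+x. ennreal (s/2) * ennreal ((u x)\<^sup>2) + ennreal (1/(2 * s)) * ennreal ((v x)\<^sup>2) \<partial>M)"
      using p s by (intro nn_integral_mono) (simp add: ennreal_mult[symmetric] ennreal_plus[symmetric] ennreal_leI del: ennreal_plus)
    also have "\<dots> = ennreal (s/2) * (\<integral>\<^sup>+x. ennreal ((u x)\<^sup>2) \<partial>M) + ennreal (1/(2 * s)) * (\<integral>\<^sup>+x. ennreal ((v x)\<^sup>2) \<partial>M)"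
      by (simp add: nn_integral_add nn_integral_cmult)
    also have "\<dots> \<le> ennreal (s/2) * ennreal (a\<^sup>2) + ennreal (1/(2 * s)) * ennreal (b\<^sup>2)"
      using A B by (intro add_mono mult_left_mono) auto
    also have "\<dots> = ennreal ((s * a\<^sup>2 + b\<^sup>2 / s) / 2)"
      using s by (simp add: ennreal_mult[symmetric] ennreal_plus[symmetric] field_simps del: ennreal_plus)
    finally show ?thesis .
  qed
  show ?thesis by (rule ennreal_le_mult_by_weights[OF weighted]) (use assms in auto)
qed

lemma L2_Cauchy_Schwarz:
  assumes "L2 f" "L2 g"
  shows "cmod (LINT x|lborel. f x * g x) \<le> L2_norm f * L2_norm g"
proof -
  note [measurable] = assms[THEN L2_measurable]
  have "ennreal (cmod (LINT x|lborel. f x * g x)) \<le> (\<integral>\<^sup>+x. ennreal (cmod (f x * g x)) \<partial>lborel)"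
    using L2_mult_integrable[OF assms] by (rule integral_norm_bound_ennreal)
  also have "\<dots> \<le> ennreal (L2_norm f * L2_norm g)"
    unfolding norm_mult
    by (rule nn_integral_Cauchy_Schwarz_sqrt) (simp_all add: nn_integral_L2 assms)
  finally show ?thesis by (simp add: ennreal_le_iff)
qed

lemma L2_norm_triangle:
  assumes "L2 f" "L2 g"
  shows "L2_norm (\<lambda>x. f x + g x) \<le> L2_norm f + L2_norm g"
proof (rule power2_le_imp_le)
  have "Re (LINT x|lborel. cnj (g x) * f x) \<le> L2_norm (\<lambda>x. cnj (g x)) * L2_norm f"
    using L2_Cauchy_Schwarz[OF L2_cnj[OF assms(2)] assms(1)] complex_Re_le_cmod order_trans by blast
  then show "(L2_norm (\<lambda>x. f x + g x))\<^sup>2 \<le> (L2_norm f + L2_norm g)\<^sup>2"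
    unfolding L2_norm_power2_add[OF assms] by (simp add: power2_sum L2_norm_def algebra_simps)
qed simp

lemma L2_norm_triangle_diff:
  assumes "L2 f" "L2 g" "L2 h"
  shows "L2_norm (\<lambda>x. f x - h x) \<le> L2_norm (\<lambda>x. f x - g x) + L2_norm (\<lambda>x. g x - h x)"
  using L2_norm_triangle[OF L2_diff[OF assms(1,2)] L2_diff[OF assms(2,3)]] by simp

lemma L2_norm_minus_commute: "L2_norm (\<lambda>x. f x - g x) = L2_norm (\<lambda>x. g x - f x)"
  by (simp add: L2_norm_def norm_minus_commute)

lemma L2_norm_eq_0:
  assumes "L2 f" shows "L2_norm f = 0 \<longleftrightarrow> (AE x in lborel. f x = 0)"
proof -
  have "L2_norm f = 0 \<longleftrightarrow> (LINT x|lborel. (cmod (f x))\<^sup>2) = 0"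
    by (simp add: L2_norm_def)
  also have "\<dots> \<longleftrightarrow> (AE x in lborel. (cmod (f x))\<^sup>2 = 0)"
    by (intro integral_nonneg_eq_0_iff_AE L2_square_integrable assms) auto
  finally show ?thesis by simp
qed

section \<open>Pointwise limits and completeness of L2\<close>

text \<open>The weights 4^j still leave a convergent series of integrals, since 4^j / 16^j = 4^-j.
  So almost everywhere 4^j |d j x|^2 tends to 0, and |d j x| is eventually at most 2^-j. A geometric
  rate in norm thus gives pointwise convergence with no further passage to a subsequence.\<close>

lemma L2_fast_convergence_AE:
  assumes L: "\<And>j. L2 (d j)" and b: "\<And>j. L2_norm (d j) \<le> (1/4) ^ j"
  shows "AE x in lborel. summable (\<lambda>j. cmod (d j x))"
proof -
  note [measurable] = L2_measurable[OF L]
  have "(\<integral>\<^sup>+x. (\<Sum>j. ennreal (4 ^ j * (cmod (d j x))\<^sup>2)) \<partial>lborel)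
      = (\<Sum>j. (\<integral>\<^sup>+x. ennreal (4 ^ j * (cmod (d j x))\<^sup>2) \<partial>lborel))"
    by (rule nn_integral_suminf) simp
  also have "\<dots> = (\<Sum>j. ennreal (4 ^ j * (L2_norm (d j))\<^sup>2))"
    by (simp add: ennreal_mult nn_integral_cmult nn_integral_L2[OF L])
  also have "\<dots> \<le> (\<Sum>j. ennreal ((1/4) ^ j))"
  proof (intro suminf_le ennreal_leI)
    fix j
    have "(L2_norm (d j))\<^sup>2 \<le> ((1/4) ^ j)\<^sup>2" using b by (intro power_mono) auto
    then have "4 ^ j * (L2_norm (d j))\<^sup>2 \<le> 4 ^ j * ((1/4) ^ j)\<^sup>2" by simp
    also have "\<dots> = (1/4 :: real) ^ j"
      by (simp add: power2_eq_square power_mult_distrib[symmetric])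
    finally show "4 ^ j * (L2_norm (d j))\<^sup>2 \<le> (1/4) ^ j" .
  qed auto
  also have "\<dots> < \<infinity>"
    by (subst suminf_ennreal2) (auto intro: summable_geometric)
  finally have "AE x in lborel. (\<Sum>j. ennreal (4 ^ j * (cmod (d j x))\<^sup>2)) \<noteq> \<infinity>"
    by (intro nn_integral_PInf_AE) auto
  then show ?thesis
  proof eventually_elim
    fix x assume fin: "(\<Sum>j. ennreal (4 ^ j * (cmod (d j x))\<^sup>2)) \<noteq> \<infinity>"
    have "summable (\<lambda>j. 4 ^ j * (cmod (d j x))\<^sup>2)"
      using fin by (intro summable_suminf_not_top) auto
    then have "(\<lambda>j. 4 ^ j * (cmod (d j x))\<^sup>2) \<longlonglongrightarrow> 0" by (rule summable_LIMSEQ_zero)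
    then have "\<forall>\<^sub>F j in sequentially. 4 ^ j * (cmod (d j x))\<^sup>2 < 1" by (rule order_tendstoD) simp
    then have ev: "\<forall>\<^sub>F j in sequentially. norm (cmod (d j x)) \<le> (1/2) ^ j"
    proof eventually_elim
      fix j assume *: "4 ^ j * (cmod (d j x))\<^sup>2 < 1"
      have "(2 ^ j * cmod (d j x))\<^sup>2 \<le> 1\<^sup>2"
        using * by (simp add: power_mult_distrib power2_eq_square[of "2 ^ j"] power_mult_distrib[symmetric])
      then have "2 ^ j * cmod (d j x) \<le> 1" by (rule power2_le_imp_le) simp
      then show "norm (cmod (d j x)) \<le> (1/2) ^ j" by (simp add: field_simps power_one_over)
    qed
    show "summable (\<lambda>j. cmod (d j x))"
      using summable_comparison_test_ev[OF ev] by (simp add: summable_geometric)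
  qed
qed

text \<open>Fatou's lemma for the squared moduli; membership of the limit in L2 is part of the
  conclusion.\<close>

lemma L2_norm_limit_le:
  assumes L: "\<And>j. L2 (p j)" and [measurable]: "g \<in> borel_measurable lborel"
    and lim: "AE x in lborel. (\<lambda>j. p j x) \<longlonglongrightarrow> g x"
    and b: "\<forall>\<^sub>F j in sequentially. L2_norm (p j) \<le> B" and "0 \<le> B"
  shows "L2 g \<and> L2_norm g \<le> B"
proof -
  note [measurable] = L2_measurable[OF L]
  have "(\<integral>\<^sup>+x. ennreal ((cmod (g x))\<^sup>2) \<partial>lborel) = (\<integral>\<^sup>+x. liminf (\<lambda>j. ennreal ((cmod (p j x))\<^sup>2)) \<partial>lborel)"
  proof (rule nn_integral_cong_AE)
    show "AE x in lborel. ennreal ((cmod (g x))\<^sup>2) = liminf (\<lambda>j. ennreal ((cmod (p j x))\<^sup>2))"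
      using lim
    proof eventually_elim
      fix x assume "(\<lambda>j. p j x) \<longlonglongrightarrow> g x"
      then have "(\<lambda>j. ennreal ((cmod (p j x))\<^sup>2)) \<longlonglongrightarrow> ennreal ((cmod (g x))\<^sup>2)"
        by (intro tendsto_intros tendsto_ennrealI)
      then show "ennreal ((cmod (g x))\<^sup>2) = liminf (\<lambda>j. ennreal ((cmod (p j x))\<^sup>2))"
        by (intro lim_imp_Liminf[symmetric]) auto
    qed
  qed
  also have "\<dots> \<le> liminf (\<lambda>j. \<integral>\<^sup>+x. ennreal ((cmod (p j x))\<^sup>2) \<partial>lborel)"
    by (rule nn_integral_liminf) simp
  also have "\<dots> \<le> liminf (\<lambda>j. ennreal (B\<^sup>2))"
    using b by (intro Liminf_mono) (auto simp: nn_integral_L2[OF L] elim!: eventually_mono intro!: ennreal_leI power_mono)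
  also have "\<dots> = ennreal (B\<^sup>2)" by (simp add: Liminf_const)
  finally have le: "(\<integral>\<^sup>+x. ennreal ((cmod (g x))\<^sup>2) \<partial>lborel) \<le> ennreal (B\<^sup>2)" .
  then have g: "L2 g" by (intro L2_I_nn_integral) (auto simp: order_le_less_trans)
  moreover have "L2_norm g \<le> B"
    using le \<open>0 \<le> B\<close> unfolding nn_integral_L2[OF g] by (simp add: ennreal_le_iff)
  ultimately show ?thesis ..
qed

text \<open>Riesz-Fischer: a rapidly converging subsequence has a pointwise limit, and Fatou's lemma
  bounds the distance of every late member of the sequence to that limit.\<close>

lemma L2_complete:
  assumes L: "\<And>j. L2 (p j)"
    and C: "\<And>e. e > 0 \<Longrightarrow> \<exists>N. \<forall>m\<ge>N. \<forall>n\<ge>N. L2_norm (\<lambda>x. p m x - p n x) < e"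
  obtains g where "L2 g" "(\<lambda>j. L2_norm (\<lambda>x. p j x - g x)) \<longlonglongrightarrow> 0"
proof -
  have "\<exists>N. \<forall>j. \<forall>m\<ge>N j. \<forall>n\<ge>N j. L2_norm (\<lambda>x. p m x - p n x) < (1/4) ^ j"
    by (intro choice allI C) simp
  then obtain N where N: "\<And>j m n. m \<ge> N j \<Longrightarrow> n \<ge> N j \<Longrightarrow> L2_norm (\<lambda>x. p m x - p n x) < (1/4) ^ j"
    by blast
  \<comment> \<open>Summing the thresholds makes the indices monotone, so that \<open>k j\<close>
    and \<open>k (Suc j)\<close> are both at least \<open>N j\<close>.\<close>
  define k where "k j = (\<Sum>i\<le>j. N i)" for j
  have kN: "k j \<ge> N j" for j unfolding k_def by (intro member_le_sum) auto
  have kS: "k (Suc j) \<ge> N j" for j unfolding k_def by (intro member_le_sum) auto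
  note [measurable] = L2_measurable[OF L]
  \<comment> \<open>On the null set of divergence \<open>lim\<close> has an arbitrary value; the
    function is measurable all the same.\<close>
  define g where "g x = lim (\<lambda>j. p (k j) x)" for x
  have [measurable]: "g \<in> borel_measurable lborel"
    unfolding g_def by simp
  have "AE x in lborel. summable (\<lambda>j. cmod (p (k (Suc j)) x - p (k j) x))"
    using N[OF kS kN] by (intro L2_fast_convergence_AE L2_diff L) (auto intro: less_imp_le)
  then have lim: "AE x in lborel. (\<lambda>j. p (k j) x) \<longlonglongrightarrow> g x"
  proof eventually_elim
    fix x assume "summable (\<lambda>j. cmod (p (k (Suc j)) x - p (k j) x))"
    then have "summable (\<lambda>j. p (k (Suc j)) x - p (k j) x)" by (rule summable_norm_cancel)
    then have "convergent (\<lambda>j. p (k j) x)"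
    proof -
      assume "summable (\<lambda>j. p (k (Suc j)) x - p (k j) x)"
      then have "convergent (\<lambda>n. \<Sum>j<n. (p (k (Suc j)) x - p (k j) x))"
        by (simp add: summable_iff_convergent)
      then have "convergent (\<lambda>n. p (k n) x - p (k 0) x)"
        using sum_lessThan_telescope[of "\<lambda>j. p (k j) x"] by simp
      then have "convergent (\<lambda>n. (p (k n) x - p (k 0) x) + p (k 0) x)"
        by (intro convergent_add convergent_const)
      then show ?thesis by simp
    qed
    then show "(\<lambda>j. p (k j) x) \<longlonglongrightarrow> g x" by (simp add: g_def convergent_LIMSEQ_iff)
  qed
  have kmono: "k j \<ge> k i" if "j \<ge> i" for i j unfolding k_def using that by (intro sum_mono2) auto
  have main: "L2 (\<lambda>x. p m x - g x) \<and> L2_norm (\<lambda>x. p m x - g x) \<le> (1/4) ^ i" if m: "m \<ge> N i" for m i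
  proof (rule L2_norm_limit_le)
    show "AE x in lborel. (\<lambda>j. p m x - p (k j) x) \<longlonglongrightarrow> p m x - g x"
      using lim by eventually_elim (auto intro!: tendsto_intros)
    show "\<forall>\<^sub>F j in sequentially. L2_norm (\<lambda>x. p m x - p (k j) x) \<le> (1/4) ^ i"
      using eventually_ge_at_top[of i]
    proof eventually_elim
      fix j assume "j \<ge> i"
      then have "k j \<ge> N i" using kmono[of i j] kN[of i] by simp
      from N[OF m this] show "L2_norm (\<lambda>x. p m x - p (k j) x) \<le> (1/4) ^ i" by simp
    qed
  qed (auto intro: L2_diff L)
  have "L2 (\<lambda>x. p (N 0) x - (p (N 0) x - g x))"
    using L2_diff[OF L main[THEN conjunct1, OF order_refl]] .
  then have "L2 g" by simp
  moreover have "(\<lambda>j. L2_norm (\<lambda>x. p j x - g x)) \<longlonglongrightarrow> 0"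
  proof (rule LIMSEQ_I)
    fix r :: real assume "r > 0"
    then obtain i where i: "(1/4) ^ i < r" using real_arch_pow_inv[of r "1/4"] by auto
    show "\<exists>no. \<forall>n\<ge>no. norm (L2_norm (\<lambda>x. p n x - g x) - 0) < r"
      using main[of i] i by (intro exI[of _ "N i"]) (auto intro: le_less_trans)
  qed
  ultimately show ?thesis by (rule that)
qed

subsection \<open>Functions with Gaussian decay\<close>

text \<open>The factor exp (c |x|) absorbs polynomials and the linear exponent of a Gaussian. The
  class is therefore closed under multiplication by x, while a product of two members is still
  dominated by exp (- x^2 / 2).\<close>

definition gaussian_decay :: "(real \<Rightarrow> 'a::real_normed_vector) \<Rightarrow> bool" where
  "gaussian_decay f \<longleftrightarrow> continuous_on UNIV f \<and> (\<exists>C c. \<forall>x. norm (f x) \<le> C * exp (c * \<bar>x\<bar> - x\<^sup>2 / 2))"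

lemma gaussian_decayE:
  assumes "gaussian_decay f"
  obtains C c where "C \<ge> 0" "c \<ge> 0" "\<And>x. norm (f x) \<le> C * exp (c * \<bar>x\<bar> - x\<^sup>2 / 2)"
proof -
  obtain C c where b: "\<And>x. norm (f x) \<le> C * exp (c * \<bar>x\<bar> - x\<^sup>2 / 2)"
    using assms by (auto simp: gaussian_decay_def)
  have "norm (f x) \<le> max 0 C * exp (max 0 c * \<bar>x\<bar> - x\<^sup>2 / 2)" for x
  proof -
    have "C * exp (c * \<bar>x\<bar> - x\<^sup>2 / 2) \<le> max 0 C * exp (max 0 c * \<bar>x\<bar> - x\<^sup>2 / 2)"
      by (intro mult_mono) (auto intro!: mult_right_mono)
    with b[of x] show ?thesis by linarith
  qed
  then show ?thesis by (intro that[of "max 0 C" "max 0 c"]) auto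
qed

lemma gaussian_decay_continuous: "gaussian_decay f \<Longrightarrow> continuous_on UNIV f"
  by (simp add: gaussian_decay_def)

lemma gaussian_decay_measurable [measurable_dest]:
  "gaussian_decay f \<Longrightarrow> f \<in> borel_measurable borel"
  by (simp add: gaussian_decay_def borel_measurable_continuous_onI)

lemma gaussian_decay_add:
  assumes "gaussian_decay f" "gaussian_decay g"
  shows "gaussian_decay (\<lambda>x. f x + g x)"
proof -
  obtain C c where f: "C \<ge> 0" "c \<ge> 0" "\<And>x. norm (f x) \<le> C * exp (c * \<bar>x\<bar> - x\<^sup>2 / 2)"
    using gaussian_decayE[OF assms(1)] by blast
  obtain D d where g: "D \<ge> 0" "d \<ge> 0" "\<And>x. norm (g x) \<le> D * exp (d * \<bar>x\<bar> - x\<^sup>2 / 2)"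
    using gaussian_decayE[OF assms(2)] by blast
  have "norm (f x + g x) \<le> (C + D) * exp (max c d * \<bar>x\<bar> - x\<^sup>2 / 2)" for x
  proof -
    have "norm (f x + g x) \<le> C * exp (c * \<bar>x\<bar> - x\<^sup>2 / 2) + D * exp (d * \<bar>x\<bar> - x\<^sup>2 / 2)"
      using f(3)[of x] g(3)[of x] norm_triangle_ineq[of "f x" "g x"] by linarith
    also have "\<dots> \<le> C * exp (max c d * \<bar>x\<bar> - x\<^sup>2 / 2) + D * exp (max c d * \<bar>x\<bar> - x\<^sup>2 / 2)"
      using f g by (intro add_mono mult_left_mono) (auto intro!: mult_right_mono)
    finally show ?thesis by (simp add: algebra_simps)
  qed
  then show ?thesis using assms
    unfolding gaussian_decay_def by (auto intro: continuous_intros)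
qed

lemma gaussian_decay_cmult:
  fixes f :: "real \<Rightarrow> 'a::real_normed_algebra"
  assumes "gaussian_decay f" shows "gaussian_decay (\<lambda>x. a * f x)"
proof -
  obtain C c where f: "C \<ge> 0" "c \<ge> 0" "\<And>x. norm (f x) \<le> C * exp (c * \<bar>x\<bar> - x\<^sup>2 / 2)"
    using gaussian_decayE[OF assms(1)] by blast
  have "norm (a * f x) \<le> (norm a * C) * exp (c * \<bar>x\<bar> - x\<^sup>2 / 2)" for x
    using norm_mult_ineq[of a "f x"] mult_left_mono[OF f(3)[of x], of "norm a"] by (simp add: mult.assoc)
  then show ?thesis using assms
    unfolding gaussian_decay_def by (auto intro!: continuous_intros)
qed

lemma gaussian_decay_scaleR_ident:
  assumes "gaussian_decay f" shows "gaussian_decay (\<lambda>x. x *\<^sub>R f x)"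
proof -
  obtain C c where f: "C \<ge> 0" "c \<ge> 0" "\<And>x. norm (f x) \<le> C * exp (c * \<bar>x\<bar> - x\<^sup>2 / 2)"
    using gaussian_decayE[OF assms(1)] by blast
  have "norm (x *\<^sub>R f x) \<le> C * exp ((c + 1) * \<bar>x\<bar> - x\<^sup>2 / 2)" for x
  proof -
    have "\<bar>x\<bar> \<le> exp \<bar>x\<bar>" using exp_ge_add_one_self[of "\<bar>x\<bar>"] by linarith
    then have "norm (x *\<^sub>R f x) \<le> exp \<bar>x\<bar> * (C * exp (c * \<bar>x\<bar> - x\<^sup>2 / 2))"
      using f unfolding norm_scaleR by (intro mult_mono) auto
    also have "\<dots> = C * exp ((c + 1) * \<bar>x\<bar> - x\<^sup>2 / 2)"
      by (simp add: exp_add[symmetric] algebra_simps)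
    finally show ?thesis .
  qed
  then show ?thesis using assms
    unfolding gaussian_decay_def by (auto intro!: continuous_intros)
qed

lemma gaussian_decay_of_real_mult:
  fixes f :: "real \<Rightarrow> complex"
  shows "gaussian_decay f \<Longrightarrow> gaussian_decay (\<lambda>x. of_real x * f x)"
  using gaussian_decay_scaleR_ident[of f] by (simp add: scaleR_conv_of_real)

lemma gaussian_decay_of_real:
  "gaussian_decay f \<Longrightarrow> gaussian_decay (\<lambda>x. complex_of_real (f x))"
  unfolding gaussian_decay_def by (auto intro!: continuous_intros)

lemma abs_mult_minus_square_le: "c * \<bar>x\<bar> - x\<^sup>2 \<le> c\<^sup>2 / 2 - x\<^sup>2 / 2" for c x :: real
proof -
  have "0 \<le> (\<bar>x\<bar> - c)\<^sup>2" by simp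
  then show ?thesis unfolding power2_diff by (simp add: algebra_simps)
qed

lemma gaussian_decay_mult_bound:
  fixes f g :: "real \<Rightarrow> 'a::real_normed_algebra"
  assumes "gaussian_decay f" "gaussian_decay g"
  obtains B where "B \<ge> 0" "\<And>x. norm (f x * g x) \<le> B * exp (- x\<^sup>2 / 2)"
proof -
  obtain C c where f: "C \<ge> 0" "c \<ge> 0" "\<And>x. norm (f x) \<le> C * exp (c * \<bar>x\<bar> - x\<^sup>2 / 2)"
    using gaussian_decayE[OF assms(1)] by blast
  obtain D d where g: "D \<ge> 0" "d \<ge> 0" "\<And>x. norm (g x) \<le> D * exp (d * \<bar>x\<bar> - x\<^sup>2 / 2)"
    using gaussian_decayE[OF assms(2)] by blast
  have "norm (f x * g x) \<le> (C * D * exp ((c + d)\<^sup>2 / 2)) * exp (- x\<^sup>2 / 2)" for x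
  proof -
    have "norm (f x * g x) \<le> norm (f x) * norm (g x)" by (rule norm_mult_ineq)
    also have "\<dots> \<le> (C * exp (c * \<bar>x\<bar> - x\<^sup>2 / 2)) * (D * exp (d * \<bar>x\<bar> - x\<^sup>2 / 2))"
      using f g by (intro mult_mono) auto
    also have "\<dots> = C * D * exp ((c + d) * \<bar>x\<bar> - x\<^sup>2)"
      by (simp add: exp_add[symmetric] algebra_simps)
    also have "\<dots> \<le> C * D * exp ((c + d)\<^sup>2 / 2 - x\<^sup>2 / 2)"
      using f g abs_mult_minus_square_le by (intro mult_left_mono) auto
    also have "\<dots> = (C * D * exp ((c + d)\<^sup>2 / 2)) * exp (- x\<^sup>2 / 2)"
      by (simp add: mult.assoc exp_add[symmetric])
    finally show ?thesis .
  qed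
  then show ?thesis using f g by (intro that[of "C * D * exp ((c + d)\<^sup>2 / 2)"]) auto
qed

lemma integrable_exp_minus_square_half: "integrable lborel (\<lambda>x::real. exp (- x\<^sup>2 / 2))"
proof -
  have "integrable lborel (\<lambda>x::real. sqrt (2 * pi) * std_normal_density x)" by simp
  then show ?thesis by (simp add: std_normal_density_def)
qed

lemma gaussian_decay_mult_integrable:
  fixes f g :: "real \<Rightarrow> 'a::{real_normed_algebra,euclidean_space}"
  assumes "gaussian_decay f" "gaussian_decay g"
  shows "integrable lborel (\<lambda>x. f x * g x)"
proof -
  obtain B where B: "B \<ge> 0" "\<And>x. norm (f x * g x) \<le> B * exp (- x\<^sup>2 / 2)"
    using gaussian_decay_mult_bound[OF assms] by blast
  show ?thesis
  proof (rule Bochner_Integration.integrable_bound)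
    show "integrable lborel (\<lambda>x::real. B * exp (- x\<^sup>2 / 2))"
      using integrable_exp_minus_square_half by simp
    show "(\<lambda>x. f x * g x) \<in> borel_measurable lborel"
      using assms by (auto intro!: borel_measurable_continuous_onI continuous_intros gaussian_decay_continuous)
  qed (use B in auto)
qed

lemma gaussian_decay_mult_tendsto:
  fixes f g :: "real \<Rightarrow> 'a::real_normed_algebra"
  assumes "gaussian_decay f" "gaussian_decay g"
  shows "((\<lambda>x. f x * g x) \<longlongrightarrow> 0) at_top" "((\<lambda>x. f x * g x) \<longlongrightarrow> 0) at_bot"
proof -
  obtain B where B: "B \<ge> 0" "\<And>x. norm (f x * g x) \<le> B * exp (- x\<^sup>2 / 2)"
    using gaussian_decay_mult_bound[OF assms] by blast
  have "((\<lambda>x::real. B * exp (- x\<^sup>2 / 2)) \<longlongrightarrow> 0) at_top" "((\<lambda>x::real. B * exp (- x\<^sup>2 / 2)) \<longlongrightarrow> 0) at_bot"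
    by real_asymp+
  moreover have "\<forall>\<^sub>F x in at_top. norm (f x * g x) \<le> B * exp (- x\<^sup>2 / 2)"
      "\<forall>\<^sub>F x in at_bot. norm (f x * g x) \<le> B * exp (- x\<^sup>2 / 2)"
    using always_eventually[OF allI, of "\<lambda>x. norm (f x * g x) \<le> B * exp (- x\<^sup>2 / 2)", OF B(2)] by auto
  ultimately show "((\<lambda>x. f x * g x) \<longlongrightarrow> 0) at_top" "((\<lambda>x. f x * g x) \<longlongrightarrow> 0) at_bot"
    by - (rule Lim_null_comparison, assumption+)+
qed

lemma gaussian_decay_L2: "gaussian_decay f \<Longrightarrow> L2 f"
proof -
  assume f: "gaussian_decay f"
  then have "gaussian_decay (\<lambda>x. cmod (f x))"
    unfolding gaussian_decay_def by (auto intro!: continuous_intros)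
  from gaussian_decay_mult_integrable[OF this this] show "L2 f"
    using f by (auto simp: L2_def power2_eq_square dest: gaussian_decay_measurable)
qed

lemma gaussian_decay_integration_by_parts:
  fixes f g :: "real \<Rightarrow> 'a::{real_normed_algebra,euclidean_space}"
  assumes d: "gaussian_decay f" "gaussian_decay g" "gaussian_decay f'" "gaussian_decay g'"
    and f: "\<And>x. (f has_vector_derivative f' x) (at x)"
    and g: "\<And>x. (g has_vector_derivative g' x) (at x)"
  shows "(LINT x|lborel. f' x * g x) = - (LINT x|lborel. f x * g' x)"
proof -
  have i: "integrable lborel (\<lambda>x. f' x * g x)" "integrable lborel (\<lambda>x. f x * g' x)"
    using d by (auto intro: gaussian_decay_mult_integrable)
  have "(LBINT x=-\<infinity>..\<infinity>. f x * g' x + f' x * g x) = 0 - 0"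
  proof (rule interval_integral_FTC_integrable[where F = "\<lambda>x. f x * g x"])
    show "((\<lambda>x. f x * g x) has_vector_derivative f x * g' x + f' x * g x) (at x)" for x
      by (rule has_vector_derivative_mult[OF f g])
    show "isCont (\<lambda>x. f x * g' x + f' x * g x) x" for x
      using d[THEN gaussian_decay_continuous] by (auto simp: continuous_on_eq_continuous_at)
    show "set_integrable lborel (einterval (- \<infinity>) \<infinity>) (\<lambda>x. f x * g' x + f' x * g x)"
      using i by (simp add: set_integrable_def)
    show "(((\<lambda>x. f x * g x) \<circ> real_of_ereal) \<longlongrightarrow> 0) (at_right (- \<infinity>))"
      using gaussian_decay_mult_tendsto(2)[OF d(1,2)] by (simp add: ereal_tendsto_simps)
    show "(((\<lambda>x. f x * g x) \<circ> real_of_ereal) \<longlongrightarrow> 0) (at_left \<infinity>)"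
      using gaussian_decay_mult_tendsto(1)[OF d(1,2)] by (simp add: ereal_tendsto_simps)
  qed simp
  then have "(LINT x|lborel. f x * g' x + f' x * g x) = 0"
    by (simp add: interval_lebesgue_integral_def set_lebesgue_integral_def)
  then have "(LINT x|lborel. f' x * g x) + (LINT x|lborel. f x * g' x) = 0"
    using Bochner_Integration.integral_add[OF i(2,1)] by (simp only: add.commute)
  then show ?thesis by (rule eq_neg_iff_add_eq_0[THEN iffD2])
qed

subsection \<open>Hermite functions\<close>

text \<open>These are the normalised functions H_n(x) exp (- x^2 / 2) / sqrt (2^n n! sqrt pi), with
  H_n the physicists' Hermite polynomials. The three-term recurrence makes parity, decay and the
  values at 0 accessible by induction.\<close>

fun hermite :: "nat \<Rightarrow> real \<Rightarrow> real" where
  "hermite 0 x = exp (- x\<^sup>2 / 2) / sqrt (sqrt pi)"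
| "hermite (Suc 0) x = sqrt 2 * x * hermite 0 x"
| "hermite (Suc (Suc n)) x =
    (sqrt 2 * x * hermite (Suc n) x - sqrt (real (Suc n)) * hermite n x) / sqrt (real (Suc (Suc n)))"

declare hermite.simps [simp del]

text \<open>For \<open>n = 0\<close> the junk value \<open>hermite (n - 1)\<close> is multiplied by zero.\<close>

lemma hermite_rec:
  "sqrt 2 * x * hermite n x = sqrt (real (Suc n)) * hermite (Suc n) x + sqrt (real n) * hermite (n - 1) x"
proof (cases n)
  case (Suc m)
  have "sqrt (real (Suc (Suc m))) \<noteq> 0" by simp
  then show ?thesis unfolding Suc hermite.simps
    by (simp del: of_nat_Suc)
qed (simp add: hermite.simps)

text \<open>The annihilation operator d/dx + x of the oscillator, obtained by differentiating the
  recurrence.\<close>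

lemma hermite_deriv_lower:
  "(hermite n has_real_derivative sqrt 2 * sqrt (real n) * hermite (n - 1) x - x * hermite n x) (at x)"
proof (induction n rule: less_induct)
  case (less n)
  consider "n = 0" | "n = 1" | m where "n = Suc (Suc m)"
    by (metis One_nat_def not0_implies_Suc)
  then show ?case
  proof cases
    case 1
    have "hermite 0 = (\<lambda>x. exp (- x\<^sup>2 / 2) / sqrt (sqrt pi))" by (auto simp: hermite.simps)
    then show ?thesis unfolding 1
      by (auto intro!: derivative_eq_intros simp: field_simps)
  next
    case 2
    have "hermite 1 = (\<lambda>x. sqrt 2 * x * hermite 0 x)" by (auto simp: hermite.simps)
    then show ?thesis unfolding 2 using less.IH[of 0] 2
      by (auto intro!: derivative_eq_intros simp: algebra_simps)
  next
    case 3
    let ?h = "hermite (Suc (Suc m))"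
    have e: "?h = (\<lambda>x. (sqrt 2 * x * hermite (Suc m) x - sqrt (real (Suc m)) * hermite m x) / sqrt (real (Suc (Suc m))))"
      by (auto simp: hermite.simps)
    have a: "(hermite (Suc m) has_real_derivative sqrt 2 * sqrt (real (Suc m)) * hermite m x - x * hermite (Suc m) x) (at x)"
      using less.IH[of "Suc m"] 3 by simp
    have b: "(hermite m has_real_derivative sqrt 2 * sqrt (real m) * hermite (m - 1) x - x * hermite m x) (at x)"
      using less.IH[of m] 3 by simp
    define S where "S = sqrt (real (Suc (Suc m)))"
    define T where "T = sqrt (real (Suc m))"
    have S: "S > 0" "S * S = real m + 2" and T: "T * T = real m + 1"
      by (auto simp: S_def T_def)
    \<comment> \<open>The recurrence at m removes the term with index m - 1 that the derivative of
      \<open>hermite m\<close> brings in.\<close>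
    have r: "sqrt 2 * x * hermite m x = T * hermite (Suc m) x + sqrt (real m) * hermite (m - 1) x"
      unfolding T_def by (rule hermite_rec)
    have "sqrt 2 * (sqrt (real m) * hermite (m - 1) x) = sqrt 2 * (sqrt 2 * x * hermite m x - T * hermite (Suc m) x)"
      using r by simp
    also have "\<dots> = 2 * x * hermite m x - sqrt 2 * T * hermite (Suc m) x"
      by (simp add: algebra_simps)
    finally have r2: "sqrt 2 * (sqrt (real m) * hermite (m - 1) x) = 2 * x * hermite m x - sqrt 2 * T * hermite (Suc m) x" .
    have "(?h has_real_derivative
      ((sqrt 2 * hermite (Suc m) x + sqrt 2 * x * (sqrt 2 * T * hermite m x - x * hermite (Suc m) x))
        - T * (sqrt 2 * (sqrt (real m) * hermite (m - 1) x) - x * hermite m x)) / S) (at x)"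
      unfolding e S_def[symmetric] T_def[symmetric]
      by (rule DERIV_cdivide, rule derivative_eq_intros, rule DERIV_mult[OF DERIV_cmult[OF DERIV_ident] a[folded T_def]],
          rule DERIV_cmult[OF b]) (simp add: algebra_simps)
    moreover have "((sqrt 2 * hermite (Suc m) x + sqrt 2 * x * (sqrt 2 * T * hermite m x - x * hermite (Suc m) x))
        - T * (sqrt 2 * (sqrt (real m) * hermite (m - 1) x) - x * hermite m x)) / S
      = sqrt 2 * S * hermite (Suc m) x - x * ((sqrt 2 * x * hermite (Suc m) x - T * hermite m x) / S)"
    proof -
      have "sqrt 2 * hermite (Suc m) x + sqrt 2 * x * (sqrt 2 * T * hermite m x - x * hermite (Suc m) x)
        - T * (2 * x * hermite m x - sqrt 2 * T * hermite (Suc m) x - x * hermite m x)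
        = sqrt 2 * hermite (Suc m) x * (1 + T * T) + (sqrt 2 * sqrt 2 - 2) * x * T * hermite m x
          - x * (sqrt 2 * x * hermite (Suc m) x - T * hermite m x)"
        by (simp only: algebra_simps)
      also have "\<dots> = sqrt 2 * (S * S) * hermite (Suc m) x - x * (sqrt 2 * x * hermite (Suc m) x - T * hermite m x)"
        using S T by (simp add: algebra_simps)
      finally show ?thesis unfolding r2 using S(1)
        by (simp add: field_simps)
    qed
    ultimately show ?thesis
      by (simp only: 3 e S_def[symmetric] T_def[symmetric] diff_Suc_1)
  qed
qed

text \<open>The creation operator x - d/dx; it follows from the lowering formula because the
  recurrence expresses 2 x h_n as the sum of the two shifted terms.\<close>

lemma hermite_deriv_raise:
  "(hermite n has_real_derivative x * hermite n x - sqrt 2 * sqrt (real (Suc n)) * hermite (Suc n) x) (at x)"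
proof -
  have "sqrt 2 * (sqrt 2 * x * hermite n x) = 2 * (x * hermite n x)" by (simp add: algebra_simps)
  then have "sqrt 2 * sqrt (real n) * hermite (n - 1) x - x * hermite n x
      = x * hermite n x - sqrt 2 * sqrt (real (Suc n)) * hermite (Suc n) x"
    unfolding hermite_rec[of x n] by (simp add: algebra_simps)
  with hermite_deriv_lower[of n x] show ?thesis by (simp only:)
qed

text \<open>Lowering followed by raising: the eigenvalue equation of the oscillator with eigenvalue
  2 n + 1.\<close>

lemma hermite_deriv2:
  "((\<lambda>x. sqrt 2 * sqrt (real n) * hermite (n - 1) x - x * hermite n x) has_real_derivative
    (x\<^sup>2 - (2 * real n + 1)) * hermite n x) (at x)"
proof -
  have lower: "((\<lambda>x. sqrt (real n) * hermite (n - 1) x) has_real_derivative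
    sqrt (real n) * (x * hermite (n - 1) x) - sqrt 2 * real n * hermite n x) (at x)"
  proof (cases n)
    case (Suc m)
    show ?thesis using DERIV_cmult[OF hermite_deriv_raise[of m x], of "sqrt (real n)"]
      unfolding Suc by (simp add: algebra_simps)
  qed simp
  show ?thesis
    using DERIV_diff[OF DERIV_cmult[OF lower, of "sqrt 2"] DERIV_mult[OF DERIV_ident hermite_deriv_lower[of n x]]]
    by (simp add: algebra_simps power2_eq_square)
qed

lemma hermite_minus: "hermite n (- x) = (- 1) ^ n * hermite n x"
proof (induction n rule: less_induct)
  case (less n)
  consider "n = 0" | "n = 1" | m where "n = Suc (Suc m)"
    by (metis One_nat_def not0_implies_Suc)
  then show ?case
  proof cases
    case 3
    have "sqrt 2 * - x * hermite (Suc m) (- x) - sqrt (real (Suc m)) * hermite m (- x)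
      = (- 1) ^ m * (sqrt 2 * x * hermite (Suc m) x - sqrt (real (Suc m)) * hermite m x)"
      using less.IH[of m] less.IH[of "Suc m"] 3 by (simp add: right_diff_distrib mult_ac)
    then show ?thesis unfolding 3 hermite.simps by simp
  qed (simp_all add: hermite.simps)
qed

lemma gaussian_decay_hermite: "gaussian_decay (hermite n)"
proof (induction n rule: less_induct)
  case (less n)
  consider "n = 0" | "n = 1" | m where "n = Suc (Suc m)"
    by (metis One_nat_def not0_implies_Suc)
  then show ?case
  proof cases
    case 1
    have "norm (hermite 0 x) \<le> (1 / sqrt (sqrt pi)) * exp (0 * \<bar>x\<bar> - x\<^sup>2 / 2)" for x by (simp add: hermite.simps)
    moreover have "continuous_on UNIV (hermite 0)"
      by (rule DERIV_continuous_on[OF has_field_derivative_at_within[OF hermite_deriv_raise]])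
    ultimately show ?thesis unfolding gaussian_decay_def 1 by blast
  next
    case 2
    have "hermite 1 = (\<lambda>x. sqrt 2 * (x *\<^sub>R hermite 0 x))" by (auto simp: hermite.simps)
    then show ?thesis using gaussian_decay_cmult[OF gaussian_decay_scaleR_ident[OF less[of 0]], of "sqrt 2"] 2
      by simp
  next
    case 3
    have e: "hermite n = (\<lambda>x. (sqrt 2 / sqrt (real (Suc (Suc m)))) * (x *\<^sub>R hermite (Suc m) x)
       + (- sqrt (real (Suc m)) / sqrt (real (Suc (Suc m)))) * hermite m x)"
      unfolding 3 by (auto simp: hermite.simps field_simps)
    show ?thesis unfolding e using less[of m] less[of "Suc m"] 3
      by (intro gaussian_decay_add gaussian_decay_cmult gaussian_decay_scaleR_ident) auto
  qed
qed

lemma hermite_measurable [measurable]: "hermite n \<in> borel_measurable borel"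
  using gaussian_decay_hermite by (rule gaussian_decay_measurable)

lemma hermite_continuous: "continuous_on UNIV (hermite n)"
  using gaussian_decay_hermite by (rule gaussian_decay_continuous)

lemma gaussian_decay_ident_hermite: "gaussian_decay (\<lambda>x. x * hermite n x)"
  using gaussian_decay_scaleR_ident[OF gaussian_decay_hermite] by simp

lemma gaussian_decay_hermite_deriv:
  "gaussian_decay (\<lambda>x. x * hermite n x - sqrt 2 * sqrt (real (Suc n)) * hermite (Suc n) x)"
  using gaussian_decay_add[OF gaussian_decay_ident_hermite
      gaussian_decay_cmult[OF gaussian_decay_hermite[of "Suc n"], of "- sqrt 2 * sqrt (real (Suc n))"]]
  by simp

section \<open>Adjointness of creation and annihilation, orthonormality\<close>

text \<open>The creation operator x - d/dx acting on \<open>hermite n\<close> is moved across the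
  integral, where it becomes x + d/dx. This single identity yields both the orthonormality and the
  coefficients of Gaussians.\<close>

lemma hermite_raise_lower:
  fixes g g' :: "real \<Rightarrow> complex"
  assumes "gaussian_decay g" "gaussian_decay g'" "\<And>x. (g has_vector_derivative g' x) (at x)"
  shows "sqrt 2 * sqrt (real (Suc n)) * (LINT x|lborel. of_real (hermite (Suc n) x) * g x)
    = (LINT x|lborel. of_real (hermite n x) * (of_real x * g x + g' x))"
proof -
  let ?h = "\<lambda>x. complex_of_real (hermite n x)"
  let ?h' = "\<lambda>x. complex_of_real (x * hermite n x - sqrt 2 * sqrt (real (Suc n)) * hermite (Suc n) x)"
  have h: "gaussian_decay ?h" "gaussian_decay ?h'" "gaussian_decay (\<lambda>x. complex_of_real (hermite (Suc n) x))"
    by (intro gaussian_decay_of_real gaussian_decay_hermite gaussian_decay_hermite_deriv)+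
  have d: "(?h has_vector_derivative ?h' x) (at x)" for x
    using has_vector_derivative_of_real[OF hermite_deriv_raise[of n x]] .
  have "(LINT x|lborel. ?h' x * g x) = - (LINT x|lborel. ?h x * g' x)"
    by (rule gaussian_decay_integration_by_parts[OF h(1) assms(1) h(2) assms(2) d assms(3)])
  moreover have "(LINT x|lborel. ?h' x * g x) = (LINT x|lborel. ?h x * (of_real x * g x))
     - (LINT x|lborel. sqrt 2 * sqrt (real (Suc n)) * (of_real (hermite (Suc n) x) * g x))"
  proof -
    have i: "integrable lborel (\<lambda>x. ?h x * (of_real x * g x))"
      "integrable lborel (\<lambda>x. sqrt 2 * sqrt (real (Suc n)) * (of_real (hermite (Suc n) x) * g x))"
      using assms h
      by (auto intro!: gaussian_decay_mult_integrable gaussian_decay_of_real_mult integrable_mult_right simp del: of_nat_Suc)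
    show ?thesis
      unfolding Bochner_Integration.integral_diff[OF i, symmetric]
      by (rule Bochner_Integration.integral_cong) (auto simp: algebra_simps)
  qed
  moreover have "(LINT x|lborel. ?h x * (of_real x * g x + g' x))
     = (LINT x|lborel. ?h x * (of_real x * g x)) + (LINT x|lborel. ?h x * g' x)"
  proof -
    have i: "integrable lborel (\<lambda>x. ?h x * (of_real x * g x))" "integrable lborel (\<lambda>x. ?h x * g' x)"
      using assms h by (auto intro!: gaussian_decay_mult_integrable gaussian_decay_of_real_mult)
    show ?thesis
      unfolding Bochner_Integration.integral_add[OF i, symmetric]
      by (rule Bochner_Integration.integral_cong) (auto simp: algebra_simps)
  qed
  moreover have "c = G" if "a = - g" "a = h - c" "G = h + g" for a c h g G :: complex
  proof -
    have "c = h - (h - c)" by simp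
    also have "\<dots> = h - (- g)" using that by (simp only:)
    also have "\<dots> = G" using that by simp
    finally show ?thesis .
  qed
  ultimately have "(LINT x|lborel. sqrt 2 * sqrt (real (Suc n)) * (of_real (hermite (Suc n) x) * g x))
     = (LINT x|lborel. ?h x * (of_real x * g x + g' x))"
    by blast
  then show ?thesis unfolding integral_mult_right_zero .
qed

text \<open>Since x + d/dx lowers \<open>hermite n\<close>, moving one creation operator across
  lowers both indices at once, and induction on m descends to m = 0. There \<open>rec\<close> with
  second index 0 has the factor sqrt 0, and the remaining integral is that of a normal density of
  variance 1/2.\<close>

lemma hermite_orthonormal:
  "(LINT x|lborel. hermite m x * hermite n x) = (if m = n then 1 else 0)"
proof -
  have C: "(LINT x|lborel. complex_of_real (hermite m x) * of_real (hermite n x))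
      = of_real (LINT x|lborel. hermite m x * hermite n x)" for m n
    unfolding of_real_mult[symmetric] by (rule integral_complex_of_real)
  have rec: "sqrt (real (Suc m)) * (LINT x|lborel. hermite (Suc m) x * hermite n x)
      = sqrt (real n) * (LINT x|lborel. hermite m x * hermite (n - 1) x)" for m n
  proof -
    have "complex_of_real (sqrt 2 * sqrt (real (Suc m)) * (LINT x|lborel. hermite (Suc m) x * hermite n x))
      = (LINT x|lborel. of_real (hermite m x) * (of_real x * of_real (hermite n x)
          + of_real (x * hermite n x - sqrt 2 * sqrt (real (Suc n)) * hermite (Suc n) x)))"
      unfolding of_real_mult C[symmetric]
      by (rule hermite_raise_lower[unfolded of_real_mult])
         (use gaussian_decay_of_real[OF gaussian_decay_hermite] gaussian_decay_of_real[OF gaussian_decay_hermite_deriv]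
            has_vector_derivative_of_real[OF hermite_deriv_raise] in auto)
    also have "\<dots> = (LINT x|lborel. of_real (sqrt 2 * sqrt (real n)) * (complex_of_real (hermite m x) * of_real (hermite (n - 1) x)))"
    proof (rule Bochner_Integration.integral_cong[OF refl])
      fix x
      have "sqrt 2 * (sqrt 2 * x * hermite n x) = 2 * (x * hermite n x)" by (simp add: algebra_simps)
      then have "x * hermite n x + (x * hermite n x - sqrt 2 * sqrt (real (Suc n)) * hermite (Suc n) x)
         = sqrt 2 * sqrt (real n) * hermite (n - 1) x"
        unfolding hermite_rec[of x n] by (simp add: algebra_simps)
      then show "complex_of_real (hermite m x) * (of_real x * of_real (hermite n x)
          + of_real (x * hermite n x - sqrt 2 * sqrt (real (Suc n)) * hermite (Suc n) x))
        = of_real (sqrt 2 * sqrt (real n)) * (complex_of_real (hermite m x) * of_real (hermite (n - 1) x))"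
        unfolding of_real_mult[symmetric] of_real_add[symmetric] by (simp only: mult.assoc mult.left_commute)
    qed
    also have "\<dots> = complex_of_real (sqrt 2 * sqrt (real n) * (LINT x|lborel. hermite m x * hermite (n - 1) x))"
      by (simp add: C)
    finally show ?thesis unfolding of_real_eq_iff by simp
  qed
  have zero: "(LINT x|lborel. hermite 0 x * hermite 0 x) = 1"
  proof -
    have "hermite 0 x * hermite 0 x = normal_density 0 (1 / sqrt 2) x" for x
      by (simp add: hermite.simps normal_density_def exp_add[symmetric] power_divide)
    then have "(LINT x|lborel. hermite 0 x * hermite 0 x) = (LINT x|lborel. normal_density 0 (1 / sqrt 2) x)"
      by (simp only:)
    then show ?thesis by (simp only: integral_normal_density[of "1 / sqrt 2" 0]) simp
  qed
  show ?thesis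
  proof (induction m arbitrary: n)
    case 0
    show ?case
    proof (cases n)
      case (Suc k)
      have "sqrt (real (Suc k)) * (LINT x|lborel. hermite (Suc k) x * hermite 0 x) = 0"
        using rec[of k 0] by simp
      then have "(LINT x|lborel. hermite (Suc k) x * hermite 0 x) = 0"
        unfolding mult_eq_0_iff by simp
      then show ?thesis using Suc by (simp add: mult.commute)
    qed (use zero in simp)
  next
    case (Suc m)
    have "sqrt (real (Suc m)) * (LINT x|lborel. hermite (Suc m) x * hermite n x)
        = sqrt (real (Suc m)) * (if Suc m = n then 1 else 0)"
      unfolding rec Suc.IH by (cases n) (auto)
    then show ?case unfolding mult_cancel_left by simp
  qed
qed

lemma hermite_deriv1:
  "deriv1 (\<lambda>x. complex_of_real (hermite n x))
    = (\<lambda>x. of_real (sqrt 2 * sqrt (real n) * hermite (n - 1) x - x * hermite n x))"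
  unfolding deriv1_def
  using vector_derivative_at[OF has_vector_derivative_of_real[OF hermite_deriv_lower]] by blast

lemma hermite_deriv1_deriv1:
  "deriv1 (deriv1 (\<lambda>x. complex_of_real (hermite n x)))
    = (\<lambda>x. of_real ((x\<^sup>2 - (2 * real n + 1)) * hermite n x))"
  unfolding hermite_deriv1
  unfolding deriv1_def
  using vector_derivative_at[OF has_vector_derivative_of_real[OF hermite_deriv2]] by blast

lemma osc_hermite:
  "osc (\<lambda>x. complex_of_real (hermite n x)) = (\<lambda>x. of_real (2 * real n + 1) * of_real (hermite n x))"
  unfolding osc_def hermite_deriv1_deriv1 by (auto simp: algebra_simps)

lemma L2_hermite: "L2 (\<lambda>x. complex_of_real (hermite n x))"
  by (intro gaussian_decay_L2 gaussian_decay_of_real gaussian_decay_hermite)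

lemma hermite_osc_core: "(\<lambda>x. complex_of_real (hermite n x)) \<in> osc_core"
proof -
  have "(\<lambda>x. complex_of_real (hermite n x)) differentiable at x" for x
    using has_vector_derivative_of_real[OF hermite_deriv_lower] differentiableI_vector by blast
  moreover have "deriv1 (\<lambda>x. complex_of_real (hermite n x)) differentiable at x" for x
    unfolding hermite_deriv1
    using has_vector_derivative_of_real[OF hermite_deriv2] differentiableI_vector by blast
  moreover have "continuous_on UNIV (deriv1 (deriv1 (\<lambda>x. complex_of_real (hermite n x))))"
    unfolding hermite_deriv1_deriv1 by (intro continuous_intros hermite_continuous)
  moreover have "L2 (osc (\<lambda>x. complex_of_real (hermite n x)))"
    unfolding osc_hermite by (intro L2_cmult L2_hermite)
  ultimately show ?thesis using L2_hermite by (simp add: osc_core_def)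
qed

subsection \<open>Hermite coefficients\<close>

text \<open>The inner product with \<open>hermite n\<close>, which is real, so that no conjugate
  appears.\<close>

definition hcoef :: "(real \<Rightarrow> complex) \<Rightarrow> nat \<Rightarrow> complex" where
  "hcoef f n = (LINT x|lborel. of_real (hermite n x) * f x)"

lemma hcoef_add: "L2 f \<Longrightarrow> L2 g \<Longrightarrow> hcoef (\<lambda>x. f x + g x) n = hcoef f n + hcoef g n"
  unfolding hcoef_def distrib_left
  by (intro Bochner_Integration.integral_add L2_mult_integrable L2_hermite)

lemma hcoef_diff: "L2 f \<Longrightarrow> L2 g \<Longrightarrow> hcoef (\<lambda>x. f x - g x) n = hcoef f n - hcoef g n"
  unfolding hcoef_def right_diff_distrib
  by (intro Bochner_Integration.integral_diff L2_mult_integrable L2_hermite)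

lemma hcoef_cmult: "hcoef (\<lambda>x. c * f x) n = c * hcoef f n"
  unfolding hcoef_def mult.left_commute[of _ c] by simp

lemma hcoef_cong_AE:
  assumes "f \<in> borel_measurable lborel" "g \<in> borel_measurable lborel" "AE x in lborel. f x = g x"
  shows "hcoef f n = hcoef g n"
  unfolding hcoef_def using assms by (intro integral_cong_AE) auto

lemma hcoef_hermite: "hcoef (\<lambda>x. of_real (hermite m x)) n = (if m = n then 1 else 0)"
  unfolding hcoef_def of_real_mult[symmetric] integral_complex_of_real hermite_orthonormal by auto

lemma L2_sum_hermite: "L2 (\<lambda>x. \<Sum>i\<in>I. a i * of_real (hermite i x))"
  by (intro L2_sum L2_cmult L2_hermite)

lemma hcoef_sum_hermite:
  assumes "finite I"
  shows "hcoef (\<lambda>x. \<Sum>i\<in>I. a i * of_real (hermite i x)) n = (if n \<in> I then a n else 0)"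
  using assms
proof induction
  case (insert i I)
  have "hcoef (\<lambda>x. a i * of_real (hermite i x) + (\<Sum>i\<in>I. a i * of_real (hermite i x))) n
    = a i * hcoef (\<lambda>x. of_real (hermite i x)) n + hcoef (\<lambda>x. \<Sum>i\<in>I. a i * of_real (hermite i x)) n"
    by (subst hcoef_add) (auto intro: L2_cmult L2_hermite L2_sum_hermite simp: hcoef_cmult)
  with insert show ?case by (auto simp: hcoef_hermite)
qed (simp add: hcoef_def)

lemma L2_norm_hermite: "L2_norm (\<lambda>x. complex_of_real (hermite n x)) = 1"
  using hermite_orthonormal[of n n] by (simp add: L2_norm_def power2_eq_square)

lemma L2_norm_sum_hermite:
  assumes "finite I"
  shows "(L2_norm (\<lambda>x. \<Sum>i\<in>I. a i * of_real (hermite i x)))\<^sup>2 = (\<Sum>i\<in>I. (cmod (a i))\<^sup>2)"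
  using assms
proof induction
  case (insert i I)
  let ?S = "\<lambda>x. \<Sum>i\<in>I. a i * of_real (hermite i x)"
  have "(LINT x|lborel. cnj (a i * of_real (hermite i x)) * ?S x) = cnj (a i) * hcoef ?S i"
    unfolding hcoef_def complex_cnj_mult complex_cnj_complex_of_real mult.assoc by simp
  also have "\<dots> = 0" using insert by (simp add: hcoef_sum_hermite)
  finally have "(L2_norm (\<lambda>x. ?S x + a i * of_real (hermite i x)))\<^sup>2
     = (L2_norm ?S)\<^sup>2 + (L2_norm (\<lambda>x. a i * of_real (hermite i x)))\<^sup>2"
    by (subst L2_norm_power2_add) (auto intro: L2_cmult L2_hermite L2_sum_hermite)
  with insert show ?case by (simp add: L2_norm_cmult L2_norm_hermite power_mult_distrib add.commute)
qed (simp add: L2_norm_def)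

lemma hcoef_le_L2_norm: assumes "L2 f" shows "cmod (hcoef f n) \<le> L2_norm f"
  using L2_Cauchy_Schwarz[OF L2_hermite assms, of n] by (simp add: hcoef_def L2_norm_hermite)

text \<open>Pythagoras: the first K coefficients of the remainder vanish, so it is orthogonal to the
  partial sum.\<close>

lemma L2_norm_hermite_remainder:
  assumes f: "L2 f"
  shows "(L2_norm (\<lambda>x. f x - (\<Sum>i<K. hcoef f i * of_real (hermite i x))))\<^sup>2
    = (L2_norm f)\<^sup>2 - (\<Sum>i<K. (cmod (hcoef f i))\<^sup>2)"
proof -
  let ?S = "\<lambda>x. \<Sum>i<K. hcoef f i * of_real (hermite i x)"
  let ?r = "\<lambda>x. f x - ?S x"
  have r: "L2 ?r" by (intro L2_diff f L2_sum_hermite)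
  have "(LINT x|lborel. cnj (?S x) * ?r x) = (LINT x|lborel. (\<Sum>i<K. cnj (hcoef f i) * (of_real (hermite i x) * ?r x)))"
    by (intro Bochner_Integration.integral_cong refl) (simp add: cnj_sum sum_distrib_right mult.assoc)
  also have "\<dots> = (\<Sum>i<K. cnj (hcoef f i) * hcoef ?r i)"
    unfolding hcoef_def[of ?r]
    by (subst Bochner_Integration.integral_sum) (auto intro!: integrable_mult_right L2_mult_integrable L2_hermite r)
  also have "\<dots> = 0"
    by (intro sum.neutral) (auto simp: hcoef_diff[OF f L2_sum_hermite] hcoef_sum_hermite)
  finally have "(L2_norm (\<lambda>x. ?r x + ?S x))\<^sup>2 = (L2_norm ?r)\<^sup>2 + (L2_norm ?S)\<^sup>2"
    by (subst L2_norm_power2_add[OF r L2_sum_hermite]) simp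
  then show ?thesis by (simp add: L2_norm_sum_hermite)
qed

subsection \<open>Completeness of the Hermite functions\<close>

text \<open>The positive and negative parts of r have the same Fourier transform, and by t = 0 the
  same mass m. If m > 0, division by m makes them densities of probability measures with equal
  characteristic functions, which Levy's theorem identifies; if m = 0, both vanish almost
  everywhere.\<close>

lemma fourier_injective_real:
  fixes r :: "real \<Rightarrow> real"
  assumes r: "integrable lborel r" and F: "\<And>t. (LINT x|lborel. iexp (t * x) * of_real (r x)) = 0"
  shows "AE x in lborel. r x = 0"
proof -
  define p q where "p x = max 0 (r x)" and "q x = max 0 (- r x)" for x
  have i: "integrable lborel p" "integrable lborel q"
    unfolding p_def q_def using r by (auto intro!: integrable_max)
  have [measurable]: "p \<in> borel_measurable borel" "q \<in> borel_measurable borel"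
    using i[THEN borel_measurable_integrable] by simp_all
  have pq: "r x = p x - q x" and nn: "0 \<le> p x" "0 \<le> q x" for x by (auto simp: p_def q_def)
  have ie: "integrable lborel (\<lambda>x. iexp (t * x) * complex_of_real (u x))" if "integrable lborel u" for u t
    by (rule Bochner_Integration.integrable_bound[OF that])
       (use borel_measurable_integrable[OF that] in \<open>auto simp: norm_mult\<close>)
  have eq: "(LINT x|lborel. iexp (t * x) * of_real (p x)) = (LINT x|lborel. iexp (t * x) * of_real (q x))" for t
    using F[of t] Bochner_Integration.integral_diff[OF ie[OF i(1)] ie[OF i(2)], of t t]
    by (simp add: pq right_diff_distrib)
  define m where "m = (LINT x|lborel. p x)"
  have mq: "(LINT x|lborel. q x) = m"
    using eq[of 0] by (simp add: m_def del: integral_complex_of_real)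
       (metis integral_complex_of_real of_real_eq_iff)
  have "m \<ge> 0" unfolding m_def using nn by (intro Bochner_Integration.integral_nonneg) auto
  show ?thesis
  proof (cases "m = 0")
    case True
    have "AE x in lborel. p x = 0" "AE x in lborel. q x = 0"
      using integral_nonneg_eq_0_iff_AE[OF i(1)] integral_nonneg_eq_0_iff_AE[OF i(2)] True mq nn
      by (auto simp: m_def)
    then show ?thesis by eventually_elim (simp add: pq)
  next
    case False
    with \<open>m \<ge> 0\<close> have m: "m > 0" by simp
    have dist: "real_distribution (density lborel (\<lambda>x. ennreal (u x / m)))"
      and ch: "char (density lborel (\<lambda>x. ennreal (u x / m))) t = (LINT x|lborel. iexp (t * x) * of_real (u x)) / of_real m"
      if u: "integrable lborel u" "\<And>x. 0 \<le> u x" "(LINT x|lborel. u x) = m" for u t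
    proof -
      note [measurable] = borel_measurable_integrable[OF u(1)]
      have "(\<integral>\<^sup>+x. ennreal (u x / m) \<partial>lborel) = ennreal (LINT x|lborel. u x / m)"
        using u m by (intro nn_integral_eq_integral) auto
      also have "\<dots> = 1" using u m by simp
      finally have "prob_space (density lborel (\<lambda>x. ennreal (u x / m)))"
        by (intro prob_spaceI) (simp add: emeasure_density)
      then show "real_distribution (density lborel (\<lambda>x. ennreal (u x / m)))"
        by (simp add: real_distribution_def real_distribution_axioms_def)
      have "char (density lborel (\<lambda>x. ennreal (u x / m))) t = (LINT x|lborel. (u x / m) *\<^sub>R iexp (t * x))"
        unfolding char_def using u m by (intro integral_density) auto
      also have "\<dots> = (LINT x|lborel. iexp (t * x) * of_real (u x) / of_real m)"
        by (intro Bochner_Integration.integral_cong refl) (simp add: scaleR_conv_of_real)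
      finally show "char (density lborel (\<lambda>x. ennreal (u x / m))) t = (LINT x|lborel. iexp (t * x) * of_real (u x)) / of_real m"
        by simp
    qed
    have "density lborel (\<lambda>x. ennreal (p x / m)) = density lborel (\<lambda>x. ennreal (q x / m))"
      by (intro Levy_uniqueness ext dist i nn mq m_def[symmetric])
         (simp only: ch[OF i(1) nn(1) m_def[symmetric]] ch[OF i(2) nn(2) mq] eq)
    then have "AE x in lborel. ennreal (p x / m) = ennreal (q x / m)"
      by (intro sigma_finite_measure.density_unique[OF sigma_finite_lborel]) auto
    then show ?thesis
      by eventually_elim (use nn m in \<open>auto simp: pq\<close>)
  qed
qed

text \<open>The transform of the conjugate of k at t is the conjugate of the transform of k at -t,
  so the transforms of the real and imaginary parts vanish too.\<close>

lemma fourier_injective: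
  fixes k :: "real \<Rightarrow> complex"
  assumes k: "integrable lborel k" and F: "\<And>t. (LINT x|lborel. iexp (t * x) * k x) = 0"
  shows "AE x in lborel. k x = 0"
proof -
  have ie: "integrable lborel (\<lambda>x. iexp (t * x) * u x)" if "integrable lborel u" for u t
    by (rule Bochner_Integration.integrable_bound[OF that])
       (use borel_measurable_integrable[OF that] in \<open>auto simp: norm_mult\<close>)
  have kc: "integrable lborel (\<lambda>x. cnj (k x))" using k by simp
  have C: "(LINT x|lborel. iexp (t * x) * cnj (k x)) = 0" for t
  proof -
    have "(LINT x|lborel. iexp (t * x) * cnj (k x)) = (LINT x|lborel. cnj (iexp (- t * x) * k x))"
      by (intro Bochner_Integration.integral_cong refl) (simp add: exp_cnj)
    also have "\<dots> = cnj (LINT x|lborel. iexp (- t * x) * k x)" by (rule Bochner_Integration.integral_cnj)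
    finally show ?thesis using F[of "- t"] by simp
  qed
  have re: "complex_of_real (Re z) = (z + cnj z) / 2" and im: "complex_of_real (Im z) = (z - cnj z) / (2 * \<i>)" for z
    by (simp add: complex_add_cnj) (subst nonzero_eq_divide_eq, auto simp: complex_diff_cnj)
  have "(LINT x|lborel. iexp (t * x) * of_real (Re (k x)))
      = ((LINT x|lborel. iexp (t * x) * k x) + (LINT x|lborel. iexp (t * x) * cnj (k x))) / 2" for t
    unfolding re Bochner_Integration.integral_add[OF ie[OF k] ie[OF kc], symmetric]
    by (simp only: times_divide_eq_right integral_divide_zero distrib_left)
  then have 1: "AE x in lborel. Re (k x) = 0"
    using k F C by (intro fourier_injective_real) auto
  have "(LINT x|lborel. iexp (t * x) * of_real (Im (k x)))
      = ((LINT x|lborel. iexp (t * x) * k x) - (LINT x|lborel. iexp (t * x) * cnj (k x))) / (2 * \<i>)" for t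
    unfolding im Bochner_Integration.integral_diff[OF ie[OF k] ie[OF kc], symmetric]
    by (simp only: times_divide_eq_right integral_divide_zero right_diff_distrib)
  then have 2: "AE x in lborel. Im (k x) = 0"
    using k F C by (intro fourier_injective_real) auto
  from 1 2 show ?thesis by eventually_elim (simp add: complex_eq_iff)
qed

lemma gaussian_decay_power_hermite: "gaussian_decay (\<lambda>x. x ^ j * hermite n x)"
proof (induction j)
  case (Suc j)
  from gaussian_decay_scaleR_ident[OF this] show ?case by (simp add: mult.assoc)
qed (simp add: gaussian_decay_hermite)

text \<open>Multiplication by x turns \<open>hermite n\<close> into a combination of its two
  neighbours, so each power of x is traded for a shift of n; hence the induction on j has n
  arbitrary.\<close>

lemma hermite_moments_zero:
  assumes h: "L2 h" and z: "\<And>n. hcoef h n = 0"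
  shows "(LINT x|lborel. of_real (x ^ j * hermite n x) * h x) = 0"
proof (induction j arbitrary: n)
  case 0
  then show ?case using z[of n] by (simp add: hcoef_def)
next
  case (Suc j)
  have i: "integrable lborel (\<lambda>x. of_real (x ^ j * hermite n x) * h x)" for n
    by (intro L2_mult_integrable gaussian_decay_L2 gaussian_decay_of_real gaussian_decay_power_hermite h)
  have "of_real (sqrt 2) * (LINT x|lborel. of_real (x ^ Suc j * hermite n x) * h x)
     = (LINT x|lborel. of_real (sqrt (real (Suc n))) * (of_real (x ^ j * hermite (Suc n) x) * h x)
         + of_real (sqrt (real n)) * (of_real (x ^ j * hermite (n - 1) x) * h x))"
    unfolding integral_mult_right_zero[symmetric]
  proof (intro Bochner_Integration.integral_cong refl)
    fix x
    have "sqrt 2 * (x ^ Suc j * hermite n x) = x ^ j * (sqrt 2 * x * hermite n x)" by simp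
    also have "\<dots> = sqrt (real (Suc n)) * (x ^ j * hermite (Suc n) x) + sqrt (real n) * (x ^ j * hermite (n - 1) x)"
      unfolding hermite_rec by (simp add: algebra_simps)
    finally have "complex_of_real (sqrt 2 * (x ^ Suc j * hermite n x)) * h x
      = of_real (sqrt (real (Suc n)) * (x ^ j * hermite (Suc n) x) + sqrt (real n) * (x ^ j * hermite (n - 1) x)) * h x"
      by (simp only:)
    then show "of_real (sqrt 2) * (of_real (x ^ Suc j * hermite n x) * h x)
      = of_real (sqrt (real (Suc n))) * (of_real (x ^ j * hermite (Suc n) x) * h x)
         + of_real (sqrt (real n)) * (of_real (x ^ j * hermite (n - 1) x) * h x)"
      by (simp only: of_real_mult of_real_add distrib_right mult.assoc)
  qed
  also have "\<dots> = 0"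
    by (simp only: Bochner_Integration.integral_add[OF integrable_mult_right[OF i] integrable_mult_right[OF i]]
        integral_mult_right_zero Suc.IH) simp
  finally show ?case by simp
qed

text \<open>The Fourier transform of h times \<open>hermite 0\<close> is the sum of the exponential
  series against moments, all of which vanish. Exchanging sum and integral is allowed because exp
  (|t x|) \<open>hermite 0\<close> still has Gaussian decay, hence lies in L2. As
  \<open>hermite 0\<close> has no zeros, h itself vanishes almost everywhere.\<close>

lemma hermite_total:
  assumes h: "L2 h" and z: "\<And>n. hcoef h n = 0"
  shows "AE x in lborel. h x = 0"
proof -
  define k where "k x = of_real (hermite 0 x) * h x" for x
  have k: "integrable lborel k" unfolding k_def by (intro L2_mult_integrable L2_hermite h)
  note [measurable] = borel_measurable_integrable[OF k]
  have "(LINT x|lborel. iexp (t * x) * k x) = 0" for t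
  proof -
    let ?s = "\<lambda>N x. (\<Sum>i<N. (\<i> * of_real (t * x)) ^ i /\<^sub>R fact i) * k x"
    have e: "exp (\<bar>t\<bar> * \<bar>x\<bar>) * hermite 0 x = 1 / sqrt (sqrt pi) * exp (\<bar>t\<bar> * \<bar>x\<bar> - x\<^sup>2 / 2)" for x
      by (simp add: hermite.simps exp_add[symmetric])
    have "gaussian_decay (\<lambda>x. exp (\<bar>t\<bar> * \<bar>x\<bar>) * hermite 0 x)"
      unfolding gaussian_decay_def
      by (intro conjI exI[of _ "1 / sqrt (sqrt pi)"] exI[of _ "\<bar>t\<bar>"] allI continuous_intros hermite_continuous)
         (simp add: e)
    then have "L2 (\<lambda>x. of_real (exp (\<bar>t\<bar> * \<bar>x\<bar>) * hermite 0 x))"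
      by (intro gaussian_decay_L2 gaussian_decay_of_real)
    from integrable_norm[OF L2_mult_integrable[OF this h]]
    have w: "integrable lborel (\<lambda>x. exp (\<bar>t\<bar> * \<bar>x\<bar>) * cmod (k x))"
      by (simp add: k_def norm_mult mult.assoc)
    have "(\<lambda>N. LINT x|lborel. ?s N x) \<longlonglongrightarrow> (LINT x|lborel. iexp (t * x) * k x)"
    proof (rule integral_dominated_convergence[OF _ _ w])
      show "AE x in lborel. (\<lambda>N. ?s N x) \<longlonglongrightarrow> iexp (t * x) * k x"
      proof (intro AE_I2 tendsto_mult tendsto_const)
        fix x
        show "(\<lambda>N. \<Sum>i<N. (\<i> * of_real (t * x)) ^ i /\<^sub>R fact i) \<longlonglongrightarrow> iexp (t * x)"
          using exp_converges[of "\<i> * complex_of_real (t * x)"] by (simp add: sums_def)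
      qed
      show "AE x in lborel. norm (?s N x) \<le> exp (\<bar>t\<bar> * \<bar>x\<bar>) * cmod (k x)" for N
      proof (intro AE_I2)
        fix x
        have "cmod (\<Sum>i<N. (\<i> * of_real (t * x)) ^ i /\<^sub>R fact i) \<le> (\<Sum>i<N. \<bar>t * x\<bar> ^ i /\<^sub>R fact i)"
          by (intro sum_norm_le) (simp add: norm_power norm_mult abs_mult)
        also have "\<dots> \<le> exp \<bar>t * x\<bar>"
          unfolding exp_def by (intro sum_le_suminf summable_exp_generic) auto
        finally show "norm (?s N x) \<le> exp (\<bar>t\<bar> * \<bar>x\<bar>) * cmod (k x)"
          unfolding norm_mult abs_mult by (intro mult_right_mono) auto
      qed
    qed measurable
    moreover have "(LINT x|lborel. ?s N x) = 0" for N
    proof -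
      have i: "integrable lborel (\<lambda>x. of_real (x ^ j * hermite 0 x) * h x)" for j
        by (intro L2_mult_integrable gaussian_decay_L2 gaussian_decay_of_real gaussian_decay_power_hermite h)
      have "(LINT x|lborel. ?s N x)
        = (LINT x|lborel. (\<Sum>i<N. ((\<i> * of_real t) ^ i /\<^sub>R fact i) * (of_real (x ^ i * hermite 0 x) * h x)))"
        unfolding k_def sum_distrib_right
        by (intro Bochner_Integration.integral_cong sum.cong refl) (simp add: power_mult_distrib scaleR_conv_of_real)
      also have "\<dots> = 0"
        by (subst Bochner_Integration.integral_sum, rule integrable_mult_right, rule i)
           (simp only: integral_mult_right_zero hermite_moments_zero[OF h z] mult_zero_right sum.neutral_const)
      finally show ?thesis .
    qed
    ultimately have "(\<lambda>N::nat. 0) \<longlonglongrightarrow> (LINT x|lborel. iexp (t * x) * k x)" by (simp only:)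
    then show ?thesis by (simp only: LIMSEQ_const_iff)
  qed
  then have "AE x in lborel. k x = 0" by (rule fourier_injective[OF k])
  then show ?thesis by eventually_elim (simp add: k_def hermite.simps)
qed

text \<open>By Bessel's inequality the partial sums are Cauchy. Their limit g has the same
  coefficients as f, since coefficients are continuous in the norm, and totality identifies g with
  f.\<close>

lemma hermite_expansion:
  assumes f: "L2 f"
  shows "(\<lambda>K. L2_norm (\<lambda>x. (\<Sum>i<K. hcoef f i * of_real (hermite i x)) - f x)) \<longlonglongrightarrow> 0"
proof -
  let ?p = "\<lambda>K x. \<Sum>i<K. hcoef f i * of_real (hermite i x)"
  let ?a = "\<lambda>i. (cmod (hcoef f i))\<^sup>2"
  have L: "L2 (?p K)" for K by (rule L2_sum_hermite)
  have "(\<Sum>i<K. ?a i) \<le> (L2_norm f)\<^sup>2" for K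
    using L2_norm_hermite_remainder[OF f, of K] zero_le_power2[of "L2_norm (\<lambda>x. f x - ?p K x)"] by linarith
  then have sum: "summable ?a" by (intro summableI_nonneg_bounded) auto
  have diff: "(L2_norm (\<lambda>x. ?p m x - ?p n x))\<^sup>2 = (\<Sum>i=n..<m. ?a i)" if "n \<le> m" for m n
  proof -
    have "?p m x - ?p n x = (\<Sum>i=n..<m. hcoef f i * of_real (hermite i x))" for x
      using sum_diff_nat_ivl[of 0 n m "\<lambda>i. hcoef f i * of_real (hermite i x)"] that by (simp add: lessThan_atLeast0)
    then show ?thesis by (simp add: L2_norm_sum_hermite)
  qed
  obtain g where g: "L2 g" "(\<lambda>K. L2_norm (\<lambda>x. ?p K x - g x)) \<longlonglongrightarrow> 0"
  proof (rule L2_complete[OF L])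
    fix e :: real assume e: "e > 0"
    obtain N where N: "\<And>m n. m \<ge> N \<Longrightarrow> norm (\<Sum>i=m..<n. ?a i) < e\<^sup>2"
      using sum e unfolding summable_Cauchy by (metis zero_less_power)
    have le: "L2_norm (\<lambda>x. ?p m x - ?p n x) < e" if "n \<le> m" "n \<ge> N" for m n
    proof (rule power2_less_imp_less)
      show "(L2_norm (\<lambda>x. ?p m x - ?p n x))\<^sup>2 < e\<^sup>2"
        using N[OF that(2), of m] diff[OF that(1)] by simp
    qed (use e in simp)
    show "\<exists>N. \<forall>m\<ge>N. \<forall>n\<ge>N. L2_norm (\<lambda>x. ?p m x - ?p n x) < e"
    proof (intro exI[of _ N] allI impI)
      fix m n assume "N \<le> m" "N \<le> n"
      then show "L2_norm (\<lambda>x. ?p m x - ?p n x) < e"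
        using le[of n m] le[of m n] L2_norm_minus_commute[of "?p m" "?p n"] by (cases "n \<le> m") auto
    qed
  qed blast
  have "hcoef g n = hcoef f n" for n
  proof -
    have "(\<lambda>K. hcoef (?p K) n - hcoef g n) \<longlonglongrightarrow> 0"
    proof (rule Lim_null_comparison[OF always_eventually[OF allI] g(2)])
      fix K show "norm (hcoef (?p K) n - hcoef g n) \<le> L2_norm (\<lambda>x. ?p K x - g x)"
        unfolding hcoef_diff[OF L g(1), symmetric] by (intro hcoef_le_L2_norm L2_diff L g)
    qed
    moreover have "\<forall>\<^sub>F K in sequentially. hcoef (?p K) n - hcoef g n = hcoef f n - hcoef g n"
      using eventually_gt_at_top[of n] by eventually_elim (simp add: hcoef_sum_hermite)
    ultimately have "(\<lambda>K::nat. hcoef f n - hcoef g n) \<longlonglongrightarrow> 0"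
      by (rule Lim_transform_eventually)
    then show ?thesis by (simp add: LIMSEQ_const_iff)
  qed
  then have "AE x in lborel. f x - g x = 0"
    by (intro hermite_total L2_diff f g) (simp add: hcoef_diff f g)
  then have "L2_norm (\<lambda>x. ?p K x - g x) = L2_norm (\<lambda>x. ?p K x - f x)" for K
    using L[of K] f g by (intro L2_norm_cong_AE) (auto elim!: eventually_mono dest: L2_measurable)
  with g(2) show ?thesis by simp
qed

lemma hcoef_determines:
  assumes "L2 f" "L2 g" "\<And>n. hcoef f n = hcoef g n"
  shows "AE x in lborel. f x = g x"
  using hermite_total[OF L2_diff[OF assms(1,2)]] assms by (simp add: hcoef_diff)

subsection \<open>The propagator on Hermite expansions\<close>

context
  fixes U :: "real \<Rightarrow> (real \<Rightarrow> complex) \<Rightarrow> real \<Rightarrow> complex"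
  assumes P: "is_propagator U"
begin

lemma propagator_L2: "L2 f \<Longrightarrow> L2 (U t f)"
  using P unfolding is_propagator_def by blast

lemma propagator_norm: "L2 f \<Longrightarrow> L2_norm (U t f) = L2_norm f"
  using P unfolding is_propagator_def by blast

lemma propagator_linear:
  "L2 f \<Longrightarrow> L2 g \<Longrightarrow> AE x in lborel. U t (\<lambda>y. a * f y + b * g y) x = a * U t f x + b * U t g x"
  using P unfolding is_propagator_def by blast

lemma propagator_0: "L2 f \<Longrightarrow> AE x in lborel. U 0 f x = f x"
  using P unfolding is_propagator_def by blast

lemma propagator_add: "L2 f \<Longrightarrow> AE x in lborel. U (s + t) f x = U s (U t f) x"
  using P unfolding is_propagator_def by blast

lemma propagator_generator: "f \<in> osc_core \<Longrightarrow>
  ((\<lambda>h. L2_norm (\<lambda>x. \<i> * ((U h f x - f x) / of_real h) + osc f x)) \<longlongrightarrow> 0) (at 0)"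
  using P unfolding is_propagator_def by blast

text \<open>Linearity of \<open>U t\<close> turns its isometry into a statement about differences.
  In particular functions that agree almost everywhere have images that agree almost
  everywhere.\<close>

lemma propagator_diff_cmult_norm:
  assumes "L2 f" "L2 g"
  shows "L2_norm (\<lambda>x. U t f x - c * U t g x) = L2_norm (\<lambda>x. f x - c * g x)"
proof -
  have L: "L2 (\<lambda>y. 1 * f y + (- c) * g y)" by (intro L2_add L2_cmult assms)
  have "AE x in lborel. U t f x - c * U t g x = U t (\<lambda>y. 1 * f y + (- c) * g y) x"
    using propagator_linear[OF assms, of t 1 "- c"] by eventually_elim simp
  then have "L2_norm (\<lambda>x. U t f x - c * U t g x) = L2_norm (U t (\<lambda>y. 1 * f y + (- c) * g y))"
    using L2_measurable[OF L2_diff[OF propagator_L2[OF assms(1)] L2_cmult[OF propagator_L2[OF assms(2)]]]]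
      L2_measurable[OF propagator_L2[OF L]]
    by (intro L2_norm_cong_AE) auto
  also have "\<dots> = L2_norm (\<lambda>x. f x - c * g x)"
    unfolding propagator_norm[OF L] by simp
  finally show ?thesis .
qed

lemma propagator_diff_norm:
  "L2 f \<Longrightarrow> L2 g \<Longrightarrow> L2_norm (\<lambda>x. U t f x - U t g x) = L2_norm (\<lambda>x. f x - g x)"
  using propagator_diff_cmult_norm[of f g t 1] by simp

text \<open>The defect \<open>n(t) = \<parallel>U t \<phi> - e\<^bsup>ilt\<^esup> \<phi>\<parallel>\<close> of an eigenfunction is subadditive in \<open>t\<close> and \<open>o(t)\<close> at
  \<open>0\<close>, so \<open>n(t) \<le> N n(t / N)\<close> forces it to vanish.\<close>

lemma propagator_eigenfunction:
  fixes l :: real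
  assumes f: "f \<in> osc_core" and eig: "osc f = (\<lambda>x. of_real l * f x)"
  shows "AE x in lborel. U t f x = cis (l * t) * f x"
proof -
  have L: "L2 f" using f by (simp add: osc_core_def)
  define n where "n t = L2_norm (\<lambda>x. U t f x - cis (l * t) * f x)" for t
  have Ld: "L2 (\<lambda>x. U t f x - c * f x)" for t c by (intro L2_diff L2_cmult propagator_L2 L)
  have n0: "n 0 = 0"
    unfolding n_def using propagator_0[OF L] by (subst L2_norm_eq_0[OF Ld]) auto
  have sub: "n (s + t) \<le> n s + n t" for s t
  proof -
    let ?g = "U t f"
    have g: "L2 ?g" "L2 (U s ?g)" "L2 (U s f)" by (intro propagator_L2 L)+
    have "n (s + t) = L2_norm (\<lambda>x. U s ?g x - cis (l * (s + t)) * f x)"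
      unfolding n_def
    proof (rule L2_norm_cong_AE)
      show "AE x in lborel. U (s + t) f x - cis (l * (s + t)) * f x = U s ?g x - cis (l * (s + t)) * f x"
        using propagator_add[OF L, of s t] by eventually_elim simp
      show "(\<lambda>x. U s ?g x - cis (l * (s + t)) * f x) \<in> borel_measurable lborel"
        using L2_measurable[OF L2_diff[OF g(2) L2_cmult[OF L]]] by simp
    qed (use L2_measurable[OF Ld] in simp)
    \<comment> \<open>The intermediate function is cis (l t) \<open>U s f\<close>: its distance to
      \<open>U s ?g\<close> is n t because \<open>U s\<close> is isometric, and its distance to the
      target is n s because the phase has modulus 1.\<close>
    also have "\<dots> \<le> L2_norm (\<lambda>x. U s ?g x - cis (l * t) * U s f x)
        + L2_norm (\<lambda>x. cis (l * t) * U s f x - cis (l * (s + t)) * f x)"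
      by (intro L2_norm_triangle_diff L2_cmult g L)
    also have "L2_norm (\<lambda>x. U s ?g x - cis (l * t) * U s f x) = n t"
      unfolding n_def by (rule propagator_diff_cmult_norm[OF g(1) L])
    also have "(\<lambda>x. cis (l * t) * U s f x - cis (l * (s + t)) * f x)
        = (\<lambda>x. cis (l * t) * (U s f x - cis (l * s) * f x))"
    proof -
      have "cis (l * (s + t)) = cis (l * t) * cis (l * s)" by (simp add: cis_mult algebra_simps)
      then show ?thesis by (simp only: right_diff_distrib mult.assoc)
    qed
    also have "L2_norm \<dots> = n s" by (simp add: L2_norm_cmult n_def)
    finally show ?thesis by simp
  qed
  have mult: "n (real N * h) \<le> real N * n h" for N h
  proof (induction N)
    case (Suc N)
    have "n (real (Suc N) * h) \<le> n (real N * h) + n h"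
      using sub[of "real N * h" h] by (simp add: algebra_simps)
    with Suc show ?case by (simp add: algebra_simps)
  qed (simp add: n0)
  have small: "((\<lambda>h. n h / \<bar>h\<bar>) \<longlongrightarrow> 0) (at 0)"
  proof -
    let ?D = "\<lambda>h. L2_norm (\<lambda>x. \<i> * ((U h f x - f x) / of_real h) + osc f x)"
    \<comment> \<open>The quotient i (cis (l h) - 1) / h tends to i (i l) = - l, so this correction
      tends to 0. It measures how far the exact phase is from solving the equation at a finite step
      h.\<close>
    let ?c = "\<lambda>h. \<i> * (cis (l * h) - 1) / of_real h + of_real l"
    have "((\<lambda>h. sin (l * h)) has_real_derivative l) (at 0)" "((\<lambda>h. cos (l * h)) has_real_derivative 0) (at 0)"
      by (auto intro!: derivative_eq_intros)
    then have d: "((\<lambda>h. (sin (l * (0 + h)) - sin (l * 0)) / h) \<longlongrightarrow> l) (at 0)"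
      "((\<lambda>h. (cos (l * (0 + h)) - cos (l * 0)) / h) \<longlongrightarrow> 0) (at 0)"
      by (simp_all only: DERIV_def)
    have "?c = (\<lambda>h. Complex (l - (sin (l * (0 + h)) - sin (l * 0)) / h) ((cos (l * (0 + h)) - cos (l * 0)) / h))"
      by (auto simp: fun_eq_iff complex_eq_iff Re_divide_of_real Im_divide_of_real)
    moreover have "((\<lambda>h. Complex (l - (sin (l * (0 + h)) - sin (l * 0)) / h) ((cos (l * (0 + h)) - cos (l * 0)) / h))
      \<longlongrightarrow> Complex (l - l) 0) (at 0)"
      by (intro tendsto_Complex tendsto_diff tendsto_const d)
    ultimately have c: "(?c \<longlongrightarrow> 0) (at 0)" by (simp add: zero_complex.code)
    have le: "n h / \<bar>h\<bar> \<le> ?D h + cmod (?c h) * L2_norm f" if h: "h \<noteq> 0" for h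
    proof -
      have "n h / \<bar>h\<bar> = L2_norm (\<lambda>x. (\<i> / of_real h) * (U h f x - cis (l * h) * f x))"
        unfolding L2_norm_cmult n_def by (simp add: norm_divide)
      also have "(\<lambda>x. (\<i> / of_real h) * (U h f x - cis (l * h) * f x))
         = (\<lambda>x. (\<i> * ((U h f x - f x) / of_real h) + osc f x) - ?c h * f x)"
        using h unfolding eig by (auto simp: fun_eq_iff field_simps)
      also have "L2_norm \<dots> \<le> L2_norm (\<lambda>x. (\<i> * ((U h f x - f x) / of_real h) + osc f x)) + L2_norm (\<lambda>x. - (?c h * f x))"
        unfolding diff_conv_add_uminus
      proof (rule L2_norm_triangle)
        have "L2 (\<lambda>x. (\<i> / of_real h) * (U h f x - 1 * f x) + of_real l * f x)"
          by (intro L2_add L2_cmult Ld L)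
        then show "L2 (\<lambda>x. \<i> * ((U h f x + - f x) / of_real h) + osc f x)"
          unfolding eig by simp
        have "L2 (\<lambda>x. (- (\<i> * (cis (l * h) + - 1) / of_real h + of_real l)) * f x)" by (intro L2_cmult L)
        then show "L2 (\<lambda>x. - ((\<i> * (cis (l * h) + - 1) / of_real h + of_real l) * f x))"
          by (simp only: mult_minus_left)
      qed
      also have "L2_norm (\<lambda>x. - (?c h * f x)) = cmod (?c h) * L2_norm f"
        unfolding L2_norm_uminus by (rule L2_norm_cmult)
      finally show ?thesis .
    qed
    have "((\<lambda>h. ?D h + cmod (?c h) * L2_norm f) \<longlongrightarrow> 0 + 0 * L2_norm f) (at 0)"
      by (intro tendsto_add tendsto_mult tendsto_const propagator_generator f tendsto_norm_zero c)
    then have lim: "((\<lambda>h. ?D h + cmod (?c h) * L2_norm f) \<longlongrightarrow> 0) (at 0)" by simp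
    show ?thesis
    proof (rule Lim_null_comparison[OF _ lim])
      show "\<forall>\<^sub>F h in at 0. norm (n h / \<bar>h\<bar>) \<le> ?D h + cmod (?c h) * L2_norm f"
        unfolding eventually_at_filter using le by (auto simp: n_def intro!: always_eventually)
    qed
  qed
  have "n t = 0"
  proof (cases "t = 0")
    case False
    have lim: "filterlim (\<lambda>N. t / real (Suc N)) (at 0) sequentially"
      unfolding filterlim_at using False
      by (auto intro!: always_eventually LIMSEQ_Suc[OF lim_const_over_n] simp del: of_nat_Suc)
    have "(\<lambda>N. \<bar>t\<bar> * (n (t / real (Suc N)) / \<bar>t / real (Suc N)\<bar>)) \<longlonglongrightarrow> \<bar>t\<bar> * 0"
      by (intro tendsto_mult tendsto_const filterlim_compose[OF small lim])
    moreover have "n t \<le> \<bar>t\<bar> * (n (t / real (Suc N)) / \<bar>t / real (Suc N)\<bar>)" for N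
    proof -
      have "n t \<le> real (Suc N) * n (t / real (Suc N))"
        using mult[of "Suc N" "t / real (Suc N)"] by simp
      also have "\<dots> = \<bar>t\<bar> * (n (t / real (Suc N)) / \<bar>t / real (Suc N)\<bar>)"
        using False by (simp add: abs_divide field_simps)
      finally show ?thesis .
    qed
    ultimately have "n t \<le> \<bar>t\<bar> * 0" by (intro LIMSEQ_le_const) auto
    then show ?thesis by (simp add: n_def order_antisym)
  qed (simp add: n0)
  then have "AE x in lborel. U t f x - cis (l * t) * f x = 0"
    unfolding n_def L2_norm_eq_0[OF Ld] .
  then show ?thesis by eventually_elim simp
qed

lemma propagator_sum_hermite:
  assumes "finite I"
  shows "AE x in lborel. U t (\<lambda>x. \<Sum>i\<in>I. a i * of_real (hermite i x)) x
    = (\<Sum>i\<in>I. cis ((2 * real i + 1) * t) * a i * of_real (hermite i x))"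
  using assms
proof induction
  case empty
  show ?case using propagator_linear[OF L2_zero L2_zero, of t 0 0] by simp
next
  case (insert i I)
  let ?S = "\<lambda>x. \<Sum>i\<in>I. a i * of_real (hermite i x)"
  have e: "(\<lambda>x. \<Sum>i\<in>insert i I. a i * of_real (hermite i x)) = (\<lambda>x. a i * of_real (hermite i x) + 1 * ?S x)"
    using insert by simp
  show ?case unfolding e
    using propagator_linear[OF L2_hermite L2_sum_hermite, of t "a i" i 1 a I] insert.IH
      propagator_eigenfunction[OF hermite_osc_core osc_hermite, of t i]
  proof eventually_elim
    case (elim x)
    show ?case unfolding elim(1) elim(2) elim(3) using insert.hyps by (simp add: mult_ac)
  qed
qed

text \<open>By isometry the n-th coefficient of the evolved partial sum converges to that of
  \<open>U t f\<close>, and it no longer changes once K > n.\<close>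

lemma propagator_hcoef:
  assumes f: "L2 f"
  shows "hcoef (U t f) n = cis ((2 * real n + 1) * t) * hcoef f n"
proof -
  let ?p = "\<lambda>K x. \<Sum>i<K. hcoef f i * of_real (hermite i x)"
  have L: "L2 (?p K)" for K by (rule L2_sum_hermite)
  have "(\<lambda>K. hcoef (U t (?p K)) n - hcoef (U t f) n) \<longlonglongrightarrow> 0"
  proof (rule Lim_null_comparison[OF always_eventually[OF allI] hermite_expansion[OF f]])
    fix K show "norm (hcoef (U t (?p K)) n - hcoef (U t f) n) \<le> L2_norm (\<lambda>x. ?p K x - f x)"
      unfolding hcoef_diff[OF propagator_L2[OF L] propagator_L2[OF f], symmetric]
        propagator_diff_norm[OF L f, of t, symmetric]
      by (intro hcoef_le_L2_norm L2_diff propagator_L2 L f)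
  qed
  moreover have "\<forall>\<^sub>F K in sequentially. hcoef (U t (?p K)) n - hcoef (U t f) n
      = cis ((2 * real n + 1) * t) * hcoef f n - hcoef (U t f) n"
    using eventually_gt_at_top[of n]
  proof eventually_elim
    case (elim K)
    have "hcoef (U t (?p K)) n = hcoef (\<lambda>x. \<Sum>i<K. (cis ((2 * real i + 1) * t) * hcoef f i) * of_real (hermite i x)) n"
      using propagator_sum_hermite[of "{..<K}" t "hcoef f"] L2_measurable[OF propagator_L2[OF L]]
        L2_measurable[OF L2_sum_hermite]
      by (intro hcoef_cong_AE) auto
    with elim show ?case by (simp add: hcoef_sum_hermite)
  qed
  ultimately have "(\<lambda>K::nat. cis ((2 * real n + 1) * t) * hcoef f n - hcoef (U t f) n) \<longlonglongrightarrow> 0"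
    by (rule Lim_transform_eventually)
  then show ?thesis by (simp add: LIMSEQ_const_iff)
qed

end

subsection \<open>Products of Hermite functions in rotated coordinates\<close>

text \<open>Only the coefficient of the top index is prescribed, the one whose partner is
  \<open>hermite 0\<close> in the second rotated coordinate. The others merely have to exist,
  because their total square sum is found later from the rotation invariance of Lebesgue
  measure.\<close>

definition rotated_coeffs :: "nat \<Rightarrow> nat \<Rightarrow> (nat \<Rightarrow> real) \<Rightarrow> bool" where
  "rotated_coeffs i j r \<longleftrightarrow>
    (\<forall>x y. hermite i x * hermite j y
      = (\<Sum>m\<le>i + j. r m * (hermite m ((x + y) / sqrt 2) * hermite (i + j - m) ((x - y) / sqrt 2))))
    \<and> r (i + j) = sqrt (real (i + j choose i) / 2 ^ (i + j))"

text \<open>With u, v = (x + y) / sqrt 2, (x - y) / sqrt 2, the creation operator in x is the sum of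
  those in u and v divided by sqrt 2. Differentiating both sides of the expansion in x and comparing
  expresses the raised product through the raised terms; the parts multiplied by x cancel.\<close>

lemma rotated_coeffs_raise:
  assumes "rotated_coeffs i j r"
  shows "\<exists>r'. rotated_coeffs (Suc i) j r'"
proof -
  define N where "N = i + j"
  define s where "s n = sqrt (real n)" for n
  define c where "c = 1 / (sqrt 2 * s (Suc i))"
  \<comment> \<open>Index m of the new level is reached by raising u from m - 1 or by raising v from
    m; \<open>c\<close> removes the factor produced by raising in x.\<close>
  define r' where "r' m = c * ((if m = 0 then 0 else r (m - 1) * s m) + (if m \<le> N then r m * s (Suc N - m) else 0))" for m
  have eq: "hermite i x * hermite j y = (\<Sum>m\<le>N. r m * (hermite m ((x + y) / sqrt 2) * hermite (N - m) ((x - y) / sqrt 2)))" for x y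
    using assms by (simp add: rotated_coeffs_def N_def)
  have top: "r N = sqrt (real (N choose i) / 2 ^ N)" using assms by (simp add: rotated_coeffs_def N_def)
  have sc: "sqrt 2 * s (Suc i) * c = 1" by (simp add: c_def s_def)
  have main: "hermite (Suc i) x * hermite j y
    = (\<Sum>m\<le>Suc N. r' m * (hermite m ((x + y) / sqrt 2) * hermite (Suc N - m) ((x - y) / sqrt 2)))" for x y
  proof -
    define u where "u x = (x + y) / sqrt 2" for x
    define v where "v x = (x - y) / sqrt 2" for x
    have du: "(u has_real_derivative 1 / sqrt 2) (at x)" and dv: "(v has_real_derivative 1 / sqrt 2) (at x)"
      unfolding u_def[abs_def] v_def[abs_def] by (auto intro!: derivative_eq_intros simp: real_div_sqrt)
    have xuv: "x = (u x + v x) / sqrt 2"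
      by (simp add: u_def v_def add_divide_distrib[symmetric])
    define H where "H m k = hermite m (u x) * hermite k (v x)" for m k
    have dh: "((\<lambda>x. hermite m (u x)) has_real_derivative
        (u x * hermite m (u x) - sqrt 2 * s (Suc m) * hermite (Suc m) (u x)) * (1 / sqrt 2)) (at x)"
      "((\<lambda>x. hermite m (v x)) has_real_derivative
        (v x * hermite m (v x) - sqrt 2 * s (Suc m) * hermite (Suc m) (v x)) * (1 / sqrt 2)) (at x)" for m
      unfolding s_def by (rule DERIV_chain2[OF hermite_deriv_raise du], rule DERIV_chain2[OF hermite_deriv_raise dv])
    have dH: "((\<lambda>x. hermite m (u x) * hermite k (v x)) has_real_derivative
        x * H m k - (s (Suc m) * H (Suc m) k + s (Suc k) * H m (Suc k))) (at x)" for m k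
    proof -
      have "x * H m k - (s (Suc m) * H (Suc m) k + s (Suc k) * H m (Suc k)) =
        (u x * hermite m (u x) - sqrt 2 * s (Suc m) * hermite (Suc m) (u x)) * (1 / sqrt 2) * hermite k (v x)
        + (v x * hermite k (v x) - sqrt 2 * s (Suc k) * hermite (Suc k) (v x)) * (1 / sqrt 2) * hermite m (u x)"
      proof -
        have ring: "((U + V) * w) * (a * b) - (p * (a' * b) + q * (a * b'))
          = (U * a - t * p * a') * w * b + (V * b - t * q * b') * w * a"
          if "t * w = 1" for U V w a b p q a' b' t :: real
          using that by algebra
        have xw: "(u x + v x) * (1 / sqrt 2) = x" using xuv by simp
        have tw: "sqrt 2 * (1 / sqrt 2) = (1::real)" by simp
        show ?thesis
          using ring[OF tw, of "u x" "v x" "hermite m (u x)" "hermite k (v x)" "s (Suc m)" "hermite (Suc m) (u x)"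
              "s (Suc k)" "hermite (Suc k) (v x)"]
          unfolding xw H_def .
      qed
      then show ?thesis using DERIV_mult[OF dh(1)[of m] dh(2)[of k]] by (simp only: mult.commute)
    qed
    have "((\<lambda>x. \<Sum>m\<le>N. r m * (hermite m (u x) * hermite (N - m) (v x))) has_real_derivative
       (\<Sum>m\<le>N. r m * (x * H m (N - m) - (s (Suc m) * H (Suc m) (N - m) + s (Suc (N - m)) * H m (Suc (N - m)))))) (at x)"
      by (intro DERIV_sum DERIV_cmult dH)
    then have d1: "((\<lambda>x. hermite i x * hermite j y) has_real_derivative
       (\<Sum>m\<le>N. r m * (x * H m (N - m) - (s (Suc m) * H (Suc m) (N - m) + s (Suc (N - m)) * H m (Suc (N - m)))))) (at x)"
      unfolding eq u_def v_def by simp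
    have d2: "((\<lambda>x. hermite i x * hermite j y) has_real_derivative
       (x * hermite i x - sqrt 2 * s (Suc i) * hermite (Suc i) x) * hermite j y) (at x)"
      unfolding s_def by (rule DERIV_cmult_right[OF hermite_deriv_raise])
    have "(x * hermite i x - sqrt 2 * s (Suc i) * hermite (Suc i) x) * hermite j y
      = x * (\<Sum>m\<le>N. r m * H m (N - m))
        - (\<Sum>m\<le>N. r m * (s (Suc m) * H (Suc m) (N - m) + s (Suc (N - m)) * H m (Suc (N - m))))"
      using DERIV_unique[OF d2 d1] by (simp add: right_diff_distrib sum_subtractf sum_distrib_left mult.left_commute)
    moreover have "(\<Sum>m\<le>N. r m * H m (N - m)) = hermite i x * hermite j y"
      unfolding eq H_def u_def v_def ..
    ultimately have k: "sqrt 2 * s (Suc i) * (hermite (Suc i) x * hermite j y)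
      = (\<Sum>m\<le>N. r m * (s (Suc m) * H (Suc m) (N - m) + s (Suc (N - m)) * H m (Suc (N - m))))"
      by (simp add: left_diff_distrib mult.assoc)
    have "(\<Sum>m\<le>Suc N. r' m * H m (Suc N - m))
      = c * ((\<Sum>m\<le>Suc N. (if m = 0 then 0 else r (m - 1) * s m) * H m (Suc N - m))
         + (\<Sum>m\<le>Suc N. (if m \<le> N then r m * s (Suc N - m) else 0) * H m (Suc N - m)))"
      unfolding r'_def sum.distrib[symmetric] sum_distrib_left
      by (intro sum.cong refl) (simp only: distrib_right mult.assoc distrib_left)
    also have "(\<Sum>m\<le>Suc N. (if m = 0 then 0 else r (m - 1) * s m) * H m (Suc N - m))
      = (\<Sum>m\<le>N. r m * s (Suc m) * H (Suc m) (N - m))"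
      by (subst sum.atMost_Suc_shift) simp
    also have "(\<Sum>m\<le>Suc N. (if m \<le> N then r m * s (Suc N - m) else 0) * H m (Suc N - m))
      = (\<Sum>m\<le>N. r m * s (Suc (N - m)) * H m (Suc (N - m)))"
      by (simp add: Suc_diff_le)
    also have "(\<Sum>m\<le>N. r m * s (Suc m) * H (Suc m) (N - m)) + (\<Sum>m\<le>N. r m * s (Suc (N - m)) * H m (Suc (N - m)))
      = sqrt 2 * s (Suc i) * (hermite (Suc i) x * hermite j y)"
      unfolding k by (simp add: sum.distrib[symmetric] distrib_left mult.assoc)
    also have "c * (sqrt 2 * s (Suc i) * (hermite (Suc i) x * hermite j y)) = hermite (Suc i) x * hermite j y"
      using sc by (metis mult.assoc mult.commute mult_1)
    finally show ?thesis by (simp add: H_def u_def v_def)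
  qed
  \<comment> \<open>The top index is reached only by raising u, which multiplies the coefficient by
    sqrt ((N + 1) / (2 (i + 1))), the root of the ratio of the binomial weights.\<close>
  have "r' (Suc N) = sqrt (real (Suc N choose Suc i) / 2 ^ Suc N)"
  proof -
    have b: "real (Suc N choose Suc i) = real (Suc N) * real (N choose i) / real (Suc i)"
      using Suc_times_binomial[of i N] by (simp add: field_simps flip: of_nat_mult of_nat_Suc)
    have "r' (Suc N) = sqrt (real (N choose i) / 2 ^ N) * sqrt (real (Suc N)) / (sqrt 2 * sqrt (real (Suc i)))"
      by (simp add: r'_def top c_def s_def)
    also have "\<dots> = sqrt (real (N choose i) / 2 ^ N * real (Suc N) / (2 * real (Suc i)))"
      by (simp only: real_sqrt_mult real_sqrt_divide)
    also have "real (N choose i) / 2 ^ N * real (Suc N) / (2 * real (Suc i)) = real (Suc N choose Suc i) / 2 ^ Suc N"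
      unfolding b by (simp add: field_simps)
    finally show ?thesis .
  qed
  then have "rotated_coeffs (Suc i) j r'"
    using main unfolding rotated_coeffs_def N_def by simp
  then show ?thesis by (rule exI[of _ r'])
qed

text \<open>Exchanging x and y changes the sign of the second rotated coordinate only, and parity
  supplies the sign. At the top index the exponent is 0.\<close>

lemma rotated_coeffs_swap:
  assumes "rotated_coeffs i j r"
  shows "rotated_coeffs j i (\<lambda>m. (- 1) ^ (i + j - m) * r m)"
proof -
  have "hermite j x * hermite i y
    = (\<Sum>m\<le>j + i. (- 1) ^ (i + j - m) * r m * (hermite m ((x + y) / sqrt 2) * hermite (j + i - m) ((x - y) / sqrt 2)))" for x y
  proof -
    have "hermite j x * hermite i y = hermite i y * hermite j x" by simp
    also have "\<dots> = (\<Sum>m\<le>i + j. r m * (hermite m ((y + x) / sqrt 2) * hermite (i + j - m) ((y - x) / sqrt 2)))"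
      using assms by (simp only: rotated_coeffs_def)
    also have "(y - x) / sqrt 2 = - ((x - y) / sqrt 2)" by (simp add: minus_divide_left)
    finally show ?thesis by (simp only: hermite_minus add.commute mult_ac)
  qed
  moreover have "(i + j choose i) = (j + i choose j)"
    using binomial_symmetric[of i "i + j"] by (simp add: add.commute)
  ultimately show ?thesis using assms by (simp add: rotated_coeffs_def add.commute)
qed

text \<open>Raising acts on the first index only, so (i, j) is reached from (0, 0) via (j, 0), a
  swap to (0, j), and raising again.\<close>

lemma rotated_coeffs_exist: "\<exists>r. rotated_coeffs i j r"
proof -
  have "\<exists>r. rotated_coeffs 0 0 r"
  proof (intro exI)
    have "hermite 0 x * hermite 0 y = hermite 0 ((x + y) / sqrt 2) * hermite 0 ((x - y) / sqrt 2)" for x y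
      by (simp add: hermite.simps exp_add[symmetric] power_divide power2_sum power2_diff field_simps)
    then show "rotated_coeffs 0 0 (\<lambda>_. 1)" by (simp add: rotated_coeffs_def)
  qed
  then have "\<exists>r. rotated_coeffs j 0 r" by (induction j) (auto dest: rotated_coeffs_raise)
  then have "\<exists>r. rotated_coeffs 0 j r" by (auto dest: rotated_coeffs_swap)
  then show ?thesis by (induction i) (auto dest: rotated_coeffs_raise)
qed

lemma level_rotation:
  fixes A :: "nat \<Rightarrow> complex"
  obtains a where
    "\<And>x y. (\<Sum>i\<le>N. A i * (of_real (hermite i x) * of_real (hermite (N - i) y)))
      = (\<Sum>m\<le>N. a m * (of_real (hermite m ((x + y) / sqrt 2)) * of_real (hermite (N - m) ((x - y) / sqrt 2))))"
    "a N = (\<Sum>i\<le>N. of_real (sqrt (real (N choose i) / 2 ^ N)) * A i)"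
proof -
  obtain r where r: "\<And>i. rotated_coeffs i (N - i) (r i)"
    using choice[of "\<lambda>i. rotated_coeffs i (N - i)"] rotated_coeffs_exist by blast
  define a where "a m = (\<Sum>i\<le>N. of_real (r i m) * A i)" for m
  have "(\<Sum>i\<le>N. A i * (of_real (hermite i x) * of_real (hermite (N - i) y)))
      = (\<Sum>m\<le>N. a m * (of_real (hermite m ((x + y) / sqrt 2)) * of_real (hermite (N - m) ((x - y) / sqrt 2))))" for x y
  proof -
    have "(\<Sum>i\<le>N. A i * (of_real (hermite i x) * of_real (hermite (N - i) y)))
      = (\<Sum>i\<le>N. A i * of_real (\<Sum>m\<le>N. r i m * (hermite m ((x + y) / sqrt 2) * hermite (N - m) ((x - y) / sqrt 2))))"
    proof (intro sum.cong refl)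
      fix i assume "i \<in> {..N}"
      then have "hermite i x * hermite (N - i) y
        = (\<Sum>m\<le>N. r i m * (hermite m ((x + y) / sqrt 2) * hermite (N - m) ((x - y) / sqrt 2)))"
        using r[of i] by (simp add: rotated_coeffs_def)
      then show "A i * (of_real (hermite i x) * of_real (hermite (N - i) y))
        = A i * of_real (\<Sum>m\<le>N. r i m * (hermite m ((x + y) / sqrt 2) * hermite (N - m) ((x - y) / sqrt 2)))"
        by (simp only: of_real_mult[symmetric])
    qed
    also have "\<dots> = (\<Sum>i\<le>N. \<Sum>m\<le>N. of_real (r i m) * A i *
        (of_real (hermite m ((x + y) / sqrt 2)) * of_real (hermite (N - m) ((x - y) / sqrt 2))))"
      unfolding of_real_sum sum_distrib_left by (intro sum.cong refl) (simp only: of_real_mult mult_ac)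
    also have "\<dots> = (\<Sum>m\<le>N. a m * (of_real (hermite m ((x + y) / sqrt 2)) * of_real (hermite (N - m) ((x - y) / sqrt 2))))"
      unfolding a_def sum_distrib_right by (rule sum.swap)
    finally show ?thesis .
  qed
  moreover have "a N = (\<Sum>i\<le>N. of_real (sqrt (real (N choose i) / 2 ^ N)) * A i)"
  proof -
    have "r i N = sqrt (real (N choose i) / 2 ^ N)" if "i \<le> N" for i
      using r[of i] that by (simp add: rotated_coeffs_def)
    then show ?thesis unfolding a_def by (intro sum.cong refl) simp
  qed
  ultimately show ?thesis by (rule that)
qed

subsection \<open>The sharp bound on one energy level\<close>

text \<open>The map is split into u = sqrt 2 x - v at fixed v and y = x - sqrt 2 v at fixed x. The
  two Jacobians cancel, so one-dimensional affine substitutions and Tonelli's theorem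
  suffice.\<close>

lemma nn_integral_rotation:
  fixes f :: "real \<Rightarrow> real \<Rightarrow> ennreal"
  assumes [measurable]: "(\<lambda>(x, y). f x y) \<in> borel_measurable (borel \<Otimes>\<^sub>M borel)"
  shows "(\<integral>\<^sup>+v. \<integral>\<^sup>+u. f ((u + v) / sqrt 2) ((u - v) / sqrt 2) \<partial>lborel \<partial>lborel)
    = (\<integral>\<^sup>+y. \<integral>\<^sup>+x. f x y \<partial>lborel \<partial>lborel)"
proof -
  have "(\<integral>\<^sup>+u. f ((u + v) / sqrt 2) ((u - v) / sqrt 2) \<partial>lborel)
      = sqrt 2 * (\<integral>\<^sup>+x. f x (x + - sqrt 2 * v) \<partial>lborel)" for v
  proof -
    have "(- v + sqrt 2 * x + v) / sqrt 2 = x" "(- v + sqrt 2 * x - v) / sqrt 2 = x + - sqrt 2 * v" for x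
      by (simp_all add: field_simps)
    then show ?thesis
      by (subst nn_integral_real_affine[where c = "sqrt 2" and t = "- v"]) simp_all
  qed
  then have "(\<integral>\<^sup>+v. \<integral>\<^sup>+u. f ((u + v) / sqrt 2) ((u - v) / sqrt 2) \<partial>lborel \<partial>lborel)
      = sqrt 2 * (\<integral>\<^sup>+v. \<integral>\<^sup>+x. f x (x + - sqrt 2 * v) \<partial>lborel \<partial>lborel)"
    by (simp only:) (subst nn_integral_cmult, measurable)
  also have "(\<integral>\<^sup>+v. \<integral>\<^sup>+x. f x (x + - sqrt 2 * v) \<partial>lborel \<partial>lborel)
      = (\<integral>\<^sup>+x. \<integral>\<^sup>+v. f x (x + - sqrt 2 * v) \<partial>lborel \<partial>lborel)"
    by (rule lborel_pair.Fubini') measurable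
  also have "sqrt 2 * (\<integral>\<^sup>+x. \<integral>\<^sup>+v. f x (x + - sqrt 2 * v) \<partial>lborel \<partial>lborel)
      = (\<integral>\<^sup>+x. sqrt 2 * (\<integral>\<^sup>+v. f x (x + - sqrt 2 * v) \<partial>lborel) \<partial>lborel)"
    by (subst nn_integral_cmult) measurable
  also have "\<dots> = (\<integral>\<^sup>+x. \<integral>\<^sup>+y. f x y \<partial>lborel \<partial>lborel)"
  proof (intro nn_integral_cong)
    fix x
    show "sqrt 2 * (\<integral>\<^sup>+v. f x (x + - sqrt 2 * v) \<partial>lborel) = (\<integral>\<^sup>+y. f x y \<partial>lborel)"
      by (subst (2) nn_integral_real_affine[where c = "- sqrt 2" and t = x]) auto
  qed
  also have "\<dots> = (\<integral>\<^sup>+y. \<integral>\<^sup>+x. f x y \<partial>lborel \<partial>lborel)"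
    by (rule lborel_pair.Fubini') measurable
  finally show ?thesis .
qed

lemma nn_integral_hermite_square: "(\<integral>\<^sup>+x. ennreal ((hermite n x)\<^sup>2) \<partial>lborel) = 1"
  using nn_integral_L2[OF L2_hermite[of n]] by (simp add: L2_norm_hermite)

lemma nn_integral_sum_hermite:
  assumes "finite I"
  shows "(\<integral>\<^sup>+x. ennreal ((cmod (\<Sum>i\<in>I. a i * of_real (hermite i x)))\<^sup>2) \<partial>lborel) = ennreal (\<Sum>i\<in>I. (cmod (a i))\<^sup>2)"
  unfolding nn_integral_L2[OF L2_sum_hermite] L2_norm_sum_hermite[OF assms] ..

lemma nn_integral_level_2d:
  "(\<integral>\<^sup>+y. \<integral>\<^sup>+x. ennreal ((cmod (\<Sum>i\<le>N. A i * (of_real (hermite i x) * of_real (hermite (N - i) y))))\<^sup>2) \<partial>lborel \<partial>lborel)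
    = ennreal (\<Sum>i\<le>N. (cmod (A i))\<^sup>2)"
proof -
  have "(\<integral>\<^sup>+x. ennreal ((cmod (\<Sum>i\<le>N. A i * (of_real (hermite i x) * of_real (hermite (N - i) y))))\<^sup>2) \<partial>lborel)
      = (\<Sum>i\<le>N. ennreal ((cmod (A i))\<^sup>2) * ennreal ((hermite (N - i) y)\<^sup>2))" for y
  proof -
    have "(\<Sum>i\<le>N. A i * (of_real (hermite i x) * of_real (hermite (N - i) y)))
      = (\<Sum>i\<le>N. (A i * of_real (hermite (N - i) y)) * of_real (hermite i x))" for x
      by (intro sum.cong refl) (simp only: mult_ac)
    then show ?thesis
      by (simp add: nn_integral_sum_hermite norm_mult power_mult_distrib ennreal_mult[symmetric] sum_ennreal)
  qed
  then have "(\<integral>\<^sup>+y. \<integral>\<^sup>+x. ennreal ((cmod (\<Sum>i\<le>N. A i * (of_real (hermite i x) * of_real (hermite (N - i) y))))\<^sup>2) \<partial>lborel \<partial>lborel)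
    = (\<Sum>i\<le>N. ennreal ((cmod (A i))\<^sup>2) * (\<integral>\<^sup>+y. ennreal ((hermite (N - i) y)\<^sup>2) \<partial>lborel))"
    by (simp add: nn_integral_sum nn_integral_cmult)
  then show ?thesis by (simp add: nn_integral_hermite_square sum_ennreal)
qed

text \<open>At 0 the recurrence gives h_(n+2)(0)^2 = (n+1)/(n+2) h_n(0)^2. Odd indices vanish, even
  ones decrease, and the step from 0 to 2 already halves the value.\<close>

lemma hermite_at_0: "(hermite 0 0)\<^sup>2 = 1 / sqrt pi" "n \<ge> 1 \<Longrightarrow> (hermite n 0)\<^sup>2 \<le> 1 / (2 * sqrt pi)"
proof -
  show zero: "(hermite 0 0)\<^sup>2 = 1 / sqrt pi" by (simp add: hermite.simps power_divide)
  have rec: "(hermite (Suc (Suc m)) 0)\<^sup>2 = real (Suc m) / real (Suc (Suc m)) * (hermite m 0)\<^sup>2" for m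
    by (simp add: hermite.simps power_divide power_mult_distrib del: of_nat_Suc)
  assume "n \<ge> 1"
  then show "(hermite n 0)\<^sup>2 \<le> 1 / (2 * sqrt pi)"
  proof (induction n rule: less_induct)
    case (less n)
    consider "n = 1" | "n = 2" | m where "n = Suc (Suc m)" "m \<ge> 1"
      using less.prems by (metis One_nat_def Suc_1 le_SucE le_Suc_ex not_less_eq_eq plus_1_eq_Suc)
    then show ?case
    proof cases
      case 1 then show ?thesis by (simp add: hermite.simps)
    next
      case 2 then show ?thesis using rec[of 0] zero by (simp add: numeral_2_eq_2)
    next
      case 3
      have "(hermite n 0)\<^sup>2 \<le> 1 * (hermite m 0)\<^sup>2"
        unfolding 3 rec by (intro mult_right_mono) auto
      also have "\<dots> \<le> 1 / (2 * sqrt pi)" using less.IH[of m] 3 by simp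
      finally show ?thesis .
    qed
  qed
qed

text \<open>On the diagonal the second rotated coordinate vanishes, and \<open>(hermite n 0)\<^sup>2\<close> is largest at
  \<open>n = 0\<close>, with a gap of at least a factor of two to all other values.\<close>

lemma nn_integral_level_diagonal:
  fixes A :: "nat \<Rightarrow> complex"
  shows "(\<integral>\<^sup>+x. ennreal ((cmod (\<Sum>i\<le>N. A i * (of_real (hermite i x) * of_real (hermite (N - i) x))))\<^sup>2) \<partial>lborel)
    \<le> ennreal (1 / sqrt (2 * pi) *
        (((\<Sum>i\<le>N. (cmod (A i))\<^sup>2) + (cmod (\<Sum>i\<le>N. of_real (sqrt (real (N choose i) / 2 ^ N)) * A i))\<^sup>2) / 2))"
proof -
  obtain a where a: "\<And>x y. (\<Sum>i\<le>N. A i * (of_real (hermite i x) * of_real (hermite (N - i) y)))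
      = (\<Sum>m\<le>N. a m * (of_real (hermite m ((x + y) / sqrt 2)) * of_real (hermite (N - m) ((x - y) / sqrt 2))))"
    and top: "a N = (\<Sum>i\<le>N. of_real (sqrt (real (N choose i) / 2 ^ N)) * A i)"
    by (rule level_rotation[of A N]) (rule that)
  \<comment> \<open>The passage from A to a preserves the norm: both square sums are the integral
    over the plane of the same function, computed in the two coordinate systems.\<close>
  have "ennreal (\<Sum>i\<le>N. (cmod (A i))\<^sup>2) = ennreal (\<Sum>m\<le>N. (cmod (a m))\<^sup>2)"
  proof -
    have uv: "((u + v) / sqrt 2 + (u - v) / sqrt 2) / sqrt 2 = u" "((u + v) / sqrt 2 - (u - v) / sqrt 2) / sqrt 2 = v" for u v :: real
      by (simp_all add: add_divide_distrib[symmetric] diff_divide_distrib[symmetric])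
    let ?f = "\<lambda>x y. ennreal ((cmod (\<Sum>i\<le>N. A i * (of_real (hermite i x) * of_real (hermite (N - i) y))))\<^sup>2)"
    have "(\<integral>\<^sup>+v. \<integral>\<^sup>+u. ?f ((u + v) / sqrt 2) ((u - v) / sqrt 2) \<partial>lborel \<partial>lborel) = (\<integral>\<^sup>+y. \<integral>\<^sup>+x. ?f x y \<partial>lborel \<partial>lborel)"
      by (rule nn_integral_rotation) measurable
    then show ?thesis unfolding nn_integral_level_2d unfolding a uv nn_integral_level_2d by simp
  qed
  then have norm_eq: "(\<Sum>i\<le>N. (cmod (A i))\<^sup>2) = (\<Sum>m\<le>N. (cmod (a m))\<^sup>2)"
    by (simp add: sum_nonneg)
  let ?S = "\<lambda>x. \<Sum>m\<le>N. (a m * of_real (hermite (N - m) 0)) * of_real (hermite m x)"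
  have "(\<Sum>i\<le>N. A i * (of_real (hermite i x) * of_real (hermite (N - i) x))) = ?S (0 + sqrt 2 * x)" for x
  proof -
    have "(x + x) / sqrt 2 = sqrt 2 * x"
      by (metis mult.commute mult_2 nonzero_mult_div_cancel_left power2_eq_square real_div_sqrt real_sqrt_eq_zero_cancel_iff times_divide_eq_left zero_le_numeral zero_neq_numeral)
    then show ?thesis unfolding a by (simp add: mult_ac)
  qed
  then have "sqrt 2 * (\<integral>\<^sup>+x. ennreal ((cmod (\<Sum>i\<le>N. A i * (of_real (hermite i x) * of_real (hermite (N - i) x))))\<^sup>2) \<partial>lborel)
    = (\<integral>\<^sup>+x. ennreal ((cmod (?S x))\<^sup>2) \<partial>lborel)"
    by (subst (2) nn_integral_real_affine[where c = "sqrt 2" and t = 0]) auto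
  also have "\<dots> = ennreal (\<Sum>m\<le>N. (cmod (a m))\<^sup>2 * (hermite (N - m) 0)\<^sup>2)"
    by (simp add: nn_integral_sum_hermite norm_mult power_mult_distrib)
  also have "\<dots> \<le> ennreal (sqrt 2 * (1 / sqrt (2 * pi) * (((\<Sum>i\<le>N. (cmod (a i))\<^sup>2) + (cmod (a N))\<^sup>2) / 2)))"
  proof (rule ennreal_leI)
    have "(\<Sum>m\<le>N. (cmod (a m))\<^sup>2 * (hermite (N - m) 0)\<^sup>2)
      \<le> (\<Sum>m<N. (cmod (a m))\<^sup>2 * (1 / (2 * sqrt pi))) + (cmod (a N))\<^sup>2 * (1 / sqrt pi)"
      unfolding lessThan_Suc_atMost[symmetric] sum.lessThan_Suc
      by (intro add_mono sum_mono mult_left_mono) (auto simp: hermite_at_0)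
    \<comment> \<open>All terms get the weight 1 / (2 sqrt pi), and the top one gets it once more.
      The leading sqrt 2 undoes the substitution u = sqrt 2 x on the diagonal.\<close>
    also have "\<dots> = sqrt 2 * (1 / sqrt (2 * pi) * (((\<Sum>i\<le>N. (cmod (a i))\<^sup>2) + (cmod (a N))\<^sup>2) / 2))"
      unfolding lessThan_Suc_atMost[symmetric] sum.lessThan_Suc sum_distrib_right[symmetric]
      by (simp add: real_sqrt_mult field_simps)
    finally show "(\<Sum>m\<le>N. (cmod (a m))\<^sup>2 * (hermite (N - m) 0)\<^sup>2)
      \<le> sqrt 2 * (1 / sqrt (2 * pi) * (((\<Sum>i\<le>N. (cmod (a i))\<^sup>2) + (cmod (a N))\<^sup>2) / 2))" .
  qed
  also have "\<dots> = sqrt 2 * ennreal (1 / sqrt (2 * pi) * (((\<Sum>i\<le>N. (cmod (A i))\<^sup>2) + (cmod (a N))\<^sup>2) / 2))"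
    unfolding norm_eq by (intro ennreal_mult) (auto simp: sum_nonneg)
  finally show ?thesis unfolding top by (subst (asm) ennreal_mult_le_mult_iff) auto
qed

section \<open>Coherent component and defect of a level\<close>

lemma sum_choose_div: "(\<Sum>i\<le>N. real (N choose i) / 2 ^ N) = 1"
proof -
  have "(\<Sum>i\<le>N. real (N choose i)) = 2 ^ N"
    using choose_row_sum[of N] by (simp flip: of_nat_sum)
  then show ?thesis by (simp add: sum_divide_distrib[symmetric])
qed

definition level_energy :: "(nat \<Rightarrow> complex) \<Rightarrow> (nat \<Rightarrow> complex) \<Rightarrow> nat \<Rightarrow> real" where
  "level_energy a b N = (\<Sum>i\<le>N. (cmod (a i * b (N - i)))\<^sup>2)"

text \<open>The coefficient of \<open>hermite N\<close> (u) \<open>hermite 0\<close> (v) in the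
  rotated expansion of the level, that is, the inner product with the unit vector of roots of
  binomial weights.\<close>

definition level_coherent :: "(nat \<Rightarrow> complex) \<Rightarrow> (nat \<Rightarrow> complex) \<Rightarrow> nat \<Rightarrow> complex" where
  "level_coherent a b N = (\<Sum>i\<le>N. of_real (sqrt (real (N choose i) / 2 ^ N)) * (a i * b (N - i)))"

text \<open>The squared distance of \<open>(a i * b (N - i))\<close> to the line spanned by the unit vector
  \<open>sqrt ((N choose i) / 2 ^ N)\<close>.\<close>

definition level_defect :: "(nat \<Rightarrow> complex) \<Rightarrow> (nat \<Rightarrow> complex) \<Rightarrow> nat \<Rightarrow> real" where
  "level_defect a b N = (\<Sum>i\<le>N. (cmod (a i * b (N - i)
      - of_real (sqrt (real (N choose i) / 2 ^ N)) * level_coherent a b N))\<^sup>2)"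

text \<open>Pythagoras; the vector of binomial roots has norm 1 by
  \<open>sum_choose_div\<close>.\<close>

lemma level_defect_eq:
  "level_defect a b N = level_energy a b N - (cmod (level_coherent a b N))\<^sup>2"
proof -
  let ?e = "\<lambda>i. sqrt (real (N choose i) / 2 ^ N)"
  let ?c = "level_coherent a b N"
  have p: "(cmod (z - of_real e * w))\<^sup>2 = (cmod z)\<^sup>2 - 2 * Re (cnj w * (of_real e * z)) + e\<^sup>2 * (cmod w)\<^sup>2" for z w :: complex and e
    by (simp add: cmod_power2 power2_diff power_mult_distrib algebra_simps)
  have "level_defect a b N = level_energy a b N
     - 2 * Re (cnj ?c * (\<Sum>i\<le>N. of_real (?e i) * (a i * b (N - i)))) + (\<Sum>i\<le>N. (?e i)\<^sup>2) * (cmod ?c)\<^sup>2"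
    unfolding level_defect_def level_energy_def p sum.distrib sum_subtractf sum_distrib_left sum_distrib_right Re_sum ..
  also have "(\<Sum>i\<le>N. of_real (?e i) * (a i * b (N - i))) = ?c"
    by (simp add: level_coherent_def)
  also have "Re (cnj ?c * ?c) = (cmod ?c)\<^sup>2"
    unfolding cmod_power2 by (simp add: power2_eq_square)
  also have "(\<Sum>i\<le>N. (?e i)\<^sup>2) = 1" using sum_choose_div[of N] by simp
  finally show ?thesis by simp
qed

lemma level_defect_nonneg: "0 \<le> level_defect a b N"
  by (simp add: level_defect_def sum_nonneg)

section \<open>Sums over levels and orthogonality of their phases\<close>

text \<open>The levels below 2 K contain all pairs of indices below K. They also contain pairs with
  one index at least K, which the support conditions annihilate, so that every level can be summed
  in full.\<close>

lemma sum_mult_triangle: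
  fixes f g :: "nat \<Rightarrow> 'a::idom"
  assumes "\<And>i. i \<ge> K \<Longrightarrow> f i = 0" "\<And>i. i \<ge> K \<Longrightarrow> g i = 0"
  shows "(\<Sum>i<K. f i) * (\<Sum>j<K. g j) = (\<Sum>N<2 * K. \<Sum>i\<le>N. f i * g (N - i))"
proof -
  have "(\<Sum>i<K. f i) * (\<Sum>j<K. g j) = (\<Sum>(i, j)\<in>{..<K} \<times> {..<K}. f i * g j)"
    by (simp add: sum_product sum.cartesian_product)
  also have "\<dots> = (\<Sum>(i, j)\<in>{(i, j). i + j < 2 * K}. f i * g j)"
  proof (rule sum.mono_neutral_left)
    have "{(i, j). i + j < 2 * K} \<subseteq> {..<2 * K} \<times> {..<2 * K}" by auto
    then show "finite {(i, j). i + j < 2 * K}" by (rule finite_subset) simp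
    have "i < K" if "f i \<noteq> 0" for i
      using that assms(1)[of i] by (cases "i < K") auto
    moreover have "i < K" if "g i \<noteq> 0" for i
      using that assms(2)[of i] by (cases "i < K") auto
    ultimately show "\<forall>p\<in>{(i, j). i + j < 2 * K} - {..<K} \<times> {..<K}. (case p of (i, j) \<Rightarrow> f i * g j) = 0"
      by auto
  qed auto
  also have "\<dots> = (\<Sum>N<2 * K. \<Sum>i\<le>N. f i * g (N - i))" by (rule sum.triangle_reindex)
  finally show ?thesis .
qed

text \<open>The interval has length pi because over [0, pi/2] the integral vanishes only for even
  nonzero k; levels of different parity would not decouple there.\<close>

lemma has_integral_cis:
  "((\<lambda>t. cis (2 * of_int k * t)) has_integral (if k = 0 then of_real pi else 0)) {0..pi}"
proof (cases "k = 0")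
  case True
  then show ?thesis using has_integral_const_real[of "1::complex" 0 pi] by (simp add: scaleR_conv_of_real)
next
  case False
  have "((\<lambda>t. cis (2 * of_int k * t)) has_integral
      (- \<i> / (2 * of_int k) * cis (2 * of_int k * pi) - - \<i> / (2 * of_int k) * cis (2 * of_int k * 0))) {0..pi}"
  proof (rule fundamental_theorem_of_calculus)
    fix t
    show "((\<lambda>t. - \<i> / (2 * of_int k) * cis (2 * of_int k * t)) has_vector_derivative cis (2 * of_int k * t)) (at t within {0..pi})"
    proof -
      have "((\<lambda>z. - \<i> / (2 * of_int k) * exp (\<i> * (2 * of_int k * z))) has_field_derivative
          exp (\<i> * (2 * of_int k * of_real t))) (at (of_real t))"
        using False by (auto intro!: derivative_eq_intros)
      from has_vector_derivative_real_field[OF this, of "{0..pi}"] show ?thesis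
        by (simp add: cis_conv_exp)
    qed
  qed simp
  moreover have "cis (2 * of_int k * pi) = 1"
    using cis_multiple_2pi[of "of_int k"] by (simp add: mult_ac)
  ultimately show ?thesis using False by simp
qed

lemma nn_integral_trig_Parseval:
  fixes c :: "nat \<Rightarrow> complex"
  shows "(\<integral>\<^sup>+t. ennreal ((cmod (\<Sum>N<M. cis (2 * (real N + 1) * t) * c N))\<^sup>2) * indicator {0..pi} t \<partial>lborel)
    = ennreal (pi * (\<Sum>N<M. (cmod (c N))\<^sup>2))"
proof -
  let ?S = "\<lambda>t. \<Sum>N<M. cis (2 * (real N + 1) * t) * c N"
  have e: "complex_of_real ((cmod (?S t))\<^sup>2) = (\<Sum>N<M. \<Sum>L<M. (c N * cnj (c L)) * cis (2 * of_int (int N - int L) * t))" for t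
  proof -
    have "complex_of_real ((cmod (?S t))\<^sup>2) = ?S t * cnj (?S t)" by (rule complex_norm_square)
    also have "\<dots> = (\<Sum>N<M. \<Sum>L<M. (c N * cnj (c L)) * (cis (2 * (real N + 1) * t) * cis (- (2 * (real L + 1) * t))))"
      unfolding cnj_sum sum_product by (intro sum.cong refl) (simp add: cis_cnj mult_ac)
    also have "\<dots> = (\<Sum>N<M. \<Sum>L<M. (c N * cnj (c L)) * cis (2 * of_int (int N - int L) * t))"
      unfolding cis_mult by (intro sum.cong refl) (simp add: algebra_simps)
    finally show ?thesis .
  qed
  have "((\<lambda>t. complex_of_real ((cmod (?S t))\<^sup>2)) has_integral
     (\<Sum>N<M. \<Sum>L<M. (c N * cnj (c L)) * (if int N - int L = 0 then of_real pi else 0))) {0..pi}"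
    unfolding e by (intro has_integral_sum has_integral_mult_right has_integral_cis) auto
  also have "(\<Sum>N<M. \<Sum>L<M. (c N * cnj (c L)) * (if int N - int L = 0 then of_real pi else 0))
     = (\<Sum>N<M. of_real ((cmod (c N))\<^sup>2 * pi))"
  proof (intro sum.cong refl)
    fix N assume N: "N \<in> {..<M}"
    have "(\<Sum>L<M. (c N * cnj (c L)) * (if int N - int L = 0 then of_real pi else 0))
      = (\<Sum>L<M. if N = L then (c N * cnj (c L)) * of_real pi else 0)"
      by (intro sum.cong refl) auto
    also have "\<dots> = (c N * cnj (c N)) * of_real pi"
      using N by (subst sum.delta') auto
    also have "\<dots> = of_real ((cmod (c N))\<^sup>2 * pi)"
      unfolding complex_norm_square[symmetric] by (rule of_real_mult[symmetric])
    finally show "(\<Sum>L<M. (c N * cnj (c L)) * (if int N - int L = 0 then of_real pi else 0))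
      = of_real ((cmod (c N))\<^sup>2 * pi)" .
  qed
  also have "\<dots> = of_real (pi * (\<Sum>N<M. (cmod (c N))\<^sup>2))"
    by (simp add: sum_distrib_left mult.commute)
  finally have C: "((\<lambda>t. complex_of_real ((cmod (?S t))\<^sup>2)) has_integral
      of_real (pi * (\<Sum>N<M. (cmod (c N))\<^sup>2))) {0..pi}" .
  have "((\<lambda>t. (cmod (?S t))\<^sup>2) has_integral (pi * (\<Sum>N<M. (cmod (c N))\<^sup>2))) {0..pi}"
    using has_integral_linear[OF C bounded_linear_Re] by (simp only: o_def Re_complex_of_real)
  then show ?thesis by (intro nn_integral_has_integral_lebesgue') auto
qed

subsection \<open>The bilinear bound for finite Hermite expansions\<close>

text \<open>An explicit, jointly measurable representative of the propagator applied to a finite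
  Hermite expansion; \<open>U\<close> itself is specified only almost everywhere for each t.\<close>

definition evolve :: "nat \<Rightarrow> (nat \<Rightarrow> complex) \<Rightarrow> real \<Rightarrow> real \<Rightarrow> complex" where
  "evolve K a t x = (\<Sum>i<K. cis ((2 * real i + 1) * t) * a i * of_real (hermite i x))"

lemma evolve_measurable [measurable]: "(\<lambda>(t, x). evolve K a t x) \<in> borel_measurable (borel \<Otimes>\<^sub>M borel)"
proof -
  have "cis \<in> borel_measurable borel"
    by (intro borel_measurable_continuous_onI continuous_on_cis continuous_on_id)
  note [measurable] = measurable_compose[OF _ this]
  show ?thesis unfolding evolve_def by measurable
qed

text \<open>A time shift by pi/2 multiplies the n-th term by i (-1)^n, and (-1)^n is the parity of
  \<open>hermite n\<close>.\<close>

lemma evolve_shift: "evolve K a (pi / 2 + t) x = \<i> * evolve K a t (- x)"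
proof -
  have c: "cis ((2 * real i + 1) * (pi / 2)) = \<i> * (- 1) ^ i" for i
  proof -
    have "cis ((2 * real i + 1) * (pi / 2)) = cis (real i * pi) * cis (pi / 2)"
      unfolding cis_mult by (simp add: field_simps)
    then show ?thesis by (simp add: Complex.DeMoivre[symmetric])
  qed
  have "cis ((2 * real i + 1) * (pi / 2 + t)) = \<i> * (- 1) ^ i * cis ((2 * real i + 1) * t)" for i
    unfolding c[symmetric] cis_mult by (simp add: distrib_left)
  then show ?thesis
    by (simp add: evolve_def sum_distrib_left hermite_minus mult_ac)
qed

text \<open>Twice the integral over [0, pi/2] is the integral over [0, pi], where the levels are
  orthogonal in time at every x. The diagonal estimate then applies to each level, and of all the
  defects gained only that of level M is kept.\<close>

lemma evolve_bilinear_bound: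
  assumes a: "\<And>i. i \<ge> K \<Longrightarrow> a i = 0" and b: "\<And>i. i \<ge> K \<Longrightarrow> b i = 0" and M: "M < 2 * K"
  shows "(\<integral>\<^sup>+t. (\<integral>\<^sup>+x. ennreal ((cmod (evolve K a t x * evolve K b t x))\<^sup>2) \<partial>lborel) * indicator {0..pi/2} t \<partial>lborel)
    \<le> ennreal (pi / 2 * (1 / sqrt (2 * pi) *
        ((\<Sum>i<K. (cmod (a i))\<^sup>2) * (\<Sum>i<K. (cmod (b i))\<^sup>2) - level_defect a b M / 2)))"
proof -
  define q where "q N x = (\<Sum>i\<le>N. (a i * b (N - i)) * (of_real (hermite i x) * of_real (hermite (N - i) x)))" for N x
  define G where "G t = (\<integral>\<^sup>+x. ennreal ((cmod (evolve K a t x * evolve K b t x))\<^sup>2) \<partial>lborel)" for t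
  have [measurable]: "G \<in> borel_measurable borel" unfolding G_def by measurable
  have prod: "evolve K a t x * evolve K b t x = (\<Sum>N<2 * K. cis (2 * (real N + 1) * t) * q N x)" for t x
    unfolding evolve_def q_def
  proof (subst sum_mult_triangle)
    show "(\<Sum>N<2 * K. \<Sum>i\<le>N. cis ((2 * real i + 1) * t) * a i * of_real (hermite i x)
           * (cis ((2 * real (N - i) + 1) * t) * b (N - i) * of_real (hermite (N - i) x)))
      = (\<Sum>N<2 * K. cis (2 * (real N + 1) * t) * (\<Sum>i\<le>N. (a i * b (N - i)) * (of_real (hermite i x) * of_real (hermite (N - i) x))))"
      unfolding sum_distrib_left
    proof (intro sum.cong refl)
      fix N i :: nat assume "i \<in> {..N}"
      then have "cis (2 * (real N + 1) * t) = cis ((2 * real i + 1) * t) * cis ((2 * real (N - i) + 1) * t)"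
        unfolding cis_mult by (simp add: of_nat_diff algebra_simps)
      then show "cis ((2 * real i + 1) * t) * a i * of_real (hermite i x)
           * (cis ((2 * real (N - i) + 1) * t) * b (N - i) * of_real (hermite (N - i) x))
        = cis (2 * (real N + 1) * t) * ((a i * b (N - i)) * (of_real (hermite i x) * of_real (hermite (N - i) x)))"
        by (simp only: mult_ac)
    qed
  qed (simp_all add: a b)
  have per: "G (pi / 2 + t) = G t" for t
  proof -
    have "G (pi / 2 + t) = (\<integral>\<^sup>+x. ennreal ((cmod (evolve K a t (0 + (- 1) * x) * evolve K b t (0 + (- 1) * x)))\<^sup>2) \<partial>lborel)"
      unfolding G_def evolve_shift by (simp add: norm_mult)
    also have "\<dots> = G t"
      unfolding G_def by (subst (2) nn_integral_real_affine[where c = "- 1" and t = 0]) auto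
    finally show ?thesis .
  qed
  have "(\<integral>\<^sup>+t. G t * indicator {pi/2<..pi} t \<partial>lborel) = (\<integral>\<^sup>+t. G (pi / 2 + 1 * t) * indicator {pi/2<..pi} (pi / 2 + 1 * t) \<partial>lborel)"
    by (subst nn_integral_real_affine[where c = 1 and t = "pi / 2"]) auto
  \<comment> \<open>The shifted interval is open at 0, so the two integrands agree except at t =
    0.\<close>
  also have "\<dots> = (\<integral>\<^sup>+t. G t * indicator {0..pi/2} t \<partial>lborel)"
    using AE_lborel_singleton[of "0::real"]
    by (intro nn_integral_cong_AE, eventually_elim) (auto simp: per indicator_def)
  finally have "(\<integral>\<^sup>+t. G t * indicator {0..pi/2} t \<partial>lborel) + (\<integral>\<^sup>+t. G t * indicator {0..pi/2} t \<partial>lborel)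
    = (\<integral>\<^sup>+t. G t * indicator {0..pi/2} t \<partial>lborel) + (\<integral>\<^sup>+t. G t * indicator {pi/2<..pi} t \<partial>lborel)" by simp
  also have "\<dots> = (\<integral>\<^sup>+t. G t * indicator {0..pi} t \<partial>lborel)"
  proof -
    have i: "indicator {0..pi/2} t + indicator {pi/2<..pi} t = (indicator {0..pi} t :: ennreal)" for t
      using pi_gt_zero by (auto simp: indicator_def)
    show ?thesis
      unfolding i[symmetric] distrib_left by (rule nn_integral_add[symmetric]) measurable
  qed
  also have "\<dots> = (\<integral>\<^sup>+t. \<integral>\<^sup>+x. ennreal ((cmod (\<Sum>N<2 * K. cis (2 * (real N + 1) * t) * q N x))\<^sup>2) * indicator {0..pi} t \<partial>lborel \<partial>lborel)"
    unfolding G_def prod[symmetric] by (subst nn_integral_multc) measurable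
  also have "\<dots> = (\<integral>\<^sup>+x. \<integral>\<^sup>+t. ennreal ((cmod (\<Sum>N<2 * K. cis (2 * (real N + 1) * t) * q N x))\<^sup>2) * indicator {0..pi} t \<partial>lborel \<partial>lborel)"
    unfolding prod[symmetric] by (rule lborel_pair.Fubini') measurable
  also have "\<dots> = (\<integral>\<^sup>+x. (\<Sum>N<2 * K. ennreal pi * ennreal ((cmod (q N x))\<^sup>2)) \<partial>lborel)"
    unfolding nn_integral_trig_Parseval
    by (intro nn_integral_cong) (simp add: ennreal_mult' sum_distrib_left[symmetric] sum_ennreal)
  also have "\<dots> = (\<Sum>N<2 * K. ennreal pi * (\<integral>\<^sup>+x. ennreal ((cmod (q N x))\<^sup>2) \<partial>lborel))"
    unfolding q_def by (simp add: nn_integral_sum nn_integral_cmult)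
  also have "\<dots> \<le> (\<Sum>N<2 * K. ennreal pi * ennreal (1 / sqrt (2 * pi) * ((level_energy a b N + (cmod (level_coherent a b N))\<^sup>2) / 2)))"
    unfolding q_def level_energy_def level_coherent_def
    by (intro sum_mono mult_left_mono nn_integral_level_diagonal) simp
  also have "\<dots> = ennreal (\<Sum>N<2 * K. pi * (1 / sqrt (2 * pi) * ((level_energy a b N + (cmod (level_coherent a b N))\<^sup>2) / 2)))"
    by (simp add: ennreal_mult[symmetric] level_energy_def sum_nonneg)
  also have "\<dots> \<le> ennreal (pi * (1 / sqrt (2 * pi) *
        ((\<Sum>i<K. (cmod (a i))\<^sup>2) * (\<Sum>i<K. (cmod (b i))\<^sup>2) - level_defect a b M / 2)))"
  proof (rule ennreal_leI)
    \<comment> \<open>By \<open>level_defect_eq\<close> the mean of the energy and the squared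
      coherent part is the energy minus half the defect.\<close>
    have "(\<Sum>N<2 * K. pi * (1 / sqrt (2 * pi) * ((level_energy a b N + (cmod (level_coherent a b N))\<^sup>2) / 2)))
       = pi * (1 / sqrt (2 * pi) * (\<Sum>N<2 * K. level_energy a b N - level_defect a b N / 2))"
      unfolding sum_distrib_left level_defect_eq by (intro sum.cong refl) (simp add: field_simps)
    also have "\<dots> \<le> pi * (1 / sqrt (2 * pi) *
        ((\<Sum>i<K. (cmod (a i))\<^sup>2) * (\<Sum>i<K. (cmod (b i))\<^sup>2) - level_defect a b M / 2))"
    proof (intro mult_left_mono)
      have "(\<Sum>N<2 * K. level_energy a b N) = (\<Sum>i<K. (cmod (a i))\<^sup>2) * (\<Sum>i<K. (cmod (b i))\<^sup>2)"
        unfolding level_energy_def norm_mult power_mult_distrib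
        by (subst sum_mult_triangle) (simp_all add: a b)
      moreover have "level_defect a b M \<le> (\<Sum>N<2 * K. level_defect a b N)"
        using M by (intro member_le_sum) (auto simp: level_defect_nonneg)
      ultimately show "(\<Sum>N<2 * K. level_energy a b N - level_defect a b N / 2)
          \<le> (\<Sum>i<K. (cmod (a i))\<^sup>2) * (\<Sum>i<K. (cmod (b i))\<^sup>2) - level_defect a b M / 2"
        by (simp add: sum_subtractf sum_divide_distrib[symmetric])
    qed auto
    finally show "(\<Sum>N<2 * K. pi * (1 / sqrt (2 * pi) * ((level_energy a b N + (cmod (level_coherent a b N))\<^sup>2) / 2)))
      \<le> pi * (1 / sqrt (2 * pi) * ((\<Sum>i<K. (cmod (a i))\<^sup>2) * (\<Sum>i<K. (cmod (b i))\<^sup>2) - level_defect a b M / 2))" .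
  qed
  finally have two: "(\<integral>\<^sup>+t. G t * indicator {0..pi/2} t \<partial>lborel) + (\<integral>\<^sup>+t. G t * indicator {0..pi/2} t \<partial>lborel)
    \<le> ennreal (pi * (1 / sqrt (2 * pi) *
        ((\<Sum>i<K. (cmod (a i))\<^sup>2) * (\<Sum>i<K. (cmod (b i))\<^sup>2) - level_defect a b M / 2)))" .
  \<comment> \<open>A negative B makes \<open>ennreal\<close> of the bound 0, hence I = 0, so the
    sign of B need not be known.\<close>
  have half: "I \<le> ennreal (pi / 2 * B)" if "I + I \<le> ennreal (pi * B)" for I B
  proof -
    have "I < top" using that by (auto simp: top_unique less_top[symmetric])
    then obtain r where r: "I = ennreal r" "r \<ge> 0" by (cases I) auto
    have "ennreal (r + r) \<le> ennreal (pi * B)"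
      using that unfolding r(1) by (simp only: ennreal_plus[OF r(2) r(2)])
    then have "r + r \<le> pi * B \<or> r + r = 0" using r by (cases "pi * B \<ge> 0") (auto simp: ennreal_le_iff ennreal_neg)
    then have "r \<le> pi / 2 * B \<or> r = 0" by auto
    then show ?thesis using r by (auto intro: ennreal_leI)
  qed
  show ?thesis using half[OF two] unfolding G_def .
qed

subsection \<open>The bilinear bound on \<open>L\<^sup>2\<close>\<close>

lemma level_defect_cong:
  assumes "\<And>i. i \<le> N \<Longrightarrow> a i = a' i" "\<And>i. i \<le> N \<Longrightarrow> b i = b' i"
  shows "level_defect a b N = level_defect a' b' N"
proof -
  have "level_coherent a b N = level_coherent a' b' N"
    unfolding level_coherent_def using assms by (intro sum.cong) auto
  then show ?thesis unfolding level_defect_def using assms by (intro sum.cong) auto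
qed

lemma hermite_Bessel:
  assumes "L2 f" shows "(\<Sum>i<K. (cmod (hcoef f i))\<^sup>2) \<le> (L2_norm f)\<^sup>2"
  using L2_norm_hermite_remainder[OF assms, of K]
    zero_le_power2[of "L2_norm (\<lambda>x. f x - (\<Sum>i<K. hcoef f i * of_real (hermite i x)))"] by linarith

context
  fixes U :: "real \<Rightarrow> (real \<Rightarrow> complex) \<Rightarrow> real \<Rightarrow> complex"
  assumes P: "is_propagator U"
begin

text \<open>Isometry carries the geometric rate over to every time, so the same indices
  \<open>k\<close> serve for all t, although the exceptional null set depends on t.\<close>

lemma evolve_convergence_AE:
  assumes f: "L2 f"
    and k: "\<And>j. L2_norm (\<lambda>x. (\<Sum>i<k j. hcoef f i * of_real (hermite i x)) - f x) \<le> (1/4) ^ j"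
  shows "AE x in lborel. (\<lambda>j. evolve (k j) (hcoef f) t x) \<longlonglongrightarrow> U t f x"
proof -
  let ?p = "\<lambda>j x. \<Sum>i<k j. hcoef f i * of_real (hermite i x)"
  have L: "L2 (?p j)" for j by (rule L2_sum_hermite)
  have "AE x in lborel. summable (\<lambda>j. cmod (U t (?p j) x - U t f x))"
    using k by (intro L2_fast_convergence_AE) (auto intro: L2_diff propagator_L2[OF P] L f simp: propagator_diff_norm[OF P L f])
  moreover have "AE x in lborel. \<forall>j. U t (?p j) x = evolve (k j) (hcoef f) t x"
    unfolding AE_all_countable evolve_def by (intro allI propagator_sum_hermite[OF P]) simp
  ultimately show ?thesis
  proof eventually_elim
    case (elim x)
    have "(\<lambda>j. cmod (U t (?p j) x - U t f x)) \<longlonglongrightarrow> 0" using elim(1) by (rule summable_LIMSEQ_zero)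
    then have "(\<lambda>j. U t (?p j) x - U t f x) \<longlonglongrightarrow> 0" by (simp only: tendsto_norm_zero_iff)
    then have "(\<lambda>j. U t (?p j) x) \<longlonglongrightarrow> U t f x" by (rule LIM_zero_cancel)
    then show ?case using elim(2) by simp
  qed
qed

text \<open>For each t the integral is unchanged when the integrand is replaced by a liminf of
  explicit functions, which is jointly measurable. This supplies the measurability in t as well as
  the starting point for Fatou's lemma.\<close>

lemma propagator_bilinear_approximation:
  assumes f: "L2 f" and g: "L2 g"
  obtains k :: "nat \<Rightarrow> nat" where "\<And>j. k j \<ge> j"
    "\<And>t. (\<integral>\<^sup>+x. ennreal ((cmod (U t f x * U t g x))\<^sup>2) \<partial>lborel)
      = (\<integral>\<^sup>+x. liminf (\<lambda>j. ennreal ((cmod (evolve (k j) (hcoef f) t x * evolve (k j) (hcoef g) t x))\<^sup>2)) \<partial>lborel)"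
proof -
  let ?d = "\<lambda>f K. L2_norm (\<lambda>x. (\<Sum>i<K. hcoef f i * of_real (hermite i x)) - f x)"
  have "\<forall>j. \<exists>K. K \<ge> j \<and> ?d f K \<le> (1/4) ^ j \<and> ?d g K \<le> (1/4) ^ j"
  proof
    fix j
    have "\<forall>\<^sub>F K in sequentially. ?d f K < (1/4) ^ j" "\<forall>\<^sub>F K in sequentially. ?d g K < (1/4) ^ j"
      by (rule order_tendstoD[OF hermite_expansion], (rule f g)?, simp)+
    then have "\<forall>\<^sub>F K in sequentially. K \<ge> j \<and> ?d f K \<le> (1/4) ^ j \<and> ?d g K \<le> (1/4) ^ j"
      using eventually_ge_at_top[of j] by eventually_elim auto
    then show "\<exists>K. K \<ge> j \<and> ?d f K \<le> (1/4) ^ j \<and> ?d g K \<le> (1/4) ^ j"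
      by (rule eventually_happens'[OF sequentially_bot])
  qed
  from choice[OF this] obtain k where "\<forall>j. k j \<ge> j \<and> ?d f (k j) \<le> (1/4) ^ j \<and> ?d g (k j) \<le> (1/4) ^ j"
    by (rule exE)
  then have k: "\<And>j. k j \<ge> j" "\<And>j. ?d f (k j) \<le> (1/4) ^ j" "\<And>j. ?d g (k j) \<le> (1/4) ^ j"
    by simp_all
  have "(\<integral>\<^sup>+x. ennreal ((cmod (U t f x * U t g x))\<^sup>2) \<partial>lborel)
      = (\<integral>\<^sup>+x. liminf (\<lambda>j. ennreal ((cmod (evolve (k j) (hcoef f) t x * evolve (k j) (hcoef g) t x))\<^sup>2)) \<partial>lborel)" for t
  proof (rule nn_integral_cong_AE)
    show "AE x in lborel. ennreal ((cmod (U t f x * U t g x))\<^sup>2)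
      = liminf (\<lambda>j. ennreal ((cmod (evolve (k j) (hcoef f) t x * evolve (k j) (hcoef g) t x))\<^sup>2))"
      using evolve_convergence_AE[OF f k(2), of t] evolve_convergence_AE[OF g k(3), of t]
    proof eventually_elim
      case (elim x)
      then have "(\<lambda>j. ennreal ((cmod (evolve (k j) (hcoef f) t x * evolve (k j) (hcoef g) t x))\<^sup>2))
          \<longlonglongrightarrow> ennreal ((cmod (U t f x * U t g x))\<^sup>2)"
        by (intro tendsto_ennrealI tendsto_intros)
      then show ?case by (intro lim_imp_Liminf[symmetric]) auto
    qed
  qed
  with k(1) show ?thesis by (rule that)
qed

lemma propagator_bilinear_measurable:
  assumes f: "L2 f" and g: "L2 g"
  shows "(\<lambda>t. \<integral>\<^sup>+x. ennreal ((cmod (U t f x * U t g x))\<^sup>2) \<partial>lborel) \<in> borel_measurable borel"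
proof -
  obtain k :: "nat \<Rightarrow> nat" where "\<And>j. k j \<ge> j" and
    k: "\<And>t. (\<integral>\<^sup>+x. ennreal ((cmod (U t f x * U t g x))\<^sup>2) \<partial>lborel)
      = (\<integral>\<^sup>+x. liminf (\<lambda>j. ennreal ((cmod (evolve (k j) (hcoef f) t x * evolve (k j) (hcoef g) t x))\<^sup>2)) \<partial>lborel)"
    using propagator_bilinear_approximation[OF f g] by blast
  show ?thesis unfolding k by measurable
qed

text \<open>Fatou's lemma in x and then in t. Once \<open>k j\<close> exceeds M, the defect of level
  M no longer depends on j, and Bessel's inequality bounds the square sums uniformly.\<close>

lemma propagator_bilinear_bound:
  assumes f: "L2 f" and g: "L2 g"
  shows "(\<integral>\<^sup>+t. (\<integral>\<^sup>+x. ennreal ((cmod (U t f x * U t g x))\<^sup>2) \<partial>lborel) * indicator {0..pi/2} t \<partial>lborel)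
    \<le> ennreal (pi / 2 * (1 / sqrt (2 * pi) * ((L2_norm f)\<^sup>2 * (L2_norm g)\<^sup>2 - level_defect (hcoef f) (hcoef g) M / 2)))"
proof -
  obtain k :: "nat \<Rightarrow> nat" where kj: "\<And>j. k j \<ge> j" and
    k: "\<And>t. (\<integral>\<^sup>+x. ennreal ((cmod (U t f x * U t g x))\<^sup>2) \<partial>lborel)
      = (\<integral>\<^sup>+x. liminf (\<lambda>j. ennreal ((cmod (evolve (k j) (hcoef f) t x * evolve (k j) (hcoef g) t x))\<^sup>2)) \<partial>lborel)"
    using propagator_bilinear_approximation[OF f g] by blast
  let ?v = "\<lambda>j t x. ennreal ((cmod (evolve (k j) (hcoef f) t x * evolve (k j) (hcoef g) t x))\<^sup>2)"
  let ?B = "ennreal (pi / 2 * (1 / sqrt (2 * pi) * ((L2_norm f)\<^sup>2 * (L2_norm g)\<^sup>2 - level_defect (hcoef f) (hcoef g) M / 2)))"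
  have fin: "(\<integral>\<^sup>+t. (\<integral>\<^sup>+x. ?v j t x \<partial>lborel) * indicator {0..pi/2} t \<partial>lborel) \<le> ?B" if j: "M < j" for j
  proof -
    define K where "K = k j"
    have K: "M < K" using j kj[of j] by (simp add: K_def)
    \<comment> \<open>Truncation provides the support condition of the finite bound and leaves the
      coefficients up to level M untouched.\<close>
    define a b where "a i = (if i < K then hcoef f i else 0)" and "b i = (if i < K then hcoef g i else 0)" for i
    have "evolve (k j) (hcoef f) t x = evolve K a t x" "evolve (k j) (hcoef g) t x = evolve K b t x" for t x
      by (simp_all add: evolve_def a_def b_def K_def)
    then have "(\<integral>\<^sup>+t. (\<integral>\<^sup>+x. ?v j t x \<partial>lborel) * indicator {0..pi/2} t \<partial>lborel)
      = (\<integral>\<^sup>+t. (\<integral>\<^sup>+x. ennreal ((cmod (evolve K a t x * evolve K b t x))\<^sup>2) \<partial>lborel) * indicator {0..pi/2} t \<partial>lborel)"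
      by (simp only:)
    also have "\<dots> \<le> ennreal (pi / 2 * (1 / sqrt (2 * pi) *
        ((\<Sum>i<K. (cmod (a i))\<^sup>2) * (\<Sum>i<K. (cmod (b i))\<^sup>2) - level_defect a b M / 2)))"
      by (rule evolve_bilinear_bound) (use K in \<open>auto simp: a_def b_def\<close>)
    also have "\<dots> \<le> ?B"
    proof (intro ennreal_leI mult_left_mono diff_mono)
      have "(\<Sum>i<K. (cmod (a i))\<^sup>2) = (\<Sum>i<K. (cmod (hcoef f i))\<^sup>2)" "(\<Sum>i<K. (cmod (b i))\<^sup>2) = (\<Sum>i<K. (cmod (hcoef g i))\<^sup>2)"
        by (simp_all add: a_def b_def)
      then show "(\<Sum>i<K. (cmod (a i))\<^sup>2) * (\<Sum>i<K. (cmod (b i))\<^sup>2) \<le> (L2_norm f)\<^sup>2 * (L2_norm g)\<^sup>2"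
        by (auto intro!: mult_mono hermite_Bessel f g sum_nonneg)
      show "level_defect (hcoef f) (hcoef g) M / 2 \<le> level_defect a b M / 2"
        using K level_defect_cong[of M a "hcoef f" b "hcoef g"] by (simp add: a_def b_def)
    qed auto
    finally show ?thesis .
  qed
  have "(\<integral>\<^sup>+t. (\<integral>\<^sup>+x. ennreal ((cmod (U t f x * U t g x))\<^sup>2) \<partial>lborel) * indicator {0..pi/2} t \<partial>lborel)
    \<le> (\<integral>\<^sup>+t. liminf (\<lambda>j. (\<integral>\<^sup>+x. ?v j t x \<partial>lborel) * indicator {0..pi/2} t) \<partial>lborel)"
  proof (rule nn_integral_mono)
    fix t :: real
    have "(\<integral>\<^sup>+x. liminf (\<lambda>j. ?v j t x) \<partial>lborel) \<le> liminf (\<lambda>j. \<integral>\<^sup>+x. ?v j t x \<partial>lborel)"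
      by (rule nn_integral_liminf) measurable
    then show "(\<integral>\<^sup>+x. ennreal ((cmod (U t f x * U t g x))\<^sup>2) \<partial>lborel) * indicator {0..pi/2} t
      \<le> liminf (\<lambda>j. (\<integral>\<^sup>+x. ?v j t x \<partial>lborel) * indicator {0..pi/2} t)"
      unfolding k by (cases "t \<in> {0..pi/2}") auto
  qed
  also have "\<dots> \<le> liminf (\<lambda>j. \<integral>\<^sup>+t. (\<integral>\<^sup>+x. ?v j t x \<partial>lborel) * indicator {0..pi/2} t \<partial>lborel)"
    by (rule nn_integral_liminf) measurable
  also have "\<dots> \<le> liminf (\<lambda>j. ?B)"
    by (rule Liminf_mono, rule eventually_mono[OF eventually_gt_at_top[of M]]) (rule fin)
  also have "\<dots> = ?B" by (simp add: Liminf_const)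
  finally show ?thesis .
qed

end

subsection \<open>Gaussians\<close>

lemma norm_gaussian: "cmod (gaussian \<beta> x) = exp (- x\<^sup>2 / 2 + Re \<beta> * x)"
proof -
  have "Re (- (of_real x)\<^sup>2 / 2 + \<beta> * of_real x) = - x\<^sup>2 / 2 + Re \<beta> * x"
    by (simp flip: of_real_power)
  then show ?thesis by (simp only: gaussian_def norm_exp_eq_Re)
qed

lemma gaussian_nonzero: "gaussian \<beta> x \<noteq> 0"
  by (simp add: gaussian_def)

lemma gaussian_decay_gaussian: "gaussian_decay (gaussian \<beta>)"
proof -
  have "cmod (gaussian \<beta> x) \<le> 1 * exp (\<bar>Re \<beta>\<bar> * \<bar>x\<bar> - x\<^sup>2 / 2)" for x
    using abs_ge_self[of "Re \<beta> * x"] by (simp add: norm_gaussian abs_mult)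
  moreover have "continuous_on UNIV (gaussian \<beta>)"
    unfolding gaussian_def[abs_def] by (intro continuous_intros) auto
  ultimately show ?thesis unfolding gaussian_decay_def by blast
qed

lemma L2_gaussian: "L2 (gaussian \<beta>)"
  by (rule gaussian_decay_L2[OF gaussian_decay_gaussian])

text \<open>Gaussians are eigenfunctions of the annihilation operator: (x + d/dx) maps
  \<open>gaussian \<beta>\<close> to \<beta> times itself. They are the coherent states of the
  oscillator.\<close>

lemma hcoef_gaussian_Suc:
  "hcoef (gaussian \<beta>) (Suc n) = (\<beta> / of_real (sqrt 2)) / of_real (sqrt (real (Suc n))) * hcoef (gaussian \<beta>) n"
proof -
  let ?g' = "\<lambda>x. \<beta> * gaussian \<beta> x + (- 1) * (of_real x * gaussian \<beta> x)"
  have d: "(gaussian \<beta> has_vector_derivative ?g' x) (at x)" for x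
  proof -
    have "((\<lambda>z. exp (- z\<^sup>2 / 2 + \<beta> * z)) has_field_derivative exp (- (of_real x)\<^sup>2 / 2 + \<beta> * of_real x) * (- of_real x + \<beta>)) (at (of_real x))"
      by (auto intro!: derivative_eq_intros)
    from has_vector_derivative_real_field[OF this] show ?thesis
      unfolding gaussian_def[abs_def] by (simp add: algebra_simps)
  qed
  have "gaussian_decay ?g'"
    by (intro gaussian_decay_add gaussian_decay_cmult gaussian_decay_of_real_mult gaussian_decay_gaussian)
  from hermite_raise_lower[OF gaussian_decay_gaussian this d, of n]
  have "sqrt 2 * sqrt (real (Suc n)) * hcoef (gaussian \<beta>) (Suc n) = hcoef (\<lambda>x. \<beta> * gaussian \<beta> x) n"
    unfolding hcoef_def by simp
  then have "sqrt 2 * sqrt (real (Suc n)) * hcoef (gaussian \<beta>) (Suc n) = \<beta> * hcoef (gaussian \<beta>) n"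
    by (simp only: hcoef_cmult)
  moreover have "complex_of_real (sqrt 2 * sqrt (real (Suc n))) \<noteq> 0" by simp
  ultimately show ?thesis by (simp add: field_simps del: of_nat_Suc)
qed

lemma hcoef_gaussian:
  "hcoef (gaussian \<beta>) n = hcoef (gaussian \<beta>) 0 * (\<beta> / of_real (sqrt 2)) ^ n / of_real (sqrt (fact n))"
proof (induction n)
  case (Suc n)
  have "sqrt (fact (Suc n)) = sqrt (real (Suc n)) * sqrt (fact n)"
    by (simp only: fact_Suc real_sqrt_mult)
  moreover have "z / s * (c * w / F) = c * (z * w) / (s * F)" for z s c w F :: complex
    by simp
  ultimately show ?case
    by (simp only: hcoef_gaussian_Suc[of \<beta> n] Suc.IH of_real_mult power_Suc)
qed simp

text \<open>If it vanished, so would all coefficients, and totality would make a nowhere vanishing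
  function zero.\<close>

lemma hcoef_gaussian_0_nonzero: "hcoef (gaussian \<beta>) 0 \<noteq> 0"
proof
  assume "hcoef (gaussian \<beta>) 0 = 0"
  then have "hcoef (gaussian \<beta>) n = 0" for n by (subst hcoef_gaussian) simp
  then have "AE x in lborel. gaussian \<beta> x = 0" by (rule hermite_total[OF L2_gaussian])
  then have "AE x in (lborel :: real measure). False" by (simp add: gaussian_nonzero)
  then obtain N :: "real set" where "UNIV \<subseteq> N" "emeasure lborel N = 0"
    by (auto simp: eventually_ae_filter null_sets_def)
  then have "emeasure lborel (UNIV :: real set) = 0" by (simp add: top.extremum_unique)
  then show False by simp
qed

text \<open>The coefficients of \<open>gaussian \<beta>\<close> have ratio parameter \<beta> / sqrt
  2, whence the factor sqrt 2; totality turns equality of coefficients into equality almost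
  everywhere.\<close>

lemma gaussian_multipleI_hcoef:
  assumes f: "L2 f" and g: "\<And>n. hcoef f n = hcoef f 0 * z ^ n / of_real (sqrt (fact n))"
  shows "gaussian_multiple (of_real (sqrt 2) * z) f"
proof -
  let ?\<beta> = "of_real (sqrt 2) * z"
  let ?c = "hcoef f 0 / hcoef (gaussian ?\<beta>) 0"
  have "hcoef f n = hcoef (\<lambda>x. ?c * gaussian ?\<beta> x) n" for n
  proof -
    have "hcoef (\<lambda>x. ?c * gaussian ?\<beta> x) n = ?c * hcoef (gaussian ?\<beta>) n" by (rule hcoef_cmult)
    also have "\<dots> = ?c * (hcoef (gaussian ?\<beta>) 0 * (?\<beta> / of_real (sqrt 2)) ^ n / of_real (sqrt (fact n)))"
      by (simp only: hcoef_gaussian[of ?\<beta> n])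
    also have "\<dots> = hcoef f 0 * z ^ n / of_real (sqrt (fact n))"
      using hcoef_gaussian_0_nonzero[of ?\<beta>] by simp
    finally show ?thesis by (simp only: g[of n])
  qed
  then have "AE x in lborel. f x = ?c * gaussian ?\<beta> x"
    by (rule hcoef_determines[OF f L2_cmult[OF L2_gaussian]])
  then show ?thesis unfolding gaussian_multiple_def by blast
qed

text \<open>Completing the square gives multiples of normal densities with mean
  \<open>Re \<beta>\<close> and variances 1/2 and 1/4.\<close>

lemma integral_gaussian_powers:
  "(LINT x|lborel. (cmod (gaussian \<beta> x))\<^sup>2) = exp ((Re \<beta>)\<^sup>2) * sqrt pi"
  "(LINT x|lborel. (cmod (gaussian \<beta> x)) ^ 4) = exp (2 * (Re \<beta>)\<^sup>2) * sqrt (pi / 2)"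
proof -
  let ?a = "Re \<beta>"
  have "(cmod (gaussian \<beta> x))\<^sup>2 = exp (?a\<^sup>2) * sqrt pi * normal_density ?a (1 / sqrt 2) x" for x
    by (simp add: norm_gaussian normal_density_def exp_double[symmetric] exp_add[symmetric] power_divide)
       (simp add: power2_eq_square algebra_simps)
  then show "(LINT x|lborel. (cmod (gaussian \<beta> x))\<^sup>2) = exp (?a\<^sup>2) * sqrt pi"
    using integral_normal_density[of "1 / sqrt 2" ?a] by simp
  have "(cmod (gaussian \<beta> x)) ^ 4 = exp (2 * ?a\<^sup>2) * sqrt (pi / 2) * normal_density ?a (1 / 2) x" for x
    by (simp add: norm_gaussian normal_density_def exp_of_nat_mult[symmetric] exp_add[symmetric] power_divide)
       (simp add: power2_eq_square algebra_simps)
  then show "(LINT x|lborel. (cmod (gaussian \<beta> x)) ^ 4) = exp (2 * ?a\<^sup>2) * sqrt (pi / 2)"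
    using integral_normal_density[of "1 / 2" ?a] by simp
qed

lemma integral_gaussian_power4:
  "(LINT x|lborel. (cmod (gaussian \<beta> x)) ^ 4) = 1 / sqrt (2 * pi) * L2_norm (gaussian \<beta>) ^ 4"
proof -
  have "L2_norm (gaussian \<beta>) ^ 4 = ((L2_norm (gaussian \<beta>))\<^sup>2)\<^sup>2" by simp
  also have "\<dots> = exp (2 * (Re \<beta>)\<^sup>2) * pi"
    unfolding L2_norm_power2 integral_gaussian_powers by (simp add: power_mult_distrib exp_double)
  finally show ?thesis
    unfolding integral_gaussian_powers by (simp add: real_sqrt_mult real_sqrt_divide real_div_sqrt field_simps)
qed

subsection \<open>Vanishing defect forces geometric coefficients\<close>

text \<open>Dependence on i + j alone lets one index be moved across: p (i+1) q j = p i q (j+1).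
  With j = 0 and i = 0 this gives one common ratio, once both initial values are seen to be
  nonzero.\<close>

lemma multiplicative_coefficients_geometric:
  fixes p q :: "nat \<Rightarrow> complex"
  assumes l: "\<And>i j. p i * q j = l (i + j)" and "\<exists>i. p i \<noteq> 0" "\<exists>j. q j \<noteq> 0"
  shows "p 0 \<noteq> 0" "p n = p 0 * (p 1 / p 0) ^ n" "q n = q 0 * (p 1 / p 0) ^ n"
proof -
  have shift: "p (Suc i) * q j = p i * q (Suc j)" for i j
    using l[of "Suc i" j] l[of i "Suc j"] by simp
  show p0: "p 0 \<noteq> 0"
  proof
    assume "p 0 = 0"
    have "p i = 0" for i
    proof (induction i)
      case (Suc i)
      then have "p (Suc i) * q j = 0" for j using shift[of i j] by simp
      then show ?case using assms(3) by auto
    qed (fact \<open>p 0 = 0\<close>)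
    then show False using assms(2) by auto
  qed
  have q0: "q 0 \<noteq> 0"
  proof
    assume q0: "q 0 = 0"
    have "p 0 * q j = 0" for j using l[of 0 j] l[of j 0] q0 by simp
    then show False using p0 assms(3) by auto
  qed
  define z where "z = p 1 / p 0"
  have qS: "q (Suc j) = q j * z" for j
    unfolding z_def using shift[of 0 j] p0 by (simp add: field_simps)
  show "q n = q 0 * (p 1 / p 0) ^ n"
    unfolding z_def[symmetric] by (induction n) (simp_all add: qS mult_ac)
  have pS: "p (Suc i) = p i * z" for i
  proof -
    have "p (Suc i) * q 0 = p i * z * q 0" unfolding shift qS by (simp only: mult_ac)
    then show ?thesis by (rule mult_right_cancel[OF q0, THEN iffD1])
  qed
  show "p n = p 0 * (p 1 / p 0) ^ n"
    unfolding z_def[symmetric] by (induction n) (simp_all add: pS mult_ac)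
qed

text \<open>A zero defect puts a i b j on the line of binomial roots. Multiplying by sqrt (i! j!)
  turns the root of the binomial coefficient into sqrt ((i + j)!), so the dependence on i and j
  separately disappears.\<close>

lemma level_defect_zero_geometric:
  assumes d: "\<And>N. level_defect a b N = 0" and "\<exists>i. a i \<noteq> 0" "\<exists>i. b i \<noteq> 0"
  shows "a 0 \<noteq> 0" "a n = a 0 * (a 1 / a 0) ^ n / of_real (sqrt (fact n))"
    "b n = b 0 * (a 1 / a 0) ^ n / of_real (sqrt (fact n))"
proof -
  define p q where "p i = a i * of_real (sqrt (fact i))" and "q i = b i * of_real (sqrt (fact i))" for i
  define l where "l N = of_real (sqrt (fact N / 2 ^ N)) * level_coherent a b N" for N
  have "p i * q j = l (i + j)" for i j
  proof -
    let ?N = "i + j"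
    have "(cmod (a i * b (?N - i) - of_real (sqrt (real (?N choose i) / 2 ^ ?N)) * level_coherent a b ?N))\<^sup>2 \<le> level_defect a b ?N"
      unfolding level_defect_def by (rule member_le_sum) auto
    then have "a i * b j = of_real (sqrt (real (?N choose i) / 2 ^ ?N)) * level_coherent a b ?N"
      unfolding d by simp
    then have "p i * q j = of_real (sqrt (real (?N choose i) / 2 ^ ?N) * sqrt (fact i) * sqrt (fact j)) * level_coherent a b ?N"
      unfolding p_def q_def by (simp add: mult_ac)
    also have "sqrt (real (?N choose i) / 2 ^ ?N) * sqrt (fact i) * sqrt (fact j) = sqrt (fact ?N / 2 ^ ?N)"
    proof -
      have "real (fact i * fact (?N - i) * (?N choose i)) = real (fact ?N)"
        by (rule arg_cong[OF binomial_fact_lemma]) simp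
      then have "real (?N choose i) * fact i * fact j = fact ?N"
        by (simp only: of_nat_mult of_nat_fact add_diff_cancel_left' mult_ac)
      then show ?thesis by (simp only: real_sqrt_mult[symmetric] times_divide_eq_left)
    qed
    finally show ?thesis by (simp add: l_def)
  qed
  moreover have "\<exists>i. p i \<noteq> 0" "\<exists>i. q i \<noteq> 0" using assms(2,3) by (auto simp: p_def q_def)
  ultimately have g: "p 0 \<noteq> 0" "p n = p 0 * (p 1 / p 0) ^ n" "q n = q 0 * (p 1 / p 0) ^ n" for n
    by (rule multiplicative_coefficients_geometric)+
  have e: "p 0 = a 0" "q 0 = b 0" "p 1 = a 1" by (simp_all add: p_def q_def)
  have fn: "complex_of_real (sqrt (fact n)) \<noteq> 0" by simp
  show "a 0 \<noteq> 0" using g(1) e by simp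
  show "a n = a 0 * (a 1 / a 0) ^ n / of_real (sqrt (fact n))"
    using g(2)[of n] fn unfolding e by (simp add: p_def nonzero_eq_divide_eq)
  show "b n = b 0 * (a 1 / a 0) ^ n / of_real (sqrt (fact n))"
    using g(3)[of n] fn unfolding e by (simp add: q_def nonzero_eq_divide_eq)
qed

lemma hcoef_nonzero: "L2 f \<Longrightarrow> L2_norm f \<noteq> 0 \<Longrightarrow> \<exists>n. hcoef f n \<noteq> 0"
  using hermite_total[of f] L2_norm_eq_0[of f] by blast

subsection \<open>The quadrilinear functional\<close>

context
  fixes U :: "real \<Rightarrow> (real \<Rightarrow> complex) \<Rightarrow> real \<Rightarrow> complex"
  assumes P: "is_propagator U"
begin

section \<open>Gaussians under the propagator\<close>

text \<open>The phase factors as cis t times the n-th power of cis (2 t), so the flow only rotates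
  the parameter of a coherent state and changes its scalar factor.\<close>

lemma propagator_gaussian: "gaussian_multiple (cis (2 * t) * \<beta>) (U t (gaussian \<beta>))"
proof -
  let ?z = "\<beta> / of_real (sqrt 2)"
  have "hcoef (U t (gaussian \<beta>)) n
    = hcoef (U t (gaussian \<beta>)) 0 * (cis (2 * t) * ?z) ^ n / of_real (sqrt (fact n))" for n
  proof -
    have "cis ((2 * real n + 1) * t) = cis t * cis (2 * t) ^ n"
      unfolding Complex.DeMoivre cis_mult by (simp add: algebra_simps)
    then show ?thesis
      unfolding propagator_hcoef[OF P L2_gaussian] hcoef_gaussian[of \<beta> n] power_mult_distrib by simp
  qed
  from gaussian_multipleI_hcoef[OF propagator_L2[OF P L2_gaussian] this] show ?thesis
    by simp
qed

text \<open>For a Gaussian the ratio of the fourth-power integral to the fourth power of the norm is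
  independent of the parameter, and the propagator preserves the norm.\<close>

lemma propagator_gaussian_power4:
  "(LINT x|lborel. (cmod (U t (gaussian \<beta>) x)) ^ 4) = 1 / sqrt (2 * pi) * L2_norm (gaussian \<beta>) ^ 4"
proof -
  obtain c \<gamma> where c: "AE x in lborel. U t (gaussian \<beta>) x = c * gaussian \<gamma> x"
    using propagator_gaussian[of t \<beta>] unfolding gaussian_multiple_def by blast
  note m = L2_measurable[OF propagator_L2[OF P L2_gaussian]] L2_measurable[OF L2_gaussian]
  have "L2_norm (gaussian \<beta>) = L2_norm (\<lambda>x. c * gaussian \<gamma> x)"
    unfolding propagator_norm[OF P L2_gaussian, of t \<beta>, symmetric]
    using c m by (intro L2_norm_cong_AE) auto
  then have n: "L2_norm (gaussian \<beta>) = cmod c * L2_norm (gaussian \<gamma>)" by (simp only: L2_norm_cmult)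
  have "(LINT x|lborel. (cmod (U t (gaussian \<beta>) x)) ^ 4) = (LINT x|lborel. cmod c ^ 4 * (cmod (gaussian \<gamma> x)) ^ 4)"
    using m by (intro integral_cong_AE) (auto intro!: eventually_mono[OF c] simp: norm_mult power_mult_distrib)
  also have "\<dots> = cmod c ^ 4 * (1 / sqrt (2 * pi) * L2_norm (gaussian \<gamma>) ^ 4)"
    by (simp only: integral_mult_right_zero integral_gaussian_power4)
  finally show ?thesis unfolding n by (simp add: power_mult_distrib)
qed

lemma propagator_cmult_AE:
  assumes f: "L2 f" and g: "L2 g" and fg: "AE x in lborel. f x = c * g x"
  shows "AE x in lborel. U t f x = c * U t g x"
proof -
  have L: "L2 (\<lambda>x. U t f x - c * U t g x)" by (intro L2_diff L2_cmult propagator_L2[OF P] f g)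
  have "L2_norm (\<lambda>x. f x - c * g x) = 0"
    using fg by (subst L2_norm_eq_0[OF L2_diff[OF f L2_cmult[OF g]]]) simp
  then have "L2_norm (\<lambda>x. U t f x - c * U t g x) = 0"
    using propagator_diff_cmult_norm[OF P f g, of t c] by simp
  then show ?thesis unfolding L2_norm_eq_0[OF L] by eventually_elim simp
qed

text \<open>Up to scalars the inner integral is that of the fourth power of one evolved Gaussian,
  hence constant in t; the length pi/2 of the time interval cancels the prefactor 2 / pi.\<close>

lemma E4_gaussian:
  assumes L: "L2 f1" "L2 f2" "L2 f3" "L2 f4"
    and G: "gaussian_multiple \<beta> f1" "gaussian_multiple \<beta> f2" "gaussian_multiple \<beta> f3" "gaussian_multiple \<beta> f4"
  shows "cmod (E4 U f1 f2 f3 f4) = 1 / sqrt (2 * pi) * (L2_norm f1 * L2_norm f2 * L2_norm f3 * L2_norm f4)"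
proof -
  let ?g = "gaussian \<beta>"
  obtain c1 c2 c3 c4 where c: "AE x in lborel. f1 x = c1 * ?g x" "AE x in lborel. f2 x = c2 * ?g x"
      "AE x in lborel. f3 x = c3 * ?g x" "AE x in lborel. f4 x = c4 * ?g x"
    using G by (auto simp: gaussian_multiple_def)
  have n: "L2_norm f = cmod c * L2_norm ?g" if "L2 f" "AE x in lborel. f x = c * ?g x" for f c
    unfolding L2_norm_cmult[symmetric]
    using that(2) L2_measurable[OF that(1)] L2_measurable[OF L2_cmult[OF L2_gaussian]]
    by (intro L2_norm_cong_AE) auto
  let ?I = "c1 * c2 * cnj (c3 * c4) * of_real (1 / sqrt (2 * pi) * L2_norm ?g ^ 4)"
  have inner: "(LINT x|lborel. U t f1 x * U t f2 x * cnj (U t f3 x * U t f4 x)) = ?I" for t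
  proof -
    note Ul = propagator_cmult_AE[OF _ L2_gaussian, of _ _ \<beta> t]
    have m: "U t f1 \<in> borel_measurable lborel" "U t f2 \<in> borel_measurable lborel"
        "U t f3 \<in> borel_measurable lborel" "U t f4 \<in> borel_measurable lborel" "U t ?g \<in> borel_measurable lborel"
      using L[THEN propagator_L2[OF P], THEN L2_measurable] propagator_L2[OF P L2_gaussian, THEN L2_measurable] by auto
    have cn: "(\<lambda>x. cnj (h x)) \<in> borel_measurable lborel" if "h \<in> borel_measurable lborel" for h :: "real \<Rightarrow> complex"
      using that by (intro borel_measurable_continuous_on[of cnj] continuous_intros) auto
    have "(LINT x|lborel. U t f1 x * U t f2 x * cnj (U t f3 x * U t f4 x))
      = (LINT x|lborel. (c1 * c2 * cnj (c3 * c4)) * of_real (cmod (U t ?g x) ^ 4))"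
    proof (rule integral_cong_AE)
      show "AE x in lborel. U t f1 x * U t f2 x * cnj (U t f3 x * U t f4 x)
          = (c1 * c2 * cnj (c3 * c4)) * of_real (cmod (U t ?g x) ^ 4)"
        using Ul[OF L(1) c(1)] Ul[OF L(2) c(2)] Ul[OF L(3) c(3)] Ul[OF L(4) c(4)]
      proof eventually_elim
        case (elim x)
        have "complex_of_real (cmod (U t ?g x) ^ 4) = of_real ((cmod (U t ?g x))\<^sup>2) * of_real ((cmod (U t ?g x))\<^sup>2)"
          by (simp flip: power_add of_real_mult of_real_power)
        also have "\<dots> = (U t ?g x * cnj (U t ?g x)) * (U t ?g x * cnj (U t ?g x))"
          by (simp only: complex_norm_square)
        finally show ?case unfolding elim by (simp add: mult_ac)
      qed
    qed (use m cn in measurable)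
    also have "\<dots> = (c1 * c2 * cnj (c3 * c4)) * of_real (LINT x|lborel. cmod (U t ?g x) ^ 4)"
      unfolding integral_mult_right_zero integral_complex_of_real ..
    finally show ?thesis unfolding propagator_gaussian_power4 .
  qed
  have "(LINT t:{0..pi/2}|lborel. ?I) = of_real (pi / 2) * ?I"
    by (simp add: set_lebesgue_integral_def scaleR_conv_of_real)
  then have "E4 U f1 f2 f3 f4 = ?I"
    unfolding E4_def inner by (simp flip: mult.assoc of_real_mult)
  then show ?thesis
    unfolding n[OF L(1) c(1)] n[OF L(2) c(2)] n[OF L(3) c(3)] n[OF L(4) c(4)]
    by (simp add: norm_mult norm_divide eval_nat_numeral mult_ac)
qed

text \<open>A Bochner integral of a non-integrable function is the junk value \<open>0\<close>, so its norm is always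
  bounded by the integral of the norm in \<open>[0, \<infinity>]\<close>. There the pointwise weighted inequality
  \<open>uv \<le> su\<^sup>2/2 + v\<^sup>2/(2s)\<close>, optimised over \<open>s\<close> after integration, replaces Cauchy--Schwarz.\<close>

lemma iterated_integral_bound:
  assumes L: "L2 a" "L2 b" "L2 c" "L2 d"
    and F: "\<And>t x. cmod (F t x) = cmod (U t a x * U t b x) * cmod (U t c x * U t d x)"
  shows "cmod (of_real (2 / pi) * (LINT t:{0..pi/2}|lborel. LINT x|lborel. F t x))
    \<le> 1 / sqrt (2 * pi) * (sqrt (max 0 ((L2_norm a * L2_norm b)\<^sup>2 - level_defect (hcoef a) (hcoef b) M / 2))
        * (L2_norm c * L2_norm d))"
proof -
  define k where "k = pi / 2 * (1 / sqrt (2 * pi))"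
  have k: "k > 0" by (simp add: k_def)
  define D where "D f g t = (\<integral>\<^sup>+x. ennreal ((cmod (U t f x * U t g x))\<^sup>2) \<partial>lborel)" for f g t
  note [measurable] = propagator_bilinear_measurable[OF P L(1,2), folded D_def]
    propagator_bilinear_measurable[OF P L(3,4), folded D_def]
  \<comment> \<open>The sign of the difference is not established here, and \<open>sqrt\<close> of a
    negative real is negative; \<open>max 0\<close> makes A a legitimate nonnegative weight.\<close>
  define A where "A = sqrt k * sqrt (max 0 ((L2_norm a * L2_norm b)\<^sup>2 - level_defect (hcoef a) (hcoef b) M / 2))"
  define B where "B = sqrt k * (L2_norm c * L2_norm d)"
  have AB: "A \<ge> 0" "B \<ge> 0" using k by (auto simp: A_def B_def)
  have "(\<integral>\<^sup>+t. D a b t * indicator {0..pi/2} t \<partial>lborel)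
      \<le> ennreal (pi / 2 * (1 / sqrt (2 * pi) * ((L2_norm a)\<^sup>2 * (L2_norm b)\<^sup>2 - level_defect (hcoef a) (hcoef b) M / 2)))"
    unfolding D_def by (rule propagator_bilinear_bound[OF P L(1,2)])
  also have "\<dots> \<le> ennreal (A\<^sup>2)"
  proof (rule ennreal_leI)
    have "pi / 2 * (1 / sqrt (2 * pi) * ((L2_norm a)\<^sup>2 * (L2_norm b)\<^sup>2 - level_defect (hcoef a) (hcoef b) M / 2))
      = k * ((L2_norm a * L2_norm b)\<^sup>2 - level_defect (hcoef a) (hcoef b) M / 2)"
      by (simp add: k_def power_mult_distrib)
    also have "\<dots> \<le> k * max 0 ((L2_norm a * L2_norm b)\<^sup>2 - level_defect (hcoef a) (hcoef b) M / 2)"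
      using k by (intro mult_left_mono) auto
    also have "\<dots> = A\<^sup>2" using k by (simp add: A_def power_mult_distrib)
    finally show "pi / 2 * (1 / sqrt (2 * pi) * ((L2_norm a)\<^sup>2 * (L2_norm b)\<^sup>2 - level_defect (hcoef a) (hcoef b) M / 2)) \<le> A\<^sup>2" .
  qed
  finally have DA: "(\<integral>\<^sup>+t. D a b t * indicator {0..pi/2} t \<partial>lborel) \<le> ennreal (A\<^sup>2)" .
  have "(\<integral>\<^sup>+t. D c d t * indicator {0..pi/2} t \<partial>lborel)
      \<le> ennreal (pi / 2 * (1 / sqrt (2 * pi) * ((L2_norm c)\<^sup>2 * (L2_norm d)\<^sup>2 - level_defect (hcoef c) (hcoef d) 0 / 2)))"
    unfolding D_def by (rule propagator_bilinear_bound[OF P L(3,4)])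
  also have "\<dots> \<le> ennreal (B\<^sup>2)"
  proof (rule ennreal_leI)
    have "pi / 2 * (1 / sqrt (2 * pi) * ((L2_norm c)\<^sup>2 * (L2_norm d)\<^sup>2 - level_defect (hcoef c) (hcoef d) 0 / 2))
      = k * ((L2_norm c * L2_norm d)\<^sup>2 - level_defect (hcoef c) (hcoef d) 0 / 2)"
      by (simp add: k_def power_mult_distrib)
    also have "\<dots> \<le> k * (L2_norm c * L2_norm d)\<^sup>2"
      using k level_defect_nonneg[of "hcoef c" "hcoef d" 0] by (intro mult_left_mono) auto
    also have "\<dots> = B\<^sup>2" using k by (simp add: B_def power_mult_distrib)
    finally show "pi / 2 * (1 / sqrt (2 * pi) * ((L2_norm c)\<^sup>2 * (L2_norm d)\<^sup>2 - level_defect (hcoef c) (hcoef d) 0 / 2)) \<le> B\<^sup>2" .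
  qed
  finally have DB: "(\<integral>\<^sup>+t. D c d t * indicator {0..pi/2} t \<partial>lborel) \<le> ennreal (B\<^sup>2)" .
  have bochner: "ennreal (norm (integral\<^sup>L M f)) \<le> (\<integral>\<^sup>+x. ennreal (norm (f x)) \<partial>M)" for M :: "real measure" and f :: "real \<Rightarrow> complex"
    by (cases "integrable M f") (auto simp: integral_norm_bound_ennreal not_integrable_integral_eq)
  let ?J = "LINT t:{0..pi/2}|lborel. LINT x|lborel. F t x"
  have "ennreal (cmod ?J) \<le> ennreal (A * B)"
  proof (rule ennreal_le_mult_by_weights[OF _ AB])
    fix s :: real assume s: "s > 0"
    have pt: "u * v \<le> s/2 * u\<^sup>2 + 1 / (2 * s) * v\<^sup>2" for u v :: real
    proof -
      have "0 \<le> (s * u - v)\<^sup>2 / (2 * s)" using s by simp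
      also have "\<dots> = s/2 * u\<^sup>2 + 1 / (2 * s) * v\<^sup>2 - u * v"
        using s by (simp add: field_simps power2_eq_square)
      finally show ?thesis by simp
    qed
    have inner: "ennreal (cmod (LINT x|lborel. F t x)) \<le> ennreal (s/2) * D a b t + ennreal (1 / (2 * s)) * D c d t" for t
    proof -
      note [measurable] = L[THEN propagator_L2[OF P, of _ t], THEN L2_measurable]
      have "ennreal (cmod (LINT x|lborel. F t x)) \<le> (\<integral>\<^sup>+x. ennreal (cmod (F t x)) \<partial>lborel)" by (rule bochner)
      also have "\<dots> \<le> (\<integral>\<^sup>+x. ennreal (s/2) * ennreal ((cmod (U t a x * U t b x))\<^sup>2)
          + ennreal (1 / (2 * s)) * ennreal ((cmod (U t c x * U t d x))\<^sup>2) \<partial>lborel)"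
        unfolding F using pt s
        by (intro nn_integral_mono) (simp add: ennreal_mult[symmetric] ennreal_plus[symmetric] ennreal_leI del: ennreal_plus)
      also have "\<dots> = ennreal (s/2) * D a b t + ennreal (1 / (2 * s)) * D c d t"
        unfolding D_def by (simp add: nn_integral_add nn_integral_cmult)
      finally show ?thesis .
    qed
    have "ennreal (cmod ?J) \<le> (\<integral>\<^sup>+t. ennreal (cmod (indicator {0..pi/2} t *\<^sub>R (LINT x|lborel. F t x))) \<partial>lborel)"
      unfolding set_lebesgue_integral_def by (rule bochner)
    also have "\<dots> \<le> (\<integral>\<^sup>+t. ennreal (s/2) * (D a b t * indicator {0..pi/2} t)
        + ennreal (1 / (2 * s)) * (D c d t * indicator {0..pi/2} t) \<partial>lborel)"
      using inner by (intro nn_integral_mono) (auto simp: indicator_def)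
    also have "\<dots> = ennreal (s/2) * (\<integral>\<^sup>+t. D a b t * indicator {0..pi/2} t \<partial>lborel)
        + ennreal (1 / (2 * s)) * (\<integral>\<^sup>+t. D c d t * indicator {0..pi/2} t \<partial>lborel)"
      by (simp add: nn_integral_add nn_integral_cmult)
    also have "\<dots> \<le> ennreal (s/2) * ennreal (A\<^sup>2) + ennreal (1 / (2 * s)) * ennreal (B\<^sup>2)"
      using DA DB by (intro add_mono mult_left_mono) auto
    also have "\<dots> = ennreal ((s * A\<^sup>2 + B\<^sup>2 / s) / 2)"
      using s by (simp add: ennreal_mult[symmetric] ennreal_plus[symmetric] field_simps del: ennreal_plus)
    finally show "ennreal (cmod ?J) \<le> ennreal ((s * A\<^sup>2 + B\<^sup>2 / s) / 2)" .
  qed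
  then have "cmod ?J \<le> A * B" using AB by (simp add: ennreal_le_iff)
  then have "2 / pi * cmod ?J \<le> 2 / pi * (A * B)" by (intro mult_left_mono) auto
  also have "2 / pi * (A * B) = 2 / pi * (sqrt k * sqrt k) * (sqrt (max 0 ((L2_norm a * L2_norm b)\<^sup>2 - level_defect (hcoef a) (hcoef b) M / 2))
        * (L2_norm c * L2_norm d))"
    by (simp add: A_def B_def)
  also have "2 / pi * (sqrt k * sqrt k) = 1 / sqrt (2 * pi)" using k by (simp add: k_def)
  finally show ?thesis by (simp add: norm_mult norm_divide)
qed

text \<open>After cancelling positive norms, equality says that p^2 is at most max 0 (p^2 - d / 2)
  with p > 0, which leaves only d = 0; this holds on every level. Only the modulus of F enters, so
  any two of the four functions can be taken as the pair a, b.\<close>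

lemma iterated_integral_equality:
  assumes L: "L2 a" "L2 b" "L2 c" "L2 d"
    and F: "\<And>t x. cmod (F t x) = cmod (U t a x * U t b x) * cmod (U t c x * U t d x)"
    and n: "L2_norm a \<noteq> 0" "L2_norm b \<noteq> 0" "L2_norm c \<noteq> 0" "L2_norm d \<noteq> 0"
    and eq: "cmod (of_real (2 / pi) * (LINT t:{0..pi/2}|lborel. LINT x|lborel. F t x))
      = 1 / sqrt (2 * pi) * (L2_norm a * L2_norm b * (L2_norm c * L2_norm d))"
  shows "gaussian_multiple (of_real (sqrt 2) * (hcoef a 1 / hcoef a 0)) a
    \<and> gaussian_multiple (of_real (sqrt 2) * (hcoef a 1 / hcoef a 0)) b"
proof -
  have d: "level_defect (hcoef a) (hcoef b) M = 0" for M
  proof -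
    let ?p = "L2_norm a * L2_norm b" and ?d = "level_defect (hcoef a) (hcoef b) M"
    have p: "?p > 0" "L2_norm c * L2_norm d > 0"
      using n L2_norm_nonneg[of a] L2_norm_nonneg[of b] L2_norm_nonneg[of c] L2_norm_nonneg[of d]
      by (auto simp: less_le)
    have "1 / sqrt (2 * pi) * (?p * (L2_norm c * L2_norm d))
        \<le> 1 / sqrt (2 * pi) * (sqrt (max 0 (?p\<^sup>2 - ?d / 2)) * (L2_norm c * L2_norm d))"
      using iterated_integral_bound[OF L F, of M] unfolding eq .
    then have "?p * (L2_norm c * L2_norm d) \<le> sqrt (max 0 (?p\<^sup>2 - ?d / 2)) * (L2_norm c * L2_norm d)"
      by (rule mult_left_le_imp_le) simp
    then have "?p \<le> sqrt (max 0 (?p\<^sup>2 - ?d / 2))" using p(2) by (rule mult_right_le_imp_le)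
    then have "?p\<^sup>2 \<le> (sqrt (max 0 (?p\<^sup>2 - ?d / 2)))\<^sup>2"
      using p(1) by (intro power_mono) auto
    then have "?p\<^sup>2 \<le> max 0 (?p\<^sup>2 - ?d / 2)" by simp
    moreover have "?p\<^sup>2 > 0" using p(1) by (rule zero_less_power)
    ultimately have "?d \<le> 0" by (simp add: max_def split: if_splits)
    then show ?thesis using level_defect_nonneg[of "hcoef a" "hcoef b" M] by simp
  qed
  note g = level_defect_zero_geometric[OF d hcoef_nonzero[OF L(1) n(1)] hcoef_nonzero[OF L(2) n(2)]]
  show ?thesis
    using gaussian_multipleI_hcoef[OF L(1) g(2)] gaussian_multipleI_hcoef[OF L(2) g(3)] ..
qed

section \<open>The sharp bound and its equality case\<close>

lemma E4_bound:
  assumes L: "L2 f1" "L2 f2" "L2 f3" "L2 f4"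
  shows "cmod (E4 U f1 f2 f3 f4) \<le> 1 / sqrt (2 * pi) * (L2_norm f1 * L2_norm f2 * L2_norm f3 * L2_norm f4)"
proof -
  have "cmod (E4 U f1 f2 f3 f4) \<le> 1 / sqrt (2 * pi) *
    (sqrt (max 0 ((L2_norm f1 * L2_norm f2)\<^sup>2 - level_defect (hcoef f1) (hcoef f2) 0 / 2)) * (L2_norm f3 * L2_norm f4))"
    unfolding E4_def by (rule iterated_integral_bound[OF L]) (simp add: norm_mult)
  also have "\<dots> \<le> 1 / sqrt (2 * pi) * ((L2_norm f1 * L2_norm f2) * (L2_norm f3 * L2_norm f4))"
  proof (intro mult_left_mono mult_right_mono)
    show "sqrt (max 0 ((L2_norm f1 * L2_norm f2)\<^sup>2 - level_defect (hcoef f1) (hcoef f2) 0 / 2)) \<le> L2_norm f1 * L2_norm f2"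
      using level_defect_nonneg[of "hcoef f1" "hcoef f2" 0] by (intro real_le_lsqrt) auto
  qed auto
  finally show ?thesis by (simp only: mult.assoc)
qed

text \<open>The first function is paired with each of the other three in turn. Since the parameter
  is computed from its coefficients alone, the three applications produce the same one.\<close>

lemma E4_equality:
  assumes L: "L2 f1" "L2 f2" "L2 f3" "L2 f4"
    and n: "L2_norm f1 \<noteq> 0" "L2_norm f2 \<noteq> 0" "L2_norm f3 \<noteq> 0" "L2_norm f4 \<noteq> 0"
    and eq: "cmod (E4 U f1 f2 f3 f4) = 1 / sqrt (2 * pi) * (L2_norm f1 * L2_norm f2 * L2_norm f3 * L2_norm f4)"
  shows "\<exists>\<beta>. gaussian_multiple \<beta> f1 \<and> gaussian_multiple \<beta> f2 \<and> gaussian_multiple \<beta> f3 \<and> gaussian_multiple \<beta> f4"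
proof -
  let ?\<beta> = "of_real (sqrt 2) * (hcoef f1 1 / hcoef f1 0)"
  have "gaussian_multiple ?\<beta> f1 \<and> gaussian_multiple ?\<beta> f2"
    by (rule iterated_integral_equality[OF L(1,2,3,4) _ n(1,2,3,4) eq[unfolded E4_def, THEN trans]])
       (simp_all add: norm_mult)
  moreover have "gaussian_multiple ?\<beta> f1 \<and> gaussian_multiple ?\<beta> f3"
    by (rule iterated_integral_equality[OF L(1,3,2,4) _ n(1,3,2,4) eq[unfolded E4_def, THEN trans]])
       (simp_all add: norm_mult)
  moreover have "gaussian_multiple ?\<beta> f1 \<and> gaussian_multiple ?\<beta> f4"
    by (rule iterated_integral_equality[OF L(1,4,2,3) _ n(1,4,2,3) eq[unfolded E4_def, THEN trans]])
       (simp_all add: norm_mult)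
  ultimately show ?thesis by blast
qed

lemma H4_real_nonneg: "H4 U g \<in> \<real> \<and> 0 \<le> Re (H4 U g)"
proof -
  have e: "z * z * cnj (z * z) = of_real ((cmod (z * z))\<^sup>2)" for z
    by (rule complex_norm_square[symmetric])
  have "H4 U g = of_real (2 / pi * (LINT t:{0..pi/2}|lborel. LINT x|lborel. (cmod (U t g x * U t g x))\<^sup>2))"
    unfolding H4_def E4_def e integral_complex_of_real set_lebesgue_integral_def scaleR_conv_of_real
      of_real_mult[symmetric] by simp
  moreover have "0 \<le> (LINT t:{0..pi/2}|lborel. LINT x|lborel. (cmod (U t g x * U t g x))\<^sup>2)"
    unfolding set_lebesgue_integral_def by (intro Bochner_Integration.integral_nonneg) auto
  ultimately show ?thesis by simp
qed

lemma H4_cmod: "Re (H4 U g) = cmod (H4 U g)"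
  using H4_real_nonneg[of g] by (auto elim!: Reals_cases)

end

theorem proposition4p7:
  fixes U :: "real \<Rightarrow> (real \<Rightarrow> complex) \<Rightarrow> real \<Rightarrow> complex"
    and f :: "nat \<Rightarrow> real \<Rightarrow> complex"
  assumes "is_propagator U"
    and "\<forall>k\<in>{1..4}. L2 (f k)"
  shows "cmod (E4 U (f 1) (f 2) (f 3) (f 4)) \<le> 1 / sqrt (2 * pi) * (\<Prod>k\<in>{1..4}. L2_norm (f k))
    \<and> (cmod (E4 U (f 1) (f 2) (f 3) (f 4)) = 1 / sqrt (2 * pi) * (\<Prod>k\<in>{1..4}. L2_norm (f k))
        \<longleftrightarrow> (\<exists>k\<in>{1..4}. AE x in lborel. f k x = 0)
          \<or> (\<exists>\<beta>. \<forall>k\<in>{1..4}. gaussian_multiple \<beta> (f k)))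
    \<and> (\<forall>g. L2 g \<longrightarrow>
         H4 U g \<in> \<real>
       \<and> Re (H4 U g) \<le> 1 / sqrt (2 * pi) * L2_norm g ^ 4
       \<and> (Re (H4 U g) = 1 / sqrt (2 * pi) * L2_norm g ^ 4 \<longleftrightarrow> (\<exists>\<beta>. gaussian_multiple \<beta> g)))"
proof (intro conjI allI impI)
  note P = assms(1)
  have four: "{1..4::nat} = {1, 2, 3, 4}" by auto
  have L: "L2 (f 1)" "L2 (f 2)" "L2 (f 3)" "L2 (f 4)" using assms(2) by auto
  have pr: "(\<Prod>k\<in>{1..4}. L2_norm (f k)) = L2_norm (f 1) * L2_norm (f 2) * L2_norm (f 3) * L2_norm (f 4)"
    unfolding four by simp
  show bound: "cmod (E4 U (f 1) (f 2) (f 3) (f 4)) \<le> 1 / sqrt (2 * pi) * (\<Prod>k\<in>{1..4}. L2_norm (f k))"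
    unfolding pr by (rule E4_bound[OF P L])
  show "cmod (E4 U (f 1) (f 2) (f 3) (f 4)) = 1 / sqrt (2 * pi) * (\<Prod>k\<in>{1..4}. L2_norm (f k))
        \<longleftrightarrow> (\<exists>k\<in>{1..4}. AE x in lborel. f k x = 0) \<or> (\<exists>\<beta>. \<forall>k\<in>{1..4}. gaussian_multiple \<beta> (f k))"
    (is "?eq \<longleftrightarrow> ?zero \<or> ?gauss")
  proof
    assume eq: ?eq
    show "?zero \<or> ?gauss"
    proof (cases ?zero)
      case False
      then have "L2_norm (f k) \<noteq> 0" if "k \<in> {1..4}" for k
        using that assms(2) L2_norm_eq_0 by blast
      then have "\<exists>\<beta>. gaussian_multiple \<beta> (f 1) \<and> gaussian_multiple \<beta> (f 2) \<and> gaussian_multiple \<beta> (f 3) \<and> gaussian_multiple \<beta> (f 4)"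
        using eq unfolding pr by (intro E4_equality[OF P L]) auto
      then show ?thesis unfolding four by auto
    qed simp
  next
    assume "?zero \<or> ?gauss"
    then show ?eq
    proof
      assume ?zero
      then obtain k where "k \<in> {1..4}" "L2_norm (f k) = 0"
        using assms(2) L2_norm_eq_0 by blast
      then have z: "(\<Prod>k\<in>{1..4}. L2_norm (f k)) = 0" by (intro prod_zero) auto
      \<comment> \<open>With right-hand side 0 the bound itself forces the functional to
        vanish.\<close>
      show ?eq using bound unfolding z by simp
    next
      assume ?gauss
      then obtain \<beta> where "gaussian_multiple \<beta> (f 1)" "gaussian_multiple \<beta> (f 2)"
          "gaussian_multiple \<beta> (f 3)" "gaussian_multiple \<beta> (f 4)"
        unfolding four by blast
      then show ?eq unfolding pr by (rule E4_gaussian[OF P L])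
    qed
  qed
  fix g assume g: "L2 g"
  have p4: "L2_norm g * L2_norm g * L2_norm g * L2_norm g = L2_norm g ^ 4"
    by (simp add: eval_nat_numeral)
  show "H4 U g \<in> \<real>" using H4_real_nonneg[OF P] by simp
  show "Re (H4 U g) \<le> 1 / sqrt (2 * pi) * L2_norm g ^ 4"
    unfolding H4_cmod[OF P] unfolding H4_def p4[symmetric] by (rule E4_bound[OF P g g g g])
  show "Re (H4 U g) = 1 / sqrt (2 * pi) * L2_norm g ^ 4 \<longleftrightarrow> (\<exists>\<beta>. gaussian_multiple \<beta> g)"
  proof
    assume eq: "Re (H4 U g) = 1 / sqrt (2 * pi) * L2_norm g ^ 4"
    show "\<exists>\<beta>. gaussian_multiple \<beta> g"
    proof (cases "L2_norm g = 0")
      case True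
      \<comment> \<open>The zero function counts as a multiple of any Gaussian, with factor 0, so no
        separate alternative is needed for a single function.\<close>
      then have "gaussian_multiple 0 g"
        unfolding L2_norm_eq_0[OF g] gaussian_multiple_def by (intro exI[of _ 0]) simp
      then show ?thesis ..
    next
      case False
      have "cmod (E4 U g g g g) = 1 / sqrt (2 * pi) * (L2_norm g * L2_norm g * L2_norm g * L2_norm g)"
        using eq unfolding H4_cmod[OF P] p4 unfolding H4_def .
      from E4_equality[OF P g g g g False False False False this] show ?thesis by blast
    qed
  next
    assume "\<exists>\<beta>. gaussian_multiple \<beta> g"
    then show "Re (H4 U g) = 1 / sqrt (2 * pi) * L2_norm g ^ 4"
      unfolding H4_cmod[OF P] unfolding H4_def p4[symmetric] using E4_gaussian[OF P g g g g] by blast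
  qed
qed

end
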